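(* Let $\ell\ge 2$ be an integer and let $x>0$ be real. For each $n$, let $\mathsf{K}_{\ell,n}$ be the number of joint orbits on $[n]$ of a random $\ell$-tuple of pairwise commuting permutations of $[n]$ sampled according to the measure $\mathbb{P}_{\ell,n,x}$ (under which each commuting tuple has probability proportional to $x$ raised to its number of joint orbits). Then, as $n\to\infty$, \[ \mathbb{E}\,\mathsf{K}_{\ell,n}\sim \frac{(x\mathcal{K}_{\ell})^{1/\ell}}{\ell-1}\, n^{\frac{\ell-1}{\ell}},\qquad \mathrm{Var}(\mathsf{K}_{\ell,n})\sim \frac{(x\mathcal{K}_{\ell})^{1/\ell}}{\ell(\ell-1)}\, n^{\frac{\ell-1}{\ell}}, \] where $\mathcal{K}_{\ell}=(\ell-1)!\,\zeta(2)\zeta(3)\cdots\zeta(\ell)$. Moreover, the normalized random variables \[ \frac{\mathsf{K}_{\ell,n}-\mathbb{E}\,\mathsf{K}_{\ell,n}}{\sqrt{\mathrm{Var}(\mathsf{K}_{\ell,n})}} \] converge in distribution and in the sense of moments to the standard Gaussian $\mathcal{N}(0,1)$; that is, \[ \lim_{n\to\infty}\mathbb{E}\left[f\left(\frac{\mathsf{K}_{\ell,n}-\mathbb{E}\,\mathsf{K}_{\ell,n}}{\sqrt{\mathrm{Var}(\mathsf{K}_{\ell,n})}}\right)\right]=\frac{1}{\sqrt{2\pi}}\int_{-\infty}^{\infty}f(s)\,e^{-s^2/2}\,\mathrm{d}s \] for every function $f:\mathbb{R}\to\mathbb{R}$ that is either bounded and continuous, or a polynomial.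
   Context: Let $[n]=\{1,\dots,n\}$ and let $\mathfrak{S}_n$ be the symmetric group on $[n]$. Let \[ \mathcal{C}_{\ell,n}=\{(\sigma_1,\dots,\sigma_\ell)\in\mathfrak{S}_n^{\ell}\ :\ \sigma_i\sigma_j=\sigma_j\sigma_i \text{ for all } i,j\}. \] For $(\sigma_1,\dots,\sigma_\ell)\in\mathcal{C}_{\ell,n}$, let $\kappa_{\ell,n}(\sigma_1,\dots,\sigma_\ell)$ be the number of orbits of the subgroup $\langle\sigma_1,\dots,\sigma_\ell\rangle$ of $\mathfrak{S}_n$ acting on $[n]$. Let $A(\ell,n,k)$ be the number of tuples in $\mathcal{C}_{\ell,n}$ with $\kappa_{\ell,n}=k$, and let \[ \mathcal{H}_{\ell,n}(x)=\frac{1}{n!}\sum_{k=0}^{n}A(\ell,n,k)\,x^k . \] For $x>0$, $\mathbb{P}_{\ell,n,x}$ is the probability measure on $\mathcal{C}_{\ell,n}$ with \[ \mathbb{P}_{\ell,n,x}(\{(\sigma_1,\dots,\sigma_\ell)\})=\frac{x^{\kappa_{\ell,n}(\sigma_1,\dots,\sigma_\ell)}}{n!\,\mathcal{H}_{\ell,n}(x)}, \] and $\mathsf{K}_{\ell,n}=\kappa_{\ell,n}(\sigma_1,\dots,\sigma_\ell)$ for $(\sigma_1,\dots,\sigma_\ell)$ sampled from $\mathbb{P}_{\ell,n,x}$. Expectation and variance are with respect to $\mathbb{P}_{\ell,n,x}$. Here $\zeta$ is the Riemann zeta function, and $f(u)\sim g(u)$ means that $f(u)/g(u)\to 1$ in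 the stated limit. *)

theory Defs
  imports
    "HOL-Probability.Probability"
    "HOL-Algebra.Sym_Groups"
    "HOL-Algebra.Group_Action"
    "HOL-Library.Landau_Symbols"
begin

text \<open>Tuples of permutations are lists; the library's \<open>sym_group n\<close> acts on \<open>{1..n}\<close>.\<close>

definition commuting_tuples :: "nat \<Rightarrow> nat \<Rightarrow> (nat \<Rightarrow> nat) list set" where
  "commuting_tuples l n =
     {\<sigma>. length \<sigma> = l \<and> set \<sigma> \<subseteq> carrier (sym_group n) \<and>
         (\<forall>i<l. \<forall>j<l. \<sigma> ! i \<otimes>\<^bsub>sym_group n\<^esub> \<sigma> ! j = \<sigma> ! j \<otimes>\<^bsub>sym_group n\<^esub> \<sigma> ! i)}"

definition num_orbits :: "nat \<Rightarrow> (nat \<Rightarrow> nat) list \<Rightarrow> nat" where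
  "num_orbits n \<sigma> =
     card (orbits (subgroup_generated (sym_group n) (set \<sigma>)) {1..n} (\<lambda>g. g))"

definition orbit_count_number :: "nat \<Rightarrow> nat \<Rightarrow> nat \<Rightarrow> nat" where
  "orbit_count_number l n k = card {\<sigma> \<in> commuting_tuples l n. num_orbits n \<sigma> = k}"

definition orbit_poly :: "nat \<Rightarrow> nat \<Rightarrow> real \<Rightarrow> real" where
  "orbit_poly l n x = 1 / fact n * (\<Sum>k=0..n. real (orbit_count_number l n k) * x ^ k)"

definition tuple_measure :: "nat \<Rightarrow> nat \<Rightarrow> real \<Rightarrow> (nat \<Rightarrow> nat) list measure" where
  "tuple_measure l n x =
     point_measure (commuting_tuples l n)
       (\<lambda>\<sigma>. ennreal (x ^ num_orbits n \<sigma> / (fact n * orbit_poly l n x)))"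

definition mean_orbits :: "nat \<Rightarrow> real \<Rightarrow> nat \<Rightarrow> real" where
  "mean_orbits l x n =
     prob_space.expectation (tuple_measure l n x) (\<lambda>\<sigma>. real (num_orbits n \<sigma>))"

definition var_orbits :: "nat \<Rightarrow> real \<Rightarrow> nat \<Rightarrow> real" where
  "var_orbits l x n =
     prob_space.variance (tuple_measure l n x) (\<lambda>\<sigma>. real (num_orbits n \<sigma>))"

text \<open>The Riemann zeta function on the half-line \<open>s > 1\<close>, where it is given by its
  Dirichlet series (only \<open>zeta 2, zeta 3, \<dots>\<close> are needed).\<close>

definition zeta :: "real \<Rightarrow> real" where
  "zeta s = (\<Sum>m. 1 / real (Suc m) powr s)"

definition zeta_const :: "nat \<Rightarrow> real" where
  "zeta_const l = fact (l - 1) * (\<Prod>j=2..l. zeta (real j))"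

text \<open>The following facts show that the definitions above are meaningful: the weights are
  positive and \<open>tuple_measure\<close> is a probability measure.\<close>

lemma finite_commuting_tuples: "finite (commuting_tuples l n)"
proof (rule finite_subset)
  show "commuting_tuples l n \<subseteq> {\<sigma>. set \<sigma> \<subseteq> {p. p permutes {1..n}} \<and> length \<sigma> = l}"
    by (auto simp: commuting_tuples_def sym_group_def)
  show "finite {\<sigma>. set \<sigma> \<subseteq> {p. p permutes {1..n}} \<and> length \<sigma> = l}"
    by (intro finite_lists_length_eq finite_permutations) simp
qed

lemma replicate_id_in_commuting_tuples: "replicate l id \<in> commuting_tuples l n"
  by (auto simp: commuting_tuples_def sym_group_def permutes_id)

lemma num_orbits_le: "num_orbits n \<sigma> \<le> n"
proof -
  have "orbits (subgroup_generated (sym_group n) (set \<sigma>)) {1..n} (\<lambda>g. g) =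
        orbit (subgroup_generated (sym_group n) (set \<sigma>)) (\<lambda>g. g) ` {1..n}"
    by (auto simp: orbits_def)
  then show ?thesis
    unfolding num_orbits_def using card_image_le[of "{1..n}"] by simp
qed

lemma orbit_poly_eq:
  "fact n * orbit_poly l n x = (\<Sum>\<sigma>\<in>commuting_tuples l n. x ^ num_orbits n \<sigma>)"
proof -
  have "(\<Sum>\<sigma>\<in>commuting_tuples l n. x ^ num_orbits n \<sigma>) =
        (\<Sum>k=0..n. \<Sum>\<sigma>\<in>{\<sigma> \<in> commuting_tuples l n. num_orbits n \<sigma> = k}. x ^ num_orbits n \<sigma>)"
    by (rule sum.group[symmetric]) (auto simp: finite_commuting_tuples num_orbits_le)
  also have "\<dots> = (\<Sum>k=0..n. real (orbit_count_number l n k) * x ^ k)"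
    by (simp add: orbit_count_number_def)
  finally show ?thesis
    by (simp add: orbit_poly_def)
qed

lemma orbit_poly_pos: "x > 0 \<Longrightarrow> fact n * orbit_poly l n x > 0"
  unfolding orbit_poly_eq
  by (rule sum_pos2[OF finite_commuting_tuples replicate_id_in_commuting_tuples]) auto

lemma prob_space_tuple_measure:
  assumes "x > 0"
  shows "prob_space (tuple_measure l n x)"
proof -
  let ?w = "\<lambda>\<sigma>. x ^ num_orbits n \<sigma> / (fact n * orbit_poly l n x)"
  have "(\<Sum>\<sigma>\<in>commuting_tuples l n. ennreal (?w \<sigma>)) = ennreal (\<Sum>\<sigma>\<in>commuting_tuples l n. ?w \<sigma>)"
    using assms orbit_poly_pos[OF assms, of n l]
    by (intro sum_ennreal divide_nonneg_pos) auto
  also have "(\<Sum>\<sigma>\<in>commuting_tuples l n. ?w \<sigma>) = 1"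
    using orbit_poly_pos[OF assms, of n l]
    by (auto simp: sum_divide_distrib[symmetric] orbit_poly_eq[symmetric])
  finally show ?thesis
    unfolding tuple_measure_def
    by (intro prob_spaceI)
       (simp add: space_point_measure emeasure_point_measure_finite finite_commuting_tuples)
qed

end

(*
The numbers H_n(y) of commuting l-tuples weighted by y^(number of orbits), divided by n!, satisfy
sum_n H_n(y) u^n = exp (y * sum_j a_l(j)/j u^j), where (j-1)! a_l(j) counts the transitive tuples
on j points and a_{l+1}(n) is the sum of d * a_l(d) over the divisors d of n.  This recursion in l
yields sum_n a_l(n) n^(k-1) e^(-nt) ~ (l+k-2)! zeta(2)...zeta(l) t^(-(l+k-1)) as t -> 0.

For fixed n take the saddle point t with x * sum_j a_l(j) e^(-jt) = n.  Cauchy's formula on the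
circle of radius e^(-t), with y = x e^(z/sd), writes the exponential moment at z of the orbit count,
centred at mu = x * sum_j a_l(j)/j e^(-jt) and scaled by sd, as a quotient of two integrals over the
angle.  After rescaling the angle by t^((l+1)/2) the integrands converge to Gaussians and are
dominated by a multiple of 1/(1+s^2), so dominated convergence gives the limit of the exponential
moments without any further saddle point expansion in z.  The characteristic functions converge to
the Gaussian one, the exponential moments at real z stay bounded, and truncation upgrades weak
convergence to convergence of all moments; the first two moments then identify the asymptotics of
mean and variance and allow the exact normalization.
*)
theory Submission
  imports Defs "HOL-Complex_Analysis.Complex_Analysis" "HOL-Real_Asymp.Real_Asymp"
begin

section \<open>Orbits of commuting permutations\<close>

text \<open>At parameter e^(-t) the numbers of orbits of each size j behave like independent Poisson
  variables with means \<open>wt t j\<close>, conditioned on total size n; the angular integral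
  performs the conditioning. Let N be the number of orbits and T the total size. Without
  conditioning, N has variance \<open>G 0\<close>, T has variance \<open>G 2\<close>, and their
  covariance is \<open>G 1\<close>. Conditioning leaves \<open>G 0 - (G 1)^2 / G 2\<close>, to
  leading order the fraction 1/l of \<open>G 0\<close>. This is the origin of the factor 1/l between
  variance and mean, and of \<open>var0\<close> and \<open>cov\<close>. The tilt z/sd moves the
  saddle point only within the width of the peak, so it enters the limit integrand as a cross term
  between z and the rescaled angle s, and a circle independent of z is enough. Away from angle 0 the
  arithmetically irregular coefficients are controlled only from below: a_l(j)/j >= 1 for l >= 2
  compares the sum with a geometric series. The resulting decay exp (-c/t) is smaller than any power
  of t.\<close>

inductive_set orb :: "('a \<Rightarrow> 'a) list \<Rightarrow> 'a \<Rightarrow> 'a set" for gs x where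
  orb_base: "x \<in> orb gs x"
| orb_step: "y \<in> orb gs x \<Longrightarrow> g \<in> set gs \<Longrightarrow> g y \<in> orb gs x"

text \<open>The set S is a parameter because the recursion removes the orbit of a point and
  continues on its complement.\<close>

definition comm_tuples :: "nat \<Rightarrow> 'a set \<Rightarrow> ('a \<Rightarrow> 'a) list set" where
  "comm_tuples l S = {gs. length gs = l \<and> (\<forall>g\<in>set gs. g permutes S) \<and>
     (\<forall>g\<in>set gs. \<forall>h\<in>set gs. g \<circ> h = h \<circ> g)}"

definition trans_tuples :: "nat \<Rightarrow> 'a set \<Rightarrow> ('a \<Rightarrow> 'a) list set" where
  "trans_tuples l S = {gs \<in> comm_tuples l S. \<forall>x\<in>S. orb gs x = S}"

definition num_orb :: "'a set \<Rightarrow> ('a \<Rightarrow> 'a) list \<Rightarrow> nat" where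
  "num_orb S gs = card (orb gs ` S)"

text \<open>Identity off B, so that the restriction to an invariant finite B is a permutation of B
  in the sense of \<open>permutes\<close>.\<close>

definition restr :: "'a set \<Rightarrow> ('a \<Rightarrow> 'a) \<Rightarrow> 'a \<Rightarrow> 'a" where
  "restr B g x = (if x \<in> B then g x else x)"

text \<open>The number of subgroups of index \<open>n\<close> of the free abelian group of rank \<open>l\<close>; junk value
  \<open>0\<close> at \<open>n = 0\<close>, where the set of divisors is infinite.\<close>

fun sublattices :: "nat \<Rightarrow> nat \<Rightarrow> nat" where
  "sublattices 0 n = (if n = 1 then 1 else 0)"
| "sublattices (Suc l) n = (\<Sum>d | d dvd n. d * sublattices l d)"

section \<open>Forward closures under the generators, compared with group orbits\<close>

lemma orb_least: "x \<in> A \<Longrightarrow> (\<And>y g. y \<in> A \<Longrightarrow> g \<in> set gs \<Longrightarrow> g y \<in> A) \<Longrightarrow> orb gs x \<subseteq> A"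
proof
  fix y assume A: "x \<in> A" "\<And>y g. y \<in> A \<Longrightarrow> g \<in> set gs \<Longrightarrow> g y \<in> A" and "y \<in> orb gs x"
  from this(3) show "y \<in> A" by induction (use A in auto)
qed

lemma orb_nth: "y \<in> orb gs x \<Longrightarrow> i < length gs \<Longrightarrow> (gs ! i) y \<in> orb gs x"
  by (auto intro: orb_step)

lemma orb_trans: "y \<in> orb gs x \<Longrightarrow> orb gs y \<subseteq> orb gs x"
  by (rule orb_least) (auto intro: orb_step)

lemma orb_cong_subset:
  assumes "length gs = length gs'" "x \<in> A"
    and "\<And>i y. i < length gs \<Longrightarrow> y \<in> A \<Longrightarrow> (gs ! i) y = (gs' ! i) y"
    and "\<And>i y. i < length gs \<Longrightarrow> y \<in> A \<Longrightarrow> (gs ! i) y \<in> A"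
  shows "orb gs x \<subseteq> orb gs' x"
proof -
  \<comment> \<open>The induction runs in the intersection with A: the two tuples agree only there,
    so membership in A has to be carried along.\<close>
  have "orb gs x \<subseteq> orb gs' x \<inter> A"
    using assms by (intro orb_least) (auto simp: in_set_conv_nth intro: orb_base orb_nth)
  then show ?thesis by auto
qed

lemma orb_cong:
  assumes "length gs = length gs'" "x \<in> A"
    and "\<And>i y. i < length gs \<Longrightarrow> y \<in> A \<Longrightarrow> (gs ! i) y = (gs' ! i) y"
    and "\<And>i y. i < length gs \<Longrightarrow> y \<in> A \<Longrightarrow> (gs ! i) y \<in> A"
  shows "orb gs x = orb gs' x"
  using orb_cong_subset[OF assms] orb_cong_subset[of gs' gs x A] assms
  by (metis subset_antisym)

lemma permutes_closed_image:
  assumes "g permutes S" "finite B" "g ` B \<subseteq> B"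
  shows "g ` B = B"
  using assms by (metis endo_inj_surj inj_on_subset permutes_inj subset_UNIV)

lemma restr_permutes:
  assumes "g permutes S" "finite B" "g ` B \<subseteq> B"
  shows "restr B g permutes B"
proof (rule bij_imp_permutes)
  have "bij_betw g B B"
    using assms permutes_closed_image[OF assms]
    by (metis bij_betw_def inj_on_subset permutes_inj subset_UNIV)
  then show "bij_betw (restr B g) B B"
    by (subst bij_betw_cong[of B "restr B g" g]) (auto simp: restr_def)
qed (auto simp: restr_def)

lemma permutes_closed_Diff:
  assumes "g permutes S" "finite B" "g ` B \<subseteq> B"
  shows "g ` (S - B) \<subseteq> S - B"
proof -
  have "g ` (S - B) = g ` S - g ` B" using assms(1)
    by (metis inj_on_image_set_diff permutes_inj sup_ge1 Diff_subset image_set_diff)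
  then show ?thesis using assms permutes_closed_image[OF assms] permutes_image[OF assms(1)] by auto
qed

lemma orb_subset:
  assumes "\<And>g. g \<in> set gs \<Longrightarrow> g permutes S" "x \<in> S"
  shows "orb gs x \<subseteq> S"
  by (rule orb_least) (use assms permutes_in_image in fastforce)+

text \<open>Although \<open>orb\<close> never applies an inverse, every step can be undone: on a
  finite set an injective g maps a g-stable set onto itself.\<close>

lemma orb_sym:
  assumes "\<And>g. g \<in> set gs \<Longrightarrow> g permutes S" "finite S" "x \<in> S" "y \<in> orb gs x"
  shows "x \<in> orb gs y"
  using assms(4)
proof induction
  case orb_base then show ?case by (rule orb.orb_base)
next
  case (orb_step y g)
  have yS: "y \<in> S" using orb_subset[OF assms(1,3)] orb_step by auto
  then have "g y \<in> S" using assms(1)[OF orb_step(2)] by (simp add: permutes_in_image)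
  then have fin: "finite (orb gs (g y))"
    using orb_subset[OF assms(1)] assms(2) finite_subset by metis
  have "g ` orb gs (g y) = orb gs (g y)"
    by (rule permutes_closed_image[OF assms(1)[OF orb_step(2)] fin])
       (use orb_step in \<open>auto intro: orb.orb_step\<close>)
  then have "g y \<in> g ` orb gs (g y)" using orb.orb_base by metis
  then have "y \<in> orb gs (g y)"
    using permutes_inj[OF assms(1)[OF orb_step(2)]] by (auto dest: injD)
  then show ?case using orb_trans orb_step.IH by fast
qed

lemma orb_eq:
  assumes "\<And>g. g \<in> set gs \<Longrightarrow> g permutes S" "finite S" "x \<in> S" "y \<in> orb gs x"
  shows "orb gs y = orb gs x"
  using orb_trans[OF assms(4)] orb_trans[OF orb_sym[OF assms]] by blast

lemma permutes_inv_closed: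
  assumes "g permutes S" "finite S" "x \<in> S" "\<And>y. y \<in> A \<Longrightarrow> g y \<in> A" "x \<in> A" "A \<subseteq> S"
  shows "inv_into UNIV g x \<in> A"
proof -
  have "g ` A = A" using assms by (intro permutes_closed_image[of g S]) (auto dest: finite_subset)
  then obtain a where "a \<in> A" "x = g a" using assms(5) by (metis imageE)
  then show ?thesis using permutes_inverses[OF assms(1)] by simp
qed

text \<open>Bridge to the group orbits of the definitions. One inclusion holds because the closure
  is stable under inverses, by finiteness; the other writes each reached point as the image of x
  under a word in the generators.\<close>

lemma orbit_subgroup_generated:
  assumes "set gs \<subseteq> carrier (sym_group n)" "x \<in> {1..n}"
  shows "orbit (subgroup_generated (sym_group n) (set gs)) (\<lambda>g. g) x = orb gs x"
proof -
  interpret G: group "sym_group n" by (rule sym_group_is_group)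
  have perm: "\<And>g. g \<in> set gs \<Longrightarrow> g permutes {1..n}"
    using assms by (auto simp: sym_group_carrier)
  have car: "carrier (subgroup_generated (sym_group n) (set gs)) = generate (sym_group n) (set gs)"
    using assms by (simp add: carrier_subgroup_generated Int_absorb1)
  have sub: "orb gs x \<subseteq> {1..n}" by (rule orb_subset[OF perm assms(2)])
  have "g y \<in> orb gs x" if "g \<in> generate (sym_group n) (set gs)" "y \<in> orb gs x" for g y
    using that
  proof (induction arbitrary: y)
    case (inv h)
    have "inv\<^bsub>sym_group n\<^esub> h = inv_into UNIV h"
      using inv assms by (auto intro!: sym_group_inv_equality)
    moreover have "inv_into UNIV h y \<in> orb gs x"
      by (rule permutes_inv_closed[OF perm[OF inv(1)]])
         (use inv sub in \<open>auto intro: orb_step\<close>)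
    ultimately show ?case by simp
  qed (auto simp: sym_group_one sym_group_mult intro: orb_step)
  then have 1: "{g x |g. g \<in> generate (sym_group n) (set gs)} \<subseteq> orb gs x"
    using orb_base by fastforce
  have "\<exists>g\<in>generate (sym_group n) (set gs). y = g x" if "y \<in> orb gs x" for y
    using that
  proof induction
    case orb_base
    show ?case by (rule bexI[OF _ generate.one]) (simp add: sym_group_one)
  next
    case (orb_step y g)
    then obtain h where h: "h \<in> generate (sym_group n) (set gs)" "y = h x" by auto
    have "g \<circ> h \<in> generate (sym_group n) (set gs)"
      using generate.eng[OF generate.incl[OF orb_step(2)] h(1)] by (simp add: sym_group_mult)
    then show ?case using h(2) by (intro bexI[of _ "g \<circ> h"]) simp_all
  qed
  with 1 show ?thesis unfolding orbit_def car by blast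
qed

lemma commuting_tuples_eq: "commuting_tuples l n = comm_tuples l {1..n}"
  unfolding commuting_tuples_def comm_tuples_def
  by (auto simp: sym_group_carrier sym_group_mult in_set_conv_nth subset_iff; metis nth_mem)

lemma num_orbits_eq:
  assumes "gs \<in> commuting_tuples l n"
  shows "num_orbits n gs = num_orb {1..n} gs"
proof -
  have "set gs \<subseteq> carrier (sym_group n)" using assms by (auto simp: commuting_tuples_def)
  from orbit_subgroup_generated[OF this]
  have "orbits (subgroup_generated (sym_group n) (set gs)) {1..n} (\<lambda>g. g) = orb gs ` {1..n}"
    unfolding orbits_def Setcompr_eq_image by (rule image_cong[OF refl])
  then show ?thesis by (simp add: num_orbits_def num_orb_def)
qed

section \<open>Restriction and recombination of commuting tuples\<close>

lemma finite_comm_tuples: "finite S \<Longrightarrow> finite (comm_tuples l S)"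
  by (rule finite_subset[OF _ finite_lists_length_eq[OF finite_permutations[of S], of l]])
     (auto simp: comm_tuples_def)

lemma finite_trans_tuples: "finite S \<Longrightarrow> finite (trans_tuples l S)"
  by (rule finite_subset[OF _ finite_comm_tuples]) (auto simp: trans_tuples_def)

lemma comm_tuplesD:
  assumes "gs \<in> comm_tuples l S"
  shows "length gs = l" "g \<in> set gs \<Longrightarrow> g permutes S"
    "g \<in> set gs \<Longrightarrow> h \<in> set gs \<Longrightarrow> g (h x) = h (g x)"
    "i < l \<Longrightarrow> (gs ! i) permutes S"
    "i < l \<Longrightarrow> j < l \<Longrightarrow> (gs ! i) ((gs ! j) x) = (gs ! j) ((gs ! i) x)"
  using assms unfolding comm_tuples_def by (auto simp: fun_eq_iff)

text \<open>Commutation has to be checked on S only, because all entries fix the points off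
  S.\<close>

lemma comm_tuplesI:
  assumes "length gs = l" "\<And>i. i < l \<Longrightarrow> (gs ! i) permutes S"
    "\<And>i j x. i < l \<Longrightarrow> j < l \<Longrightarrow> x \<in> S \<Longrightarrow> (gs ! i) ((gs ! j) x) = (gs ! j) ((gs ! i) x)"
  shows "gs \<in> comm_tuples l S"
proof -
  have "(gs ! i) ((gs ! j) x) = (gs ! j) ((gs ! i) x)" if "i < l" "j < l" for i j x
    using assms(3)[OF that] permutes_not_in[OF assms(2)[OF that(1)]] permutes_not_in[OF assms(2)[OF that(2)]]
    by (cases "x \<in> S") simp_all
  then show ?thesis using assms(1,2) unfolding comm_tuples_def
    by (force simp: in_set_conv_nth)
qed

lemma restr_comm_tuples:
  assumes "gs \<in> comm_tuples l S" "finite B" "\<And>g. g \<in> set gs \<Longrightarrow> g ` B \<subseteq> B"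
  shows "map (restr B) gs \<in> comm_tuples l B"
proof (rule comm_tuplesI)
  note D = comm_tuplesD[OF assms(1)]
  show "length (map (restr B) gs) = l" using D by simp
  show "map (restr B) gs ! i permutes B" if "i < l" for i
    using that assms restr_permutes[OF D(4)[OF that] assms(2)] D(1) by simp
  show "(map (restr B) gs ! i) ((map (restr B) gs ! j) x) = (map (restr B) gs ! j) ((map (restr B) gs ! i) x)"
    if "i < l" "j < l" "x \<in> B" for i j x
    using that D(1) D(5)[OF that(1,2)] assms(3)[of "gs ! i"] assms(3)[of "gs ! j"]
    by (auto simp: restr_def image_subset_iff)
qed

lemma orb_restr:
  assumes "\<And>g. g \<in> set gs \<Longrightarrow> g ` B \<subseteq> B" "x \<in> B"
  shows "orb (map (restr B) gs) x = orb gs x"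
proof (rule orb_cong[of _ _ _ B])
  show "(map (restr B) gs ! i) y \<in> B" if "i < length (map (restr B) gs)" "y \<in> B" for i y
    using that assms(1)[of "gs ! i"] by (auto simp: restr_def)
qed (use assms in \<open>auto simp: restr_def\<close>)

lemma orb_closed: "g \<in> set gs \<Longrightarrow> g ` orb gs x \<subseteq> orb gs x"
  by (auto intro: orb_step)

lemma restr_orb_trans:
  assumes "gs \<in> comm_tuples l S" "finite S" "p \<in> S"
  shows "map (restr (orb gs p)) gs \<in> trans_tuples l (orb gs p)"
proof -
  note D = comm_tuplesD[OF assms(1)]
  have fin: "finite (orb gs p)" by (rule finite_subset[OF orb_subset[OF D(2) assms(3)] assms(2)])
  have "orb (map (restr (orb gs p)) gs) x = orb gs p" if "x \<in> orb gs p" for x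
    using orb_restr[OF orb_closed that] orb_eq[OF D(2) assms(2,3) that] by simp
  then show ?thesis unfolding trans_tuples_def
    using restr_comm_tuples[OF assms(1) fin orb_closed] by blast
qed

lemma trans_tuplesI:
  assumes "gs \<in> comm_tuples l S" "finite S" "p \<in> S" "S \<subseteq> orb gs p"
  shows "gs \<in> trans_tuples l S"
  using assms orb_eq[of gs S p] comm_tuplesD(2)[OF assms(1)] orb_subset[of gs S p] unfolding trans_tuples_def
  by blast

text \<open>A block of size j that contains the fixed point p has j - 1 further elements to choose.
  The same sum evaluates both recursions over the block of p, for all tuples and for transitive
  ones.\<close>

lemma sum_subsets_containing:
  fixes f :: "nat \<Rightarrow> 'b::comm_semiring_1"
  assumes "finite S" "p \<in> S"
  shows "(\<Sum>B | p \<in> B \<and> B \<subseteq> S. f (card B)) =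
    (\<Sum>j=1..card S. of_nat ((card S - 1) choose (j - 1)) * f j)"
proof -
  let ?A = "{B. p \<in> B \<and> B \<subseteq> S}"
  have fin: "finite ?A" using assms by simp
  have "card ` ?A \<subseteq> {1..card S}"
    using assms by (auto intro: card_mono simp: Suc_le_eq card_gt_0_iff dest: finite_subset)
  then have "(\<Sum>B\<in>?A. f (card B)) = (\<Sum>j=1..card S. \<Sum>B | B \<in> ?A \<and> card B = j. f (card B))"
    using fin by (intro sum.group[symmetric]) auto
  also have "\<dots> = (\<Sum>j=1..card S. of_nat ((card S - 1) choose (j - 1)) * f j)"
  proof (rule sum.cong[OF refl])
    fix j assume j: "j \<in> {1..card S}"
    have "bij_betw (insert p) {B. B \<subseteq> S - {p} \<and> card B = j - 1} {B. B \<in> ?A \<and> card B = j}"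
    proof (rule bij_betwI[where g = "\<lambda>B. B - {p}"])
      have fB: "finite B" if "B \<subseteq> S" for B using that assms finite_subset by auto
      show "insert p \<in> {B. B \<subseteq> S - {p} \<and> card B = j - 1} \<rightarrow> {B. B \<in> ?A \<and> card B = j}"
        using assms j fB by (auto simp: card_insert_if subset_Diff_insert)
      show "(\<lambda>B. B - {p}) \<in> {B. B \<in> ?A \<and> card B = j} \<rightarrow> {B. B \<subseteq> S - {p} \<and> card B = j - 1}"
        using assms j fB by auto
    qed auto
    then have "card {B. B \<in> ?A \<and> card B = j} = (card S - 1) choose (j - 1)"
      using assms by (simp add: n_subsets bij_betw_same_card[symmetric])
    then show "(\<Sum>B | B \<in> ?A \<and> card B = j. f (card B)) = of_nat ((card S - 1) choose (j - 1)) * f j"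
      by simp
  qed
  finally show ?thesis .
qed

text \<open>Entries supported on B and on S - B do not interfere: the composite acts as
  \<open>rs\<close> on B and as \<open>hs\<close> on S - B. Hence composition inverts the pair of
  restrictions and keeps the orbits.\<close>

lemma comp_tuples:
  assumes rs: "rs \<in> comm_tuples l B" and hs: "hs \<in> comm_tuples l (S - B)" and "B \<subseteq> S"
  shows "map2 (\<circ>) rs hs \<in> comm_tuples l S"
    and "i < l \<Longrightarrow> x \<in> B \<Longrightarrow> (map2 (\<circ>) rs hs ! i) x = (rs ! i) x"
    and "i < l \<Longrightarrow> x \<in> S - B \<Longrightarrow> (map2 (\<circ>) rs hs ! i) x = (hs ! i) x"
    and "map (restr B) (map2 (\<circ>) rs hs) = rs"
    and "map (restr (S - B)) (map2 (\<circ>) rs hs) = hs"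
    and "x \<in> B \<Longrightarrow> orb (map2 (\<circ>) rs hs) x = orb rs x"
    and "x \<in> S - B \<Longrightarrow> orb (map2 (\<circ>) rs hs) x = orb hs x"
proof -
  note R = comm_tuplesD[OF rs] and E = comm_tuplesD[OF hs]
  have len: "length (map2 (\<circ>) rs hs) = l" using R E by simp
  have nth: "map2 (\<circ>) rs hs ! i = rs ! i \<circ> hs ! i" if "i < l" for i
    using that R E by simp
  have B: "(map2 (\<circ>) rs hs ! i) x = (rs ! i) x" if "i < l" "x \<in> B" for i x
    using that nth[OF that(1)] permutes_not_in[OF E(4)[OF that(1)]] by simp
  have C: "(map2 (\<circ>) rs hs ! i) x = (hs ! i) x" if "i < l" "x \<in> S - B" for i x
  proof -
    have "(hs ! i) x \<in> S - B" using that permutes_in_image[OF E(4)[OF that(1)]] by blast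
    then show ?thesis using that nth[OF that(1)] permutes_not_in[OF R(4)[OF that(1)]] by simp
  qed
  show "i < l \<Longrightarrow> x \<in> B \<Longrightarrow> (map2 (\<circ>) rs hs ! i) x = (rs ! i) x" by (rule B)
  show "i < l \<Longrightarrow> x \<in> S - B \<Longrightarrow> (map2 (\<circ>) rs hs ! i) x = (hs ! i) x" by (rule C)
  have Bin: "(rs ! i) x \<in> B" if "i < l" "x \<in> B" for i x
    using permutes_in_image[OF R(4)[OF that(1)]] that by blast
  have Cin: "(hs ! i) x \<in> S - B" if "i < l" "x \<in> S - B" for i x
    using permutes_in_image[OF E(4)[OF that(1)]] that by blast
  show "map2 (\<circ>) rs hs \<in> comm_tuples l S"
  proof (rule comm_tuplesI[OF len])
    show "map2 (\<circ>) rs hs ! i permutes S" if "i < l" for i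
      unfolding nth[OF that]
      by (rule permutes_compose)
         (use permutes_subset[OF R(4)[OF that]] permutes_subset[OF E(4)[OF that]] assms(3) in auto)
    fix i j x assume i: "i < l" and j: "j < l" and x: "x \<in> S"
    show "(map2 (\<circ>) rs hs ! i) ((map2 (\<circ>) rs hs ! j) x) = (map2 (\<circ>) rs hs ! j) ((map2 (\<circ>) rs hs ! i) x)"
    proof (cases "x \<in> B")
      case True
      then show ?thesis using i j Bin B R(5) by metis
    next
      case False
      then have "x \<in> S - B" using x by simp
      then show ?thesis using i j Cin C E(5) by metis
    qed
  qed
  show "map (restr B) (map2 (\<circ>) rs hs) = rs"
  proof (rule nth_equalityI)
    fix i assume "i < length (map (restr B) (map2 (\<circ>) rs hs))"
    then have i: "i < l" using len by (metis length_map)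
    have "restr B (map2 (\<circ>) rs hs ! i) x = (rs ! i) x" for x
      using B[OF i] permutes_not_in[OF R(4)[OF i]] by (auto simp: restr_def)
    then show "map (restr B) (map2 (\<circ>) rs hs) ! i = rs ! i" using i len
      by (metis ext length_map nth_map)
  qed (use R E in simp)
  show "map (restr (S - B)) (map2 (\<circ>) rs hs) = hs"
  proof (rule nth_equalityI)
    fix i assume "i < length (map (restr (S - B)) (map2 (\<circ>) rs hs))"
    then have i: "i < l" using len by (metis length_map)
    have "restr (S - B) (map2 (\<circ>) rs hs ! i) x = (hs ! i) x" for x
      using C[OF i] permutes_not_in[OF E(4)[OF i]] by (auto simp: restr_def)
    then show "map (restr (S - B)) (map2 (\<circ>) rs hs) ! i = hs ! i" using i len
      by (metis ext length_map nth_map)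
  qed (use R E in simp)
  show "x \<in> B \<Longrightarrow> orb (map2 (\<circ>) rs hs) x = orb rs x"
    by (rule orb_cong[of _ _ _ B]) (use len R(1) B Bin in auto)
  show "x \<in> S - B \<Longrightarrow> orb (map2 (\<circ>) rs hs) x = orb hs x"
    by (rule orb_cong[of _ _ _ "S - B"]) (use len E(1) C Cin in auto)
qed

lemma num_orb_remove:
  assumes "p \<in> B" "B \<subseteq> S" "finite S" "\<And>x. x \<in> B \<Longrightarrow> orb gs x = B"
    "\<And>x. x \<in> S - B \<Longrightarrow> orb gs x = orb hs x"
    "\<And>x. x \<in> S - B \<Longrightarrow> orb hs x \<subseteq> S - B"
  shows "num_orb S gs = Suc (num_orb (S - B) hs)"
proof -
  have "orb gs ` S = orb gs ` B \<union> orb gs ` (S - B)" using assms(2) by auto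
  also have "orb gs ` B = {B}" using assms by auto
  also have "orb gs ` (S - B) = orb hs ` (S - B)" using assms(5) by auto
  finally have "orb gs ` S = insert B (orb hs ` (S - B))" by simp
  moreover have "B \<notin> orb hs ` (S - B)" using orb_base assms(6) by fastforce
  ultimately show ?thesis using assms(3) by (simp add: num_orb_def)
qed

text \<open>A tuple amounts to the orbit B of p, a transitive tuple on B and an arbitrary commuting
  tuple on S - B; the orbit B accounts for the single factor y. Fixing p selects one orbit of each
  tuple, so nothing is counted twice.\<close>

lemma sum_num_orb_rec:
  fixes y :: "'b::comm_semiring_1"
  assumes "finite S" "p \<in> S"
  shows "(\<Sum>gs\<in>comm_tuples l S. y ^ num_orb S gs) =
    (\<Sum>B | p \<in> B \<and> B \<subseteq> S. of_nat (card (trans_tuples l B)) * y *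
       (\<Sum>hs\<in>comm_tuples l (S - B). y ^ num_orb (S - B) hs))"
proof -
  let ?J = "\<lambda>gs. (orb gs p, map (restr (orb gs p)) gs, map (restr (S - orb gs p)) gs)"
    and ?I = "\<lambda>(B,rs,hs). map2 (\<circ>) rs hs"
  let ?X = "SIGMA B:{B. p \<in> B \<and> B \<subseteq> S}. trans_tuples l B \<times> comm_tuples l (S - B)"
  have fB: "finite B" if "B \<subseteq> S" for B using that assms(1) finite_subset by auto
  have "(\<Sum>gs\<in>comm_tuples l S. y ^ num_orb S gs) =
    (\<Sum>(B,rs,hs)\<in>?X. y * y ^ num_orb (S - B) hs)"
  proof (rule sum.reindex_bij_witness[where j = ?J and i = ?I])
    fix gs assume gs: "gs \<in> comm_tuples l S"
    note D = comm_tuplesD[OF gs]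
    let ?B = "orb gs p"
    have BS: "?B \<subseteq> S" by (rule orb_subset[OF D(2) assms(2)])
    \<comment> \<open>The complement is invariant because each generator maps the finite set B onto
      itself.\<close>
    have cl: "g ` (S - ?B) \<subseteq> S - ?B" if "g \<in> set gs" for g
      by (rule permutes_closed_Diff[OF D(2)[OF that] fB[OF BS] orb_closed[OF that]])
    have 1: "map (restr ?B) gs \<in> trans_tuples l ?B" by (rule restr_orb_trans[OF gs assms])
    then have tr: "map (restr ?B) gs \<in> comm_tuples l ?B" by (simp add: trans_tuples_def)
    have 2: "map (restr (S - ?B)) gs \<in> comm_tuples l (S - ?B)"
      by (rule restr_comm_tuples[OF gs]) (use assms cl in auto)
    show "?J gs \<in> ?X"
      using 1 2 BS by (auto intro: orb_base)
    note C = comp_tuples[OF tr 2 BS]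
    show "?I (?J gs) = gs"
    proof (simp, rule nth_equalityI)
      fix i assume "i < length (map2 (\<circ>) (map (restr ?B) gs) (map (restr (S - ?B)) gs))"
      then have i: "i < l" using D(1) by simp
      show "map2 (\<circ>) (map (restr ?B) gs) (map (restr (S - ?B)) gs) ! i = gs ! i" (is "?f = _")
      proof
        fix x
        consider "x \<in> ?B" | "x \<in> S - ?B" | "x \<notin> S" by blast
        then show "?f x = (gs ! i) x"
        proof cases
          case 1 then show ?thesis using C(2)[OF i 1] D(1) i by (simp add: restr_def)
        next
          case 2 then show ?thesis using C(3)[OF i 2] D(1) i by (simp add: restr_def)
        next
          case 3 then show ?thesis
            using permutes_not_in[OF D(4)[OF i] 3] permutes_not_in[OF comm_tuplesD(4)[OF C(1) i] 3] by simp
        qed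
      qed
    qed simp
    have "num_orb S gs = Suc (num_orb (S - ?B) (map (restr (S - ?B)) gs))"
    proof (rule num_orb_remove[OF orb_base BS assms(1)])
      show "orb gs x = orb gs p" if "x \<in> orb gs p" for x
        using orb_eq[OF D(2) assms that] .
      show "orb gs x = orb (map (restr (S - orb gs p)) gs) x" if "x \<in> S - orb gs p" for x
        using orb_restr[OF cl that] by simp
      show "orb (map (restr (S - orb gs p)) gs) x \<subseteq> S - orb gs p" if "x \<in> S - orb gs p" for x
        by (rule orb_subset[OF comm_tuplesD(2)[OF 2] that])
    qed
    then show "(case ?J gs of (B,rs,hs) \<Rightarrow> y * y ^ num_orb (S - B) hs) = y ^ num_orb S gs" by simp
  next
    fix d assume "d \<in> ?X"
    then obtain B rs hs where d: "d = (B,rs,hs)" "p \<in> B" "B \<subseteq> S" "rs \<in> trans_tuples l B"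
      "hs \<in> comm_tuples l (S - B)" by auto
    then have rs: "rs \<in> comm_tuples l B" "orb rs p = B" by (auto simp: trans_tuples_def)
    note C = comp_tuples[OF rs(1) d(5,3)]
    show "?I d \<in> comm_tuples l S" using C(1) d by simp
    have "orb (map2 (\<circ>) rs hs) p = B" using C(6)[OF d(2)] rs by simp
    then show "?J (?I d) = d"
      using C(4,5) d(1) by simp
  qed
  also have "\<dots> = (\<Sum>B | p \<in> B \<and> B \<subseteq> S. \<Sum>(rs,hs)\<in>trans_tuples l B \<times> comm_tuples l (S - B). y * y ^ num_orb (S - B) hs)"
    using assms(1) fB by (subst sum.Sigma) (auto simp: finite_trans_tuples finite_comm_tuples split_def)
  also have "\<dots> = (\<Sum>B | p \<in> B \<and> B \<subseteq> S. of_nat (card (trans_tuples l B)) * y *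
       (\<Sum>hs\<in>comm_tuples l (S - B). y ^ num_orb (S - B) hs))"
    by (intro sum.cong refl) (simp add: sum.cartesian_product[symmetric] sum_distrib_left mult_ac)
  finally show ?thesis .
qed

section \<open>Transitive commuting tuples\<close>

text \<open>Two maps that commute with \<open>gs\<close> agree on a set closed under
  \<open>gs\<close>; by transitivity, agreement at p spreads to S.\<close>

lemma trans_centralizer_unique:
  assumes "gs \<in> trans_tuples l S" "p \<in> S" "\<gamma> p = \<gamma>' p" "x \<in> S"
    and "\<And>g x. g \<in> set gs \<Longrightarrow> x \<in> S \<Longrightarrow> \<gamma> (g x) = g (\<gamma> x)"
    and "\<And>g x. g \<in> set gs \<Longrightarrow> x \<in> S \<Longrightarrow> \<gamma>' (g x) = g (\<gamma>' x)"
  shows "\<gamma> x = \<gamma>' x"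
proof -
  have "gs \<in> comm_tuples l S" using assms(1) by (simp add: trans_tuples_def)
  note D = comm_tuplesD[OF this]
  have "orb gs p \<subseteq> {x \<in> S. \<gamma> x = \<gamma>' x}"
    by (rule orb_least) (use assms D(2) in \<open>auto simp: permutes_in_image\<close>)
  then show ?thesis using assms by (auto simp: trans_tuples_def)
qed

text \<open>Take a word in \<open>gs\<close> that moves p to b: since the entries commute with each
  other, the word commutes with all of them.\<close>

lemma trans_centralizer_exists:
  assumes "gs \<in> trans_tuples l S" "p \<in> S" "b \<in> S"
  obtains \<gamma> where "\<gamma> permutes S" "\<gamma> p = b" "\<And>g x. g \<in> set gs \<Longrightarrow> \<gamma> (g x) = g (\<gamma> x)"
proof -
  have c: "gs \<in> comm_tuples l S" using assms(1) by (simp add: trans_tuples_def)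
  note D = comm_tuplesD[OF c]
  have "b \<in> orb gs p" using assms by (auto simp: trans_tuples_def)
  then have "\<exists>\<gamma>. \<gamma> permutes S \<and> \<gamma> p = b \<and> (\<forall>g\<in>set gs. \<forall>x. \<gamma> (g x) = g (\<gamma> x))"
  proof induction
    case orb_base
    then show ?case by (intro exI[of _ id] conjI permutes_id) auto
  next
    case (orb_step y g)
    then obtain \<gamma> where \<gamma>: "\<gamma> permutes S" "\<gamma> p = y" "\<And>g x. g \<in> set gs \<Longrightarrow> \<gamma> (g x) = g (\<gamma> x)"
      by auto
    have "(g \<circ> \<gamma>) (h x) = h ((g \<circ> \<gamma>) x)" if "h \<in> set gs" for h x
      using \<gamma>(3)[OF that] D(3)[OF orb_step(2) that] by simp
    then show ?case using \<gamma>(2)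
      by (intro exI[of _ "g \<circ> \<gamma>"] conjI permutes_compose[OF \<gamma>(1) D(2)[OF orb_step(2)]]) auto
  qed
  then show ?thesis using that by blast
qed

text \<open>For a transitive tuple and p, b in S the choice is forced by the two preceding lemmas: a
  transitive abelian action is regular, so one value determines the permutation.\<close>

definition centralizer_elt :: "('a \<Rightarrow> 'a) list \<Rightarrow> 'a set \<Rightarrow> 'a \<Rightarrow> 'a \<Rightarrow> 'a \<Rightarrow> 'a" where
  "centralizer_elt gs S p b = (SOME \<gamma>. \<gamma> permutes S \<and> \<gamma> p = b \<and> (\<forall>g\<in>set gs. \<forall>x. \<gamma> (g x) = g (\<gamma> x)))"

lemma centralizer_elt:
  assumes "gs \<in> trans_tuples l S" "p \<in> S" "b \<in> S"
  shows "centralizer_elt gs S p b permutes S" "centralizer_elt gs S p b p = b"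
    "\<And>g x. g \<in> set gs \<Longrightarrow> centralizer_elt gs S p b (g x) = g (centralizer_elt gs S p b x)"
proof -
  have "\<exists>\<gamma>. \<gamma> permutes S \<and> \<gamma> p = b \<and> (\<forall>g\<in>set gs. \<forall>x. \<gamma> (g x) = g (\<gamma> x))"
    using trans_centralizer_exists[OF assms] by metis
  from someI_ex[OF this]
  show "centralizer_elt gs S p b permutes S" "centralizer_elt gs S p b p = b"
    "\<And>g x. g \<in> set gs \<Longrightarrow> centralizer_elt gs S p b (g x) = g (centralizer_elt gs S p b x)"
    unfolding centralizer_elt_def by blast+
qed

section \<open>Labellings of S by copies of an orbit\<close>

definition conj_by :: "'b set \<Rightarrow> 'a set \<Rightarrow> ('b \<Rightarrow> 'a) \<Rightarrow> ('b \<Rightarrow> 'b) \<Rightarrow> 'a \<Rightarrow> 'a" where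
  "conj_by M S h f s = (if s \<in> S then h (f (inv_into M h s)) else s)"

lemma conj_by_apply:
  assumes "bij_betw h M S" "x \<in> M"
  shows "conj_by M S h f (h x) = h (f x)"
  using assms by (auto simp: conj_by_def bij_betw_inv_into_left bij_betwE)

lemma conj_by_permutes:
  assumes "bij_betw h M S" "bij_betw f M M"
  shows "conj_by M S h f permutes S"
proof (rule bij_imp_permutes)
  have "bij_betw (h \<circ> (f \<circ> inv_into M h)) S S"
    using assms bij_betw_inv_into[OF assms(1)] by (intro bij_betw_trans) auto
  then show "bij_betw (conj_by M S h f) S S"
    by (subst bij_betw_cong[where g = "h \<circ> (f \<circ> inv_into M h)"]) (auto simp: conj_by_def)
qed (auto simp: conj_by_def)

text \<open>The m rows stand for the successive translates of B under a further permutation; row 0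
  is B itself. \<open>extensional\<close> fixes the values off the index set, so that labellings can
  be counted.\<close>

definition labellings :: "nat \<Rightarrow> 'a set \<Rightarrow> 'a set \<Rightarrow> (nat \<times> 'a \<Rightarrow> 'a) set" where
  "labellings m B S = {h \<in> extensional ({..<m} \<times> B). bij_betw h ({..<m} \<times> B) S \<and> (\<forall>x\<in>B. h (0, x) = x)}"

text \<open>Any two labellings differ by a permutation of S that fixes B pointwise. Relative to one
  reference labelling they correspond to the permutations of S - B.\<close>

lemma card_labellings:
  assumes "finite S" "B \<subseteq> S" "m * card B = card S" "0 < m"
  shows "card (labellings m B S) = fact (card S - card B)"
proof -
  let ?M = "{..<m} \<times> B"
  have fB: "finite B" using assms finite_subset by auto
  have "card ({1..<m} \<times> B) = card (S - B)"
    using assms fB by (simp add: card_Diff_subset card_cartesian_product diff_mult_distrib)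
  then obtain k where k: "bij_betw k ({1..<m} \<times> B) (S - B)"
    using finite_same_card_bij assms fB by (metis finite_Diff finite_SigmaI finite_atLeastLessThan)
  \<comment> \<open>Reference labelling: the identity on row 0 and an arbitrary bijection of the
    other rows onto S - B.\<close>
  define h0 where "h0 z = (if fst z = 0 then snd z else k z)" for z
  have "bij_betw h0 ({0} \<times> B) B"
    by (rule bij_betwI[where g = "\<lambda>x. (0, x)"]) (auto simp: h0_def)
  moreover have "bij_betw h0 ({1..<m} \<times> B) (S - B)"
    using k by (subst bij_betw_cong[of _ h0 k]) (auto simp: h0_def)
  ultimately have "bij_betw h0 ({0} \<times> B \<union> {1..<m} \<times> B) (B \<union> (S - B))"
    by (rule bij_betw_combine) auto
  moreover have "{0} \<times> B \<union> {1..<m} \<times> B = ?M" using assms(4) by auto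
  moreover have "B \<union> (S - B) = S" using assms(2) by auto
  ultimately have h0: "bij_betw h0 ?M S" by simp
  have h00: "h0 (0, x) = x" for x by (simp add: h0_def)
  have inv0: "inv_into ?M h0 x = (0, x)" if "x \<in> B" for x
    using bij_betw_inv_into_left[OF h0, of "(0, x)"] that assms(4) h00 by simp
  have "bij_betw (\<lambda>\<pi>. restrict (\<pi> \<circ> h0) ?M) {\<pi>. \<pi> permutes (S - B)} (labellings m B S)"
  proof (rule bij_betwI[where g = "\<lambda>h s. if s \<in> S then h (inv_into ?M h0 s) else s"])
    show "(\<lambda>\<pi>. restrict (\<pi> \<circ> h0) ?M) \<in> {\<pi>. \<pi> permutes (S - B)} \<rightarrow> labellings m B S"
    proof
      fix \<pi> assume "\<pi> \<in> {\<pi>. \<pi> permutes (S - B)}"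
      then have \<pi>: "\<pi> permutes (S - B)" by simp
      then have "bij_betw \<pi> S S" using permutes_subset[OF \<pi>, of S] by (simp add: permutes_imp_bij)
      then have "bij_betw (\<pi> \<circ> h0) ?M S" using h0 by (rule bij_betw_trans[rotated])
      then have "bij_betw (restrict (\<pi> \<circ> h0) ?M) ?M S" by (simp cong: bij_betw_cong)
      moreover have "restrict (\<pi> \<circ> h0) ?M (0, x) = x" if "x \<in> B" for x
        using that assms(4) h00 permutes_not_in[OF \<pi>, of x] by simp
      ultimately show "restrict (\<pi> \<circ> h0) ?M \<in> labellings m B S"
        by (auto simp: labellings_def)
    qed
    show "(\<lambda>h s. if s \<in> S then h (inv_into ?M h0 s) else s) \<in> labellings m B S \<rightarrow> {\<pi>. \<pi> permutes (S - B)}"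
    proof
      fix h assume "h \<in> labellings m B S"
      then have h: "bij_betw h ?M S" "\<And>x. x \<in> B \<Longrightarrow> h (0, x) = x" by (auto simp: labellings_def)
      let ?\<pi> = "\<lambda>s. if s \<in> S then h (inv_into ?M h0 s) else s"
      have "bij_betw (h \<circ> inv_into ?M h0) S S"
        using bij_betw_inv_into[OF h0] h(1) by (rule bij_betw_trans)
      then have b: "bij_betw ?\<pi> S S"
        by (subst bij_betw_cong[where g = "h \<circ> inv_into ?M h0"]) auto
      have "?\<pi> permutes S" by (rule bij_imp_permutes[OF b]) auto
      then have "?\<pi> permutes (S - B)"
        by (rule permutes_superset) (use inv0 h(2) in auto)
      then show "?\<pi> \<in> {\<pi>. \<pi> permutes (S - B)}" by simp
    qed
    show "(\<lambda>s. if s \<in> S then restrict (\<pi> \<circ> h0) ?M (inv_into ?M h0 s) else s) = \<pi>"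
      if "\<pi> \<in> {\<pi>. \<pi> permutes (S - B)}" for \<pi>
    proof
      fix s
      have "inv_into ?M h0 s \<in> ?M" "h0 (inv_into ?M h0 s) = s" if "s \<in> S"
        using h0 that by (metis bij_betw_def inv_into_into, metis bij_betw_inv_into_right)
      then show "(if s \<in> S then restrict (\<pi> \<circ> h0) ?M (inv_into ?M h0 s) else s) = \<pi> s"
        using that permutes_not_in[of \<pi> "S - B" s] by auto
    qed
    show "restrict ((\<lambda>s. if s \<in> S then h (inv_into ?M h0 s) else s) \<circ> h0) ?M = h"
      if "h \<in> labellings m B S" for h
    proof
      fix z
      show "restrict ((\<lambda>s. if s \<in> S then h (inv_into ?M h0 s) else s) \<circ> h0) ?M z = h z"
      proof (cases "z \<in> ?M")
        case True
        then show ?thesis using h0 bij_betw_inv_into_left[OF h0 True] bij_betwE[OF h0]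
          by auto
      next
        case False
        then show ?thesis using that extensional_arb[of h ?M z] by (simp add: labellings_def)
      qed
    qed
  qed
  then have "card (labellings m B S) = card {\<pi>. \<pi> permutes (S - B)}"
    using bij_betw_same_card by metis
  also have "\<dots> = fact (card S - card B)"
    using assms fB by (simp add: card_permutations card_Diff_subset)
  finally show ?thesis .
qed

lemma funpow_commute: "(\<And>x. f (g x) = g (f x)) \<Longrightarrow> (f ^^ i) (g x) = g ((f ^^ i) x)"
  by (induction i) auto

text \<open>A transitive tuple \<open>\<tau> # gs\<close> is encoded by the \<open>gs\<close>-orbit \<open>B\<close> of a base point \<open>p\<close>, the action of
  \<open>gs\<close> on \<open>B\<close>, the labelling \<open>(i, x) \<mapsto> \<tau>^i x\<close> of \<open>S\<close> by \<open>{..<m} \<times> B\<close>, and the return point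
  \<open>\<tau>^m p \<in> B\<close>.\<close>

definition glue :: "'a set \<Rightarrow> 'a \<Rightarrow> 'a set \<Rightarrow> ('a \<Rightarrow> 'a) list \<Rightarrow> 'a \<Rightarrow> (nat \<times> 'a \<Rightarrow> 'a) \<Rightarrow> ('a \<Rightarrow> 'a) list" where
  "glue S p B rs b h = (let m = card S div card B; M = {..<m} \<times> B in
     conj_by M S h (\<lambda>(i, x). if Suc i < m then (Suc i, x) else (0, centralizer_elt rs B p b x)) #
     map (\<lambda>g. conj_by M S h (\<lambda>(i, x). (i, g x))) rs)"

text \<open>The new permutation climbs one row at a time and returns from the last row to row 0
  through the element of the centralizer that sends p to b. The return map commutes with
  \<open>rs\<close>, so the whole tuple commutes, and all encoded data can be read back from
  it.\<close>

lemma glue: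
  assumes "finite S" "p \<in> B" "B \<subseteq> S" "card B dvd card S" "rs \<in> trans_tuples l B" "b \<in> B"
    "h \<in> labellings (card S div card B) B S"
  defines "m \<equiv> card S div card B" and "\<tau> \<equiv> hd (glue S p B rs b h)" and "gs \<equiv> tl (glue S p B rs b h)"
  shows "glue S p B rs b h \<in> trans_tuples (Suc l) S"
    and "orb gs p = B" "map (restr B) gs = rs"
    and "(\<tau> ^^ m) p = b"
    and "restrict (\<lambda>(i, x). (\<tau> ^^ i) x) ({..<m} \<times> B) = h"
proof -
  let ?M = "{..<m} \<times> B" and ?\<gamma> = "centralizer_elt rs B p b"
  have fB: "finite B" using assms finite_subset by auto
  have c0: "card B > 0" using fB assms by (auto simp: card_gt_0_iff)
  have m: "m * card B = card S" using assms by (simp add: m_def)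
  then have m0: "0 < m" using assms by (metis card_0_eq empty_iff mult_is_0 not_gr_zero subsetD)
  have h: "bij_betw h ?M S" "\<And>x. x \<in> B \<Longrightarrow> h (0, x) = x" and hext: "h \<in> extensional ?M"
    using assms by (auto simp: labellings_def)
  have rsc: "rs \<in> comm_tuples l B" and rst: "orb rs p = B" using assms by (auto simp: trans_tuples_def)
  note D = comm_tuplesD[OF rsc]
  note G = centralizer_elt[OF assms(5,2,6)]
  define ft where "ft = (\<lambda>(i, x). if Suc i < m then (Suc i, x) else (0::nat, ?\<gamma> x))"
  define fs where "fs g = (\<lambda>(i::nat, x). (i, g x))" for g :: "'a \<Rightarrow> 'a"
  have glue: "glue S p B rs b h = \<tau> # gs" and \<tau>: "\<tau> = conj_by ?M S h ft"
    and gs: "gs = map (\<lambda>g. conj_by ?M S h (fs g)) rs"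
    unfolding \<tau>_def gs_def glue_def ft_def fs_def m_def by (simp_all add: Let_def)
  have Gin: "?\<gamma> x \<in> B" if "x \<in> B" for x using permutes_in_image[OF G(1)] that by simp
  have gin: "g x \<in> B" if "x \<in> B" "g \<in> set rs" for x g
    using permutes_in_image[OF D(2)[OF that(2)]] that by simp
  have ftM: "ft z \<in> ?M" if "z \<in> ?M" for z
    using that Gin m0 by (auto simp: ft_def)
  have fsM: "fs g z \<in> ?M" if "z \<in> ?M" "g \<in> set rs" for g z
    using that gin by (auto simp: fs_def)
  have \<tau>_h: "\<tau> (h z) = h (ft z)" if "z \<in> ?M" for z
    unfolding \<tau> using conj_by_apply[OF h(1) that] .
  have gs_h: "conj_by ?M S h (fs g) (h z) = h (fs g z)" if "z \<in> ?M" for z g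
    using conj_by_apply[OF h(1) that] .
  have injG: "x = y" if "?\<gamma> x = ?\<gamma> y" for x y using permutes_inj[OF G(1)] that by (auto dest: injD)
  have inj_ft: "inj_on ft ?M"
    by (rule inj_onI) (auto simp: ft_def split: if_splits dest: injG)
  have "bij_betw ft ?M ?M"
    using inj_ft endo_inj_surj[of ?M ft] ftM fB by (auto simp: bij_betw_def image_subset_iff)
  then have perm_\<tau>: "\<tau> permutes S" unfolding \<tau> by (rule conj_by_permutes[OF h(1)])
  have perm_gs: "conj_by ?M S h (fs g) permutes S" if "g \<in> set rs" for g
  proof (rule conj_by_permutes[OF h(1)])
    have "inj_on (fs g) ?M" using permutes_inj[OF D(2)[OF that]]
      by (auto intro!: inj_onI simp: fs_def dest: injD)
    then show "bij_betw (fs g) ?M ?M"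
      using endo_inj_surj[of ?M "fs g"] fsM[OF _ that] fB by (auto simp: bij_betw_def image_subset_iff)
  qed
  have S: "\<exists>z\<in>?M. s = h z" if "s \<in> S" for s
    using h(1) that by (auto simp: bij_betw_def)
  have comm1: "\<tau> (conj_by ?M S h (fs g) s) = conj_by ?M S h (fs g) (\<tau> s)" if "g \<in> set rs" and s: "s \<in> S" for g s
  proof -
    obtain z where z: "z \<in> ?M" "s = h z" using S[OF s] by auto
    \<comment> \<open>In the last row this is the commutation of the return map with g; in the other
      rows it is immediate.\<close>
    have "ft (fs g z) = fs g (ft z)"
      using G(3)[OF that(1)] by (auto simp: ft_def fs_def split: prod.splits)
    then show ?thesis using z \<tau>_h gs_h ftM fsM[OF _ that(1)] by simp
  qed
  have comm2: "conj_by ?M S h (fs g') (conj_by ?M S h (fs g) s) = conj_by ?M S h (fs g) (conj_by ?M S h (fs g') s)"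
    if "g \<in> set rs" "g' \<in> set rs" and s: "s \<in> S" for g g' s
  proof -
    obtain z where z: "z \<in> ?M" "s = h z" using S[OF s] by auto
    have "fs g' (fs g z) = fs g (fs g' z)"
      using D(3)[OF that(1,2)] by (auto simp: fs_def split: prod.splits)
    then show ?thesis using z gs_h fsM[OF _ that(1)] fsM[OF _ that(2)] by simp
  qed
  have T: "\<tau> # gs \<in> comm_tuples (Suc l) S"
  proof (rule comm_tuplesI)
    show "length (\<tau> # gs) = Suc l" using D(1) by (simp add: gs)
    have nth: "(\<tau> # gs) ! i = (case i of 0 \<Rightarrow> \<tau> | Suc j \<Rightarrow> conj_by ?M S h (fs (rs ! j)))" if "i < Suc l" for i
      using that D(1) by (auto simp: gs split: nat.splits)
    show "(\<tau> # gs) ! i permutes S" if "i < Suc l" for i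
      unfolding nth[OF that] using that perm_\<tau> perm_gs D(1) by (auto split: nat.splits)
    show "((\<tau> # gs) ! i) (((\<tau> # gs) ! j) x) = ((\<tau> # gs) ! j) (((\<tau> # gs) ! i) x)"
      if "i < Suc l" "j < Suc l" "x \<in> S" for i j x
      unfolding nth[OF that(1)] nth[OF that(2)]
      using that comm1[OF _ that(3)] comm2[OF _ _ that(3)] D(1) by (auto split: nat.splits)
  qed
  have gsB: "(gs ! i) x = (rs ! i) x" if "i < l" "x \<in> B" for i x
  proof -
    have g: "rs ! i \<in> set rs" using that D(1) by simp
    have "conj_by ?M S h (fs (rs ! i)) (h (0, x)) = h (0, (rs ! i) x)"
      using gs_h[of "(0, x)" "rs ! i"] that m0 by (simp add: fs_def)
    then show ?thesis using that h(2) gin[OF that(2) g] D(1) by (simp add: gs)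
  qed
  have "orb gs p = orb rs p"
  proof (rule orb_cong[of _ _ _ B])
    show "(gs ! i) y \<in> B" if "i < length gs" "y \<in> B" for i y
      using that gsB[of i y] gin[of y "rs ! i"] D(1) by (simp add: gs)
  qed (use gsB D(1) assms(2) in \<open>auto simp: gs\<close>)
  then show orbB: "orb gs p = B" using rst by simp
  show "map (restr B) gs = rs"
  proof (rule nth_equalityI)
    fix i assume "i < length (map (restr B) gs)"
    then have i: "i < l" "i < length gs" using D(1) by (auto simp: gs)
    have "restr B (gs ! i) x = (rs ! i) x" for x
      using gsB[OF i(1)] permutes_not_in[OF D(4)[OF i(1)]] by (auto simp: restr_def)
    then show "map (restr B) gs ! i = rs ! i" using i by auto
  qed (simp add: gs)
  \<comment> \<open>Starting in row 0, the powers of \<tau> trace out the labelling; this recovers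
    h.\<close>
  have pow: "(\<tau> ^^ i) x = h (i, x)" if "i < m" "x \<in> B" for i x
    using that
  proof (induction i)
    case 0 then show ?case using h(2) by simp
  next
    case (Suc i)
    then show ?case using \<tau>_h[of "(i, x)"] by (simp add: ft_def)
  qed
  show "restrict (\<lambda>(i, x). (\<tau> ^^ i) x) ?M = h"
    using pow hext by (auto simp: fun_eq_iff extensional_def restrict_def)
  obtain k where k: "m = Suc k" using m0 by (cases m) auto
  have "(\<tau> ^^ m) p = h (0, ?\<gamma> p)"
    using pow[of k p] \<tau>_h[of "(k, p)"] assms(2) by (simp add: ft_def k)
  then show "(\<tau> ^^ m) p = b" using G(2) h(2) assms(6) by simp
  have "S \<subseteq> orb (\<tau> # gs) p"
  proof
    fix s assume "s \<in> S"
    then obtain i x where z: "i < m" "x \<in> B" "s = h (i, x)" using S by fastforce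
    have "x \<in> orb gs p" using z orbB by simp
    then have x: "x \<in> orb (\<tau> # gs) p"
      by induction (auto intro: orb.intros)
    have "(\<tau> ^^ i) x \<in> orb (\<tau> # gs) p" for i
      by (induction i) (auto intro: x orb_step)
    then show "s \<in> orb (\<tau> # gs) p" using pow z by metis
  qed
  then show "glue S p B rs b h \<in> trans_tuples (Suc l) S"
    unfolding glue using T assms by (intro trans_tuplesI[of _ _ _ p]) auto
qed

text \<open>Since \<tau> commutes with \<open>gs\<close>, its powers carry orbits of
  \<open>gs\<close> to orbits of \<open>gs\<close>. The translates of B are therefore disjoint until
  the first return to B, and they cover S by transitivity; hence there are card S / card B of
  them.\<close>

lemma unglue:
  assumes "finite S" "p \<in> S" "\<tau> # gs \<in> trans_tuples (Suc l) S"
  defines "B \<equiv> orb gs p"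
  defines "m \<equiv> card S div card B"
  defines "h \<equiv> restrict (\<lambda>(i, x). (\<tau> ^^ i) x) ({..<m} \<times> B)"
  shows "p \<in> B" "B \<subseteq> S" "card B dvd card S" "map (restr B) gs \<in> trans_tuples l B"
    "(\<tau> ^^ m) p \<in> B" "h \<in> labellings m B S"
    "glue S p B (map (restr B) gs) ((\<tau> ^^ m) p) h = \<tau> # gs"
proof -
  have T: "\<tau> # gs \<in> comm_tuples (Suc l) S" and orbS: "orb (\<tau> # gs) p = S"
    using assms(2,3) by (auto simp: trans_tuples_def)
  have gsc: "gs \<in> comm_tuples l S" using T by (auto simp: comm_tuples_def)
  note D = comm_tuplesD[OF gsc]
  have perm_\<tau>: "\<tau> permutes S" using comm_tuplesD(2)[OF T] by simp
  have comm: "\<tau> (g x) = g (\<tau> x)" if "g \<in> set gs" for g x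
    using comm_tuplesD(3)[OF T] that by simp
  have commp: "(\<tau> ^^ i) (g x) = g ((\<tau> ^^ i) x)" if "g \<in> set gs" for g x i
    by (rule funpow_commute) (rule comm[OF that])
  have injp: "x = y" if "(\<tau> ^^ i) x = (\<tau> ^^ i) y" for x y i
  proof -
    have "inj (\<tau> ^^ i)" using permutes_inj[OF perm_\<tau>] by (rule inj_fn)
    then show ?thesis using that by (rule injD)
  qed
  have inS: "(\<tau> ^^ i) x \<in> S" if "x \<in> S" for x i
    using that perm_\<tau> by (induction i) (auto simp: permutes_in_image)
  show pB: "p \<in> B" unfolding B_def by (rule orb_base)
  show BS: "B \<subseteq> S" unfolding B_def by (rule orb_subset[OF D(2) assms(2)])
  have fB: "finite B" using BS assms(1) finite_subset by auto
  show rs: "map (restr B) gs \<in> trans_tuples l B"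
    unfolding B_def by (rule restr_orb_trans[OF gsc assms(1,2)])
  have clB: "g x \<in> B" if "g \<in> set gs" "x \<in> B" for g x
    using that unfolding B_def by (auto intro: orb_step)
  have pow_orb: "(\<tau> ^^ i) ` B \<subseteq> orb gs ((\<tau> ^^ i) p)" for i
  proof -
    have "B \<subseteq> {x. (\<tau> ^^ i) x \<in> orb gs ((\<tau> ^^ i) p)}"
      unfolding B_def by (rule orb_least) (auto simp: commp intro: orb.intros)
    then show ?thesis by auto
  qed
  \<comment> \<open>If one point of B returns to B, then all of B does, since orbits of
    \<open>gs\<close> are equal or disjoint.\<close>
  have meet: "(\<tau> ^^ i) ` B \<subseteq> B \<and> (\<tau> ^^ i) p \<in> B" if "x \<in> B" "(\<tau> ^^ i) x \<in> B" for x i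
  proof -
    have "(\<tau> ^^ i) x \<in> orb gs ((\<tau> ^^ i) p)" using pow_orb that by blast
    then have "orb gs ((\<tau> ^^ i) p) = orb gs ((\<tau> ^^ i) x)"
      using orb_eq[OF D(2) assms(1)] inS[OF assms(2)] by metis
    also have "\<dots> = B" using orb_eq[OF D(2) assms(1,2)] that unfolding B_def by metis
    finally show ?thesis using pow_orb[of i] orb_base by metis
  qed
  have "\<exists>k>0. (\<tau> ^^ k) p \<in> B"
  proof -
    have "\<not> inj_on (\<lambda>i. (\<tau> ^^ i) p) (UNIV :: nat set)"
    proof
      assume "inj_on (\<lambda>i. (\<tau> ^^ i) p) (UNIV :: nat set)"
      moreover have "finite (range (\<lambda>i. (\<tau> ^^ i) p))"
        by (rule finite_subset[OF _ assms(1)]) (use inS assms(2) in auto)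
      ultimately show False using finite_imageD infinite_UNIV_nat by blast
    qed
    then obtain i j :: nat where ij: "i < j" "(\<tau> ^^ i) p = (\<tau> ^^ j) p"
      unfolding inj_on_def by (metis linorder_neqE_nat UNIV_I)
    then have "(\<tau> ^^ i) p = (\<tau> ^^ i) ((\<tau> ^^ (j - i)) p)"
      by (simp add: funpow_add[symmetric] flip: comp_apply[of "_ ^^ _"])
    then have "(\<tau> ^^ (j - i)) p = p" using injp by metis
    then show ?thesis using ij pB by (intro exI[of _ "j - i"]) auto
  qed
  \<comment> \<open>k is the first return time; its minimality makes the rows below k
    disjoint.\<close>
  then obtain k where k: "k > 0" "(\<tau> ^^ k) p \<in> B" and kmin: "\<And>j. 0 < j \<Longrightarrow> (\<tau> ^^ j) p \<in> B \<Longrightarrow> k \<le> j"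
    using exists_least_iff[of "\<lambda>k. k > 0 \<and> (\<tau> ^^ k) p \<in> B"] by (metis not_less)
  let ?h = "\<lambda>(i, x). (\<tau> ^^ i) x"
  have shift: "(\<tau> ^^ i) ((\<tau> ^^ j) x) = (\<tau> ^^ (i + j)) x" for i j x
    by (simp add: funpow_add)
  have ne: "(\<tau> ^^ i) x \<noteq> (\<tau> ^^ j) y" if "i < j" "j < k" "x \<in> B" "y \<in> B" for i j x y
  proof
    assume "(\<tau> ^^ i) x = (\<tau> ^^ j) y"
    then have "(\<tau> ^^ i) x = (\<tau> ^^ i) ((\<tau> ^^ (j - i)) y)" using that by (simp add: shift)
    then have "x = (\<tau> ^^ (j - i)) y" by (rule injp)
    then have "(\<tau> ^^ (j - i)) p \<in> B" using meet[of y "j - i"] that by auto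
    then show False using kmin[of "j - i"] that by auto
  qed
  have inj: "inj_on ?h ({..<k} \<times> B)"
  proof (rule inj_onI, clarsimp)
    fix i x j y assume *: "i < k" "x \<in> B" "j < k" "y \<in> B" "(\<tau> ^^ i) x = (\<tau> ^^ j) y"
    then have "i = j" using ne[of i j x y] ne[of j i y x] by (metis nat_neq_iff)
    then show "i = j \<and> x = y" using * injp by auto
  qed
  have "S \<subseteq> ?h ` ({..<k} \<times> B)"
  proof -
    have "orb (\<tau> # gs) p \<subseteq> ?h ` ({..<k} \<times> B)"
    proof (rule orb_least)
      show "p \<in> ?h ` ({..<k} \<times> B)" using pB k by (intro image_eqI[of _ _ "(0, p)"]) auto
      fix y g assume y: "y \<in> ?h ` ({..<k} \<times> B)" and g: "g \<in> set (\<tau> # gs)"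
      then obtain i x where ix: "i < k" "x \<in> B" "y = (\<tau> ^^ i) x" by auto
      show "g y \<in> ?h ` ({..<k} \<times> B)"
      proof (cases "g \<in> set gs")
        case True
        then show ?thesis using ix clB by (intro image_eqI[of _ _ "(i, g x)"]) (auto simp: commp)
      next
        case False
        then have g: "g = \<tau>" using g by simp
        show ?thesis
        proof (cases "Suc i < k")
          case True
          then show ?thesis using ix g by (intro image_eqI[of _ _ "(Suc i, x)"]) auto
        next
          case False
          then have "k = Suc i" using ix by simp
          then have "g y = (\<tau> ^^ k) x" using ix g by simp
          moreover have "(\<tau> ^^ k) x \<in> B" using meet[OF pB k(2)] ix by auto
          ultimately show ?thesis using k by (intro image_eqI[of _ _ "(0, g y)"]) auto
        qed
      qed
    qed
    then show ?thesis using orbS by simp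
  qed
  then have bij: "bij_betw ?h ({..<k} \<times> B) S"
    using inj inS BS unfolding bij_betw_def by auto
  then have cS: "card S = k * card B"
    using bij_betw_same_card[OF bij] fB by (simp add: card_cartesian_product)
  then show "card B dvd card S" by simp
  have "card B > 0" using fB pB by (auto simp: card_gt_0_iff)
  then have mk: "m = k" using cS by (simp add: m_def)
  show ret: "(\<tau> ^^ m) p \<in> B" using k mk by simp
  have hb: "bij_betw h ({..<m} \<times> B) S"
    using bij unfolding h_def mk by (simp cong: bij_betw_cong)
  show hl: "h \<in> labellings m B S"
    using hb k mk unfolding labellings_def by (auto simp: h_def)
  let ?rs = "map (restr B) gs" and ?b = "(\<tau> ^^ m) p" and ?M = "{..<m} \<times> B"
  note C = centralizer_elt[OF rs pB ret]
  \<comment> \<open>On B the power \<tau>^m commutes with the restricted tuple, so its value at p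
    determines it. This is why the encoding stores only the return point.\<close>
  have C_eq: "centralizer_elt ?rs B p ?b x = (\<tau> ^^ m) x" if "x \<in> B" for x
  proof (rule trans_centralizer_unique[OF rs pB _ that])
    show "centralizer_elt ?rs B p ?b p = (\<tau> ^^ m) p" by (rule C(2))
    show "centralizer_elt ?rs B p ?b (g x) = g (centralizer_elt ?rs B p ?b x)"
      if "g \<in> set ?rs" "x \<in> B" for g x using C(3) that by simp
    show "(\<tau> ^^ m) (g x) = g ((\<tau> ^^ m) x)" if "g \<in> set ?rs" "x \<in> B" for g x
      using that meet[OF pB ret] commp by (auto simp: restr_def)
  qed
  have outside: "conj_by ?M S h f s = s" if "s \<notin> S" for f s using that by (simp add: conj_by_def)
  have S: "\<exists>i x. i < m \<and> x \<in> B \<and> s = h (i, x) \<and> s = (\<tau> ^^ i) x" if "s \<in> S" for s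
    using hb that by (auto simp: bij_betw_def h_def)
  have 1: "conj_by ?M S h (\<lambda>(i, x). if Suc i < m then (Suc i, x) else (0, centralizer_elt ?rs B p ?b x)) = \<tau>"
    (is "conj_by ?M S h ?f = \<tau>")
  proof
    fix s
    show "conj_by ?M S h ?f s = \<tau> s"
    proof (cases "s \<in> S")
      case True
      then obtain i x where ix: "i < m" "x \<in> B" "s = h (i, x)" "s = (\<tau> ^^ i) x" using S by blast
      then have "conj_by ?M S h ?f s = h (?f (i, x))" using conj_by_apply[OF hb] by simp
      also have "\<dots> = \<tau> s"
      proof (cases "Suc i < m")
        case True then show ?thesis using ix by (simp add: h_def)
      next
        case False
        then have "m = Suc i" using ix by simp
        moreover have "(\<tau> ^^ m) x \<in> B" using meet[OF pB ret] ix by auto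
        ultimately show ?thesis using ix C_eq[OF ix(2)] by (simp add: h_def)
      qed
      finally show ?thesis .
    qed (use outside permutes_not_in[OF perm_\<tau>] in auto)
  qed
  have 2: "conj_by ?M S h (\<lambda>(i, x). (i, restr B g x)) = g" if g: "g \<in> set gs" for g
  proof
    fix s
    show "conj_by ?M S h (\<lambda>(i, x). (i, restr B g x)) s = g s"
    proof (cases "s \<in> S")
      case True
      then obtain i x where ix: "i < m" "x \<in> B" "s = h (i, x)" "s = (\<tau> ^^ i) x" using S by blast
      then have "conj_by ?M S h (\<lambda>(i, x). (i, restr B g x)) s = h (i, g x)"
        using conj_by_apply[OF hb] by (simp add: restr_def)
      also have "\<dots> = g s" using ix clB[OF g] commp[OF g] by (simp add: h_def)
      finally show ?thesis .
    qed (use outside permutes_not_in[OF D(2)[OF g]] in auto)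
  qed
  show "glue S p B ?rs ?b h = \<tau> # gs"
    unfolding glue_def Let_def m_def[symmetric] using 1 2 by (simp add: map_idI)
qed

text \<open>For a given B the encoding makes three independent choices: the action on B, one of card
  B return points, and one of (card S - card B)! labellings.\<close>

lemma card_trans_tuples_Suc:
  assumes "finite S" "p \<in> S"
  shows "card (trans_tuples (Suc l) S) =
    (\<Sum>B | p \<in> B \<and> B \<subseteq> S \<and> card B dvd card S.
       card (trans_tuples l B) * (card B * fact (card S - card B)))"
proof -
  let ?X = "SIGMA B:{B. p \<in> B \<and> B \<subseteq> S \<and> card B dvd card S}.
     trans_tuples l B \<times> B \<times> labellings (card S div card B) B S"
  let ?E = "\<lambda>(B, rs, b, h). glue S p B rs b h"
  let ?D = "\<lambda>T. (orb (tl T) p, map (restr (orb (tl T) p)) (tl T),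
     (hd T ^^ (card S div card (orb (tl T) p))) p,
     restrict (\<lambda>(i, x). (hd T ^^ i) x) ({..<card S div card (orb (tl T) p)} \<times> orb (tl T) p))"
  have fB: "finite B" if "B \<subseteq> S" for B using that assms finite_subset by auto
  have E: "bij_betw ?E ?X (trans_tuples (Suc l) S)"
  proof (rule bij_betw_byWitness[where f' = ?D])
    have X: "?E d \<in> trans_tuples (Suc l) S \<and> ?D (?E d) = d" if dX: "d \<in> ?X" for d
    proof -
      obtain B rs b h where d: "d = (B, rs, b, h)" "p \<in> B" "B \<subseteq> S" "card B dvd card S"
        "rs \<in> trans_tuples l B" "b \<in> B" "h \<in> labellings (card S div card B) B S"
        using dX by blast
      note g = glue[OF assms(1) d(2-7)]
      show ?thesis unfolding d(1) prod.case using g(1) g(3-5) by (simp add: g(2))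
    qed
    then show "\<forall>d\<in>?X. ?D (?E d) = d" by blast
    show "?E ` ?X \<subseteq> trans_tuples (Suc l) S" using X by blast
    have cons: "\<exists>\<tau> gs. T = \<tau> # gs" if "T \<in> trans_tuples (Suc l) S" for T
      using that by (cases T) (auto simp: trans_tuples_def comm_tuples_def)
    show "\<forall>T\<in>trans_tuples (Suc l) S. ?E (?D T) = T"
    proof
      fix T assume T: "T \<in> trans_tuples (Suc l) S"
      then obtain \<tau> gs where *: "T = \<tau> # gs" using cons by blast
      show "?E (?D T) = T" using unglue(7)[OF assms T[unfolded *]] by (simp add: *)
    qed
    show "?D ` trans_tuples (Suc l) S \<subseteq> ?X"
    proof
      fix d assume "d \<in> ?D ` trans_tuples (Suc l) S"
      then obtain T where "T \<in> trans_tuples (Suc l) S" "d = ?D T" by blast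
      then obtain \<tau> gs where *: "\<tau> # gs \<in> trans_tuples (Suc l) S" "d = ?D (\<tau> # gs)" using cons by blast
      show "d \<in> ?X" using unglue(1-6)[OF assms *(1)] *(2) by simp
    qed
  qed
  have lab: "card (labellings (card S div card B) B S) = fact (card S - card B)"
    if B: "p \<in> B" "B \<subseteq> S" "card B dvd card S" for B
  proof (rule card_labellings[OF assms(1) B(2)])
    show m: "card S div card B * card B = card S" using B by simp
    have "card S > 0" using assms by (auto simp: card_gt_0_iff)
    then have "0 < card S div card B * card B" using m by presburger
    then show "0 < card S div card B" unfolding nat_0_less_mult_iff by (rule conjunct1)
  qed
  have "card (trans_tuples (Suc l) S) = card ?X" by (rule bij_betw_same_card[OF E, symmetric])
  also have "\<dots> = (\<Sum>B | p \<in> B \<and> B \<subseteq> S \<and> card B dvd card S.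
     card (trans_tuples l B \<times> B \<times> labellings (card S div card B) B S))"
  proof (rule card_SigmaI)
    show "\<forall>B\<in>{B. p \<in> B \<and> B \<subseteq> S \<and> card B dvd card S}.
      finite (trans_tuples l B \<times> B \<times> labellings (card S div card B) B S)"
    proof
      fix B assume B: "B \<in> {B. p \<in> B \<and> B \<subseteq> S \<and> card B dvd card S}"
      have "card (labellings (card S div card B) B S) = fact (card S - card B)"
        using B by (intro lab) auto
      then have "finite (labellings (card S div card B) B S)" by (intro card_ge_0_finite) simp
      then show "finite (trans_tuples l B \<times> B \<times> labellings (card S div card B) B S)"
        using B by (intro finite_cartesian_product finite_trans_tuples fB) auto
    qed
  qed (use assms in simp)
  also have "\<dots> = (\<Sum>B | p \<in> B \<and> B \<subseteq> S \<and> card B dvd card S.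
       card (trans_tuples l B) * (card B * fact (card S - card B)))"
  proof (rule sum.cong[OF refl])
    fix B assume B: "B \<in> {B. p \<in> B \<and> B \<subseteq> S \<and> card B dvd card S}"
    have "card (labellings (card S div card B) B S) = fact (card S - card B)"
      using B by (intro lab) auto
    then show "card (trans_tuples l B \<times> B \<times> labellings (card S div card B) B S) =
      card (trans_tuples l B) * (card B * fact (card S - card B))"
      by (simp add: card_cartesian_product)
  qed
  finally show ?thesis .
qed

text \<open>The number of blocks of size j combines with (j-1)! and (n-j)! to (n-1)! for every j,
  and the return points contribute the weight j. What remains is the divisor recursion of
  \<open>sublattices\<close>.\<close>

lemma card_trans_tuples:
  assumes "finite S" "S \<noteq> {}"
  shows "card (trans_tuples l S) = fact (card S - 1) * sublattices l (card S)"
  using assms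
proof (induction l arbitrary: S)
  case 0
  obtain p where p: "p \<in> S" using 0 by auto
  have o: "orb [] x = {x}" for x :: 'a
    using orb_least[of x "{x}" "[]"] orb_base[of x "[]"] by auto
  \<comment> \<open>Without generators every orbit is a point, so among nonempty sets only
    singletons carry a transitive empty tuple.\<close>
  have "trans_tuples 0 S = (if card S = 1 then {[]} else {})"
    using p by (auto simp: trans_tuples_def comm_tuples_def o card_1_singleton_iff)
  then show ?case by simp
next
  case (Suc l)
  obtain p where p: "p \<in> S" using Suc by auto
  define n where "n = card S"
  have n: "n > 0" using Suc by (auto simp: n_def card_gt_0_iff)
  have ne: "finite B \<and> B \<noteq> {}" if "p \<in> B" "B \<subseteq> S" for B using that Suc.prems finite_subset by auto
  let ?f = "\<lambda>d. if d dvd n then fact (d - 1) * sublattices l d * (d * fact (n - d)) else 0"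
  have "card (trans_tuples (Suc l) S) = (\<Sum>B | p \<in> B \<and> B \<subseteq> S \<and> card B dvd card S.
       card (trans_tuples l B) * (card B * fact (card S - card B)))"
    using Suc.prems(1) p by (rule card_trans_tuples_Suc)
  \<comment> \<open>Divisibility moves into the summand, which then depends on B only through its
    size.\<close>
  also have "\<dots> = (\<Sum>B | p \<in> B \<and> B \<subseteq> S. ?f (card B))"
    using Suc.prems ne Suc.IH by (intro sum.mono_neutral_cong_left) (auto simp: n_def)
  also have "\<dots> = (\<Sum>j=1..n. ((n - 1) choose (j - 1)) * ?f j)"
    using sum_subsets_containing[OF Suc.prems(1) p, of ?f] by (simp add: n_def)
  also have "\<dots> = (\<Sum>j=1..n. if j dvd n then fact (n - 1) * (j * sublattices l j) else 0)"
  proof (rule sum.cong[OF refl])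
    fix j assume j: "j \<in> {1..n}"
    have "fact (j - 1) * fact (n - j) * ((n - 1) choose (j - 1)) = (fact (n - 1) :: nat)"
      using binomial_fact_lemma[of "j - 1" "n - 1"] j by (simp add: diff_le_mono)
    then show "((n - 1) choose (j - 1)) * ?f j = (if j dvd n then fact (n - 1) * (j * sublattices l j) else 0)"
      by (auto simp: algebra_simps)
  qed
  also have "\<dots> = (\<Sum>j | j dvd n. fact (n - 1) * (j * sublattices l j))"
  proof (rule sum.mono_neutral_cong_right)
    show "{j. j dvd n} \<subseteq> {1..n}"
      using n dvd_pos_nat[OF n] dvd_imp_le[OF _ n] by (auto simp: Suc_le_eq)
  qed auto
  finally show ?case by (simp add: sum_distrib_left n_def)
qed

text \<open>The hypothesis on w is the coefficient form of u W' = y A W with A = sum_j a_l(j) u^j.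
  Keeping w abstract separates the counting from power series, and the general field admits complex
  y.\<close>

lemma sum_power_num_orb:
  fixes y :: "'b::field_char_0"
  assumes "finite S"
    and "w 0 = 1" "\<And>n. n > 0 \<Longrightarrow> of_nat n * w n = y * (\<Sum>j=1..n. of_nat (sublattices l j) * w (n - j))"
  shows "(\<Sum>gs\<in>comm_tuples l S. y ^ num_orb S gs) = fact (card S) * w (card S)"
  using assms(1)
proof (induction "card S" arbitrary: S rule: less_induct)
  case less
  show ?case
  proof (cases "S = {}")
    case True
    \<comment> \<open>On the empty set only the tuple of identities exists, with no orbit, matching
      w 0 = 1.\<close>
    have "comm_tuples l {} = {replicate l (id :: 'a \<Rightarrow> 'a)}"
      by (auto simp: comm_tuples_def replicate_length_same intro!: replicate_eqI)
    then show ?thesis using True assms(2) by (simp add: num_orb_def)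
  next
    case False
    then obtain p where p: "p \<in> S" by auto
    define n where "n = card S"
    have n: "n > 0" using False less by (auto simp: n_def card_gt_0_iff)
    have "(\<Sum>gs\<in>comm_tuples l S. y ^ num_orb S gs) =
      (\<Sum>B | p \<in> B \<and> B \<subseteq> S. of_nat (card (trans_tuples l B)) * y *
       (\<Sum>hs\<in>comm_tuples l (S - B). y ^ num_orb (S - B) hs))"
      by (rule sum_num_orb_rec[OF less.prems p])
    also have "\<dots> = (\<Sum>B | p \<in> B \<and> B \<subseteq> S. of_nat (fact (card B - 1) * sublattices l (card B)) * y *
       (fact (n - card B) * w (n - card B)))"
    proof (rule sum.cong[OF refl])
      fix B assume B: "B \<in> {B. p \<in> B \<and> B \<subseteq> S}"
      then have fB: "finite B" "B \<noteq> {}" using less.prems finite_subset by auto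
      have c: "card (S - B) = n - card B" using B fB by (simp add: card_Diff_subset n_def)
      have "card (S - B) < card S" using B less.prems p by (intro psubset_card_mono) auto
      from less.hyps[OF this] c
      show "of_nat (card (trans_tuples l B)) * y * (\<Sum>hs\<in>comm_tuples l (S - B). y ^ num_orb (S - B) hs) =
        of_nat (fact (card B - 1) * sublattices l (card B)) * y * (fact (n - card B) * w (n - card B))"
        using less.prems card_trans_tuples[OF fB] by simp
    qed
    also have "\<dots> = (\<Sum>j=1..n. of_nat ((n - 1) choose (j - 1)) *
       (of_nat (fact (j - 1) * sublattices l j) * y * (fact (n - j) * w (n - j))))"
      using sum_subsets_containing[OF less.prems p] by (simp add: n_def)
    also have "\<dots> = (\<Sum>j=1..n. fact (n - 1) * y * (of_nat (sublattices l j) * w (n - j)))"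
    proof (rule sum.cong[OF refl])
      fix j assume j: "j \<in> {1..n}"
      have "fact (j - 1) * fact (n - j) * ((n - 1) choose (j - 1)) = (fact (n - 1) :: nat)"
        using binomial_fact_lemma[of "j - 1" "n - 1"] j by (simp add: diff_le_mono)
      then have "of_nat (fact (j - 1) * fact (n - j) * ((n - 1) choose (j - 1))) = (of_nat (fact (n - 1)) :: 'b)"
        by metis
      then have "(fact (n - 1) :: 'b) = fact (j - 1) * fact (n - j) * of_nat ((n - 1) choose (j - 1))"
        by simp
      then show "of_nat ((n - 1) choose (j - 1)) *
       (of_nat (fact (j - 1) * sublattices l j) * y * (fact (n - j) * w (n - j))) =
        fact (n - 1) * y * (of_nat (sublattices l j) * w (n - j))"
        by (simp add: mult_ac)
    qed
    also have "\<dots> = fact (n - 1) * (of_nat n * w n)"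
      unfolding assms(3)[OF n] by (simp add: sum_distrib_left mult_ac)
    also have "\<dots> = fact n * w n" using n by (cases n) (simp_all add: mult_ac)
    finally show ?thesis by (simp add: n_def)
  qed
qed

section \<open>Coefficients of exponentials of power series\<close>

lemma set_integral_cis:
  "(LINT t:{-pi..pi}|lborel. cis (of_int m * t)) = (if m = 0 then of_real (2 * pi) else 0)"
proof -
  have int: "set_integrable lborel {-pi..pi} (\<lambda>t. cis (of_int m * t))"
    by (intro borel_integrable_atLeastAtMost' continuous_intros)
  show ?thesis
  proof (cases "m = 0")
    case True
    then show ?thesis using set_borel_integral_eq_integral(2)[OF int]
      by (simp add: scaleR_conv_of_real)
  next
    case False
    have "((\<lambda>t. cis (of_int m * t) / (\<i> * of_int m)) has_vector_derivative cis (of_int m * t)) (at t within {-pi..pi})" for t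
      using False unfolding cis_conv_exp
      by (auto intro!: derivative_eq_intros has_vector_derivative_real_field simp: field_simps)
    then have "((\<lambda>t. cis (of_int m * t)) has_integral
        (cis (of_int m * pi) / (\<i> * of_int m) - cis (of_int m * (- pi)) / (\<i> * of_int m))) {-pi..pi}"
      by (intro fundamental_theorem_of_calculus) auto
    moreover have "cis (of_int m * pi) = cis (of_int m * (- pi))"
    proof -
      have "cis (of_int m * pi) = cis (of_int m * (- pi)) * cis (of_int m * (2 * pi))"
        by (simp add: cis_mult algebra_simps)
      also have "cis (of_int m * (2 * pi)) = 1"
        using cis_multiple_2pi[of "of_int m"] by (simp add: mult_ac)
      finally show ?thesis by simp
    qed
    ultimately have "((\<lambda>t. cis (of_int m * t)) has_integral 0) {-pi..pi}" by simp
    then show ?thesis using False set_borel_integral_eq_integral(2)[OF int]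
      by (simp add: integral_unique)
  qed
qed

text \<open>Cauchy's coefficient formula on the circle of radius r: absolute convergence permits
  termwise integration, and only the frequency k = n survives.\<close>

lemma power_series_coeff_integral:
  fixes a :: "nat \<Rightarrow> complex"
  assumes "\<And>t. (\<lambda>k. a k * (of_real r * cis t) ^ k) sums f t"
    and "summable (\<lambda>k. norm (a k) * r ^ k)" "0 \<le> r"
  shows "(LINT t:{-pi..pi}|lborel. f t * cis (- (real n * t))) = of_real (2 * pi) * (a n * of_real r ^ n)"
proof -
  let ?g = "\<lambda>k t. indicator {-pi..pi} t *\<^sub>R (a k * of_real r ^ k * cis (of_int (int k - int n) * t))"
  have eq: "a k * (of_real r * cis t) ^ k * cis (- (real n * t)) = a k * of_real r ^ k * cis (of_int (int k - int n) * t)" for k t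
  proof -
    have "cis t ^ k * cis (- (real n * t)) = cis (of_int (int k - int n) * t)"
      unfolding Complex.DeMoivre cis_mult by (rule arg_cong[of _ _ cis]) (simp add: algebra_simps)
    then show ?thesis by (simp only: power_mult_distrib mult.assoc)
  qed
  have nrm: "norm (?g k t) = indicator {-pi..pi} t * (norm (a k) * r ^ k)" for k t
    unfolding norm_scaleR norm_mult norm_power norm_of_real norm_cis using assms(3) by simp
  have int: "set_integrable lborel {-pi..pi} (\<lambda>t. a k * of_real r ^ k * cis (of_int (int k - int n) * t))" for k
    by (intro borel_integrable_atLeastAtMost' continuous_intros)
  have A: "(\<lambda>k. LINT t|lborel. ?g k t) sums (LINT t|lborel. (\<Sum>k. ?g k t))"
  proof (rule sums_integral)
    show "integrable lborel (?g k)" for k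
      using int[of k] by (simp add: set_integrable_def)
    show "AE t in lborel. summable (\<lambda>k. norm (?g k t))"
      unfolding nrm using assms(2) by (intro AE_I2 summable_mult)
    show "summable (\<lambda>k. LINT t|lborel. norm (?g k t))"
      unfolding nrm using summable_mult[OF assms(2), of "2 * pi"] by (simp add: mult_ac)
  qed
  have B: "(\<Sum>k. ?g k t) = indicator {-pi..pi} t *\<^sub>R (f t * cis (- (real n * t)))" for t
    using sums_scaleR_right[OF sums_mult2[OF assms(1)[of t], of "cis (- (real n * t))"], of "indicator {-pi..pi} t"]
    unfolding eq by (simp add: sums_iff)
  have C: "(LINT t|lborel. ?g k t) = (if k = n then of_real (2 * pi) * (a n * of_real r ^ n) else 0)" for k
  proof -
    have "(LINT t|lborel. ?g k t) = (LINT t:{-pi..pi}|lborel. a k * of_real r ^ k * cis (of_int (int k - int n) * t))"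
      unfolding set_lebesgue_integral_def ..
    also have "\<dots> = a k * of_real r ^ k * (LINT t:{-pi..pi}|lborel. cis (of_int (int k - int n) * t))"
      by (rule set_integral_mult_right)
    finally show ?thesis unfolding set_integral_cis by auto
  qed
  from A have "(\<lambda>k. if k = n then of_real (2 * pi) * (a n * of_real r ^ n) else 0) sums
      (LINT t:{-pi..pi}|lborel. f t * cis (- (real n * t)))"
    unfolding B C by (simp add: set_lebesgue_integral_def)
  then show ?thesis using sums_single[of n "\<lambda>_. of_real (2 * pi) * (a n * of_real r ^ n)"]
    by (metis (no_types, lifting) sums_unique2)
qed

text \<open>The coefficient of u^n in the formal power series exp (y * sum_k c(k) u^k); meant for
  c(0) = 0.\<close>

definition exp_coeff :: "(nat \<Rightarrow> complex) \<Rightarrow> complex \<Rightarrow> nat \<Rightarrow> complex" where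
  "exp_coeff c y n = fps_nth (fps_compose (fps_exp y) (Abs_fps c)) n"

lemma exp_coeff_0: "exp_coeff c y 0 = 1"
  by (simp add: exp_coeff_def fps_compose_nth)

text \<open>Coefficient comparison in W' = y C' W for W = exp (y C).\<close>

lemma exp_coeff_rec:
  assumes "c 0 = 0" "n > 0"
  shows "of_nat n * exp_coeff c y n = y * (\<Sum>j=1..n. of_nat j * c j * exp_coeff c y (n - j))"
proof -
  let ?C = "Abs_fps c" and ?W = "fps_compose (fps_exp y) (Abs_fps c)"
  obtain m where n: "n = Suc m" using assms(2) by (cases n) auto
  have "fps_deriv ?W = (fps_deriv (fps_exp y) oo ?C) * fps_deriv ?C"
    using assms by (intro fps_compose_deriv) simp
  also have "fps_deriv (fps_exp y) oo ?C = fps_const y * ?W"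
    by (simp add: fps_compose_mult_distrib assms)
  finally have "fps_nth (fps_deriv ?W) m = y * fps_nth (fps_deriv ?C * ?W) m"
    by (simp add: mult_ac)
  also have "fps_nth (fps_deriv ?C * ?W) m = (\<Sum>i=0..m. of_nat (Suc i) * c (Suc i) * exp_coeff c y (m - i))"
    by (simp add: fps_mult_nth exp_coeff_def)
  also have "\<dots> = (\<Sum>j=1..n. of_nat j * c j * exp_coeff c y (n - j))"
    unfolding n by (rule sum.reindex_bij_witness[of _ "\<lambda>j. j - 1" Suc]) auto
  finally show ?thesis by (simp add: n exp_coeff_def del: of_nat_Suc)
qed

text \<open>The function exp (y C) is holomorphic on the unit disc, so its Taylor series, which is
  the formal composition, converges to it there.\<close>

lemma exp_coeff_sums:
  assumes "c 0 = 0" "\<And>r. 0 < r \<Longrightarrow> r < 1 \<Longrightarrow> summable (\<lambda>n. norm (c n) * r ^ n)" "norm z < 1"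
  shows "(\<lambda>n. exp_coeff c y n * z ^ n) sums exp (y * (\<Sum>n. c n * z ^ n))"
proof -
  let ?C = "Abs_fps c"
  have rad: "fps_conv_radius ?C \<ge> 1"
    unfolding fps_conv_radius_def
  proof (rule conv_radius_geI_ex')
    fix r :: real assume "0 < r" "ereal r < 1"
    then show "summable (\<lambda>n. fps_nth ?C n * of_real r ^ n)"
      using assms(2)[of r] by (intro summable_norm_cancel[of "\<lambda>n. fps_nth ?C n * of_real r ^ n"]) (simp add: norm_mult norm_power)
  qed
  then have pos: "fps_conv_radius ?C > 0" by (rule less_le_trans[rotated]) simp
  have "((\<lambda>x. exp (y * x)) \<circ> eval_fps ?C) has_fps_expansion (fps_exp y oo ?C)"
    by (rule has_fps_expansion_compose[OF has_fps_expansion_exp eval_fps_has_fps_expansion[OF pos]]) (simp add: assms)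
  moreover have "(\<lambda>x. exp (y * x)) \<circ> eval_fps ?C holomorphic_on eball 0 1"
  proof -
    have "eball (0::complex) 1 \<subseteq> eball 0 (fps_conv_radius ?C)"
    proof
      fix z :: complex assume "z \<in> eball 0 1"
      then have "ereal (norm z) < 1" by simp
      also note rad
      finally show "z \<in> eball 0 (fps_conv_radius ?C)" by simp
    qed
    then have "eval_fps ?C holomorphic_on eball 0 1" by (rule holomorphic_on_eval_fps)
    then show ?thesis unfolding o_def
      by (rule holomorphic_on_exp'[OF holomorphic_on_mult[OF holomorphic_on_const]])
  qed
  ultimately have "(\<lambda>n. fps_nth (fps_exp y oo ?C) n * z ^ n) sums ((\<lambda>x. exp (y * x)) \<circ> eval_fps ?C) z"
    by (rule has_fps_expansion_imp_sums_complex) (use assms(3) in simp)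
  then show ?thesis by (simp add: exp_coeff_def eval_fps_def)
qed

lemma exp_coeff_integral:
  assumes "c 0 = 0" "\<And>r. 0 < r \<Longrightarrow> r < 1 \<Longrightarrow> summable (\<lambda>n. norm (c n) * r ^ n)" "0 < r" "r < 1"
  shows "(LINT t:{-pi..pi}|lborel. exp (y * (\<Sum>k. c k * (of_real r * cis t) ^ k)) * cis (- (real n * t))) =
    of_real (2 * pi) * (exp_coeff c y n * of_real r ^ n)"
proof (rule power_series_coeff_integral)
  show "(\<lambda>k. exp_coeff c y k * (of_real r * cis t) ^ k) sums exp (y * (\<Sum>k. c k * (of_real r * cis t) ^ k))" for t
    using assms by (intro exp_coeff_sums) (auto simp: norm_mult)
  \<comment> \<open>Convergence at a radius strictly between r and 1 gives absolute convergence at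
    r.\<close>
  define s where "s = (r + 1) / 2"
  have s: "0 < s" "s < 1" "r < s" using assms by (auto simp: s_def)
  have "summable (\<lambda>k. exp_coeff c y k * of_real s ^ k)"
    using exp_coeff_sums[OF assms(1,2), of "of_real s" y] s by (auto simp: sums_iff)
  then have "summable (\<lambda>k. norm (exp_coeff c y k * of_real r ^ k))"
    by (rule powser_insidea) (use s assms in auto)
  then show "summable (\<lambda>k. norm (exp_coeff c y k) * r ^ k)"
    using assms by (simp add: norm_mult norm_power)
qed (use assms in auto)

section \<open>Lambert-type series near zero\<close>

lemma power_le_fact_exp: "0 \<le> x \<Longrightarrow> x ^ p \<le> fact p * exp (x :: real)"
proof -
  assume x: "0 \<le> x"
  have "x ^ p /\<^sub>R fact p \<le> (\<Sum>n. x ^ n /\<^sub>R fact n)"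
    using x summable_exp_generic[of x] by (intro sum_le_suminf[of _ "{p}", simplified]) auto
  then show ?thesis by (simp add: exp_def field_simps)
qed

text \<open>Half of the exponential absorbs n^p; the other half remains as a geometric term.\<close>

lemma power_times_exp_le:
  assumes "0 < t"
  shows "real n ^ p * exp (- real n * t) \<le> fact p * (2 / t) ^ p * exp (- (t / 2)) ^ n"
proof -
  have "(real n * t / 2) ^ p \<le> fact p * exp (real n * t / 2)"
    using assms by (intro power_le_fact_exp) auto
  then have "(2 / t) ^ p * (real n * t / 2) ^ p * exp (- real n * t) \<le> (2 / t) ^ p * (fact p * exp (real n * t / 2)) * exp (- real n * t)"
    using assms by (intro mult_right_mono mult_left_mono) auto
  also have "(2 / t) ^ p * (real n * t / 2) ^ p = real n ^ p"
    using assms by (simp flip: power_mult_distrib)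
  also have "(2 / t) ^ p * (fact p * exp (real n * t / 2)) * exp (- real n * t) =
    fact p * (2 / t) ^ p * exp (- (t / 2)) ^ n"
    by (simp add: exp_of_nat_mult[symmetric] mult_exp_exp field_simps)
  finally show ?thesis by (simp add: mult_ac)
qed

lemma summable_power_times_exp:
  assumes "0 < (t::real)"
  shows "summable (\<lambda>n. real n ^ p * exp (- real n * t))"
proof (rule summable_comparison_test')
  show "summable (\<lambda>n. fact p * (2 / t) ^ p * exp (- (t / 2)) ^ n)"
    using assms by (intro summable_mult summable_geometric) auto
  show "norm (real n ^ p * exp (- real n * t)) \<le> fact p * (2 / t) ^ p * exp (- (t / 2)) ^ n" for n
    using power_times_exp_le[OF assms, of n p] by simp
qed

section \<open>Growth of the subgroup numbers and the series built from them\<close>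

lemma sublattices_0_right [simp]: "sublattices l 0 = 0"
  by (cases l) auto

text \<open>Each divisor and the number of divisors are at most n, which costs a factor n^2 per
  rank. This crude bound secures convergence of the series for every t > 0.\<close>

lemma sublattices_le: "sublattices l n \<le> n ^ (2 * l)"
proof (induction l arbitrary: n)
  case (Suc l)
  show ?case
  proof (cases "n = 0")
    case False
    have sub: "{d. d dvd n} \<subseteq> {1..n}" using False by (auto simp: Suc_le_eq dvd_imp_le intro: Nat.gr0I)
    have "sublattices (Suc l) n \<le> (\<Sum>d | d dvd n. n * n ^ (2 * l))"
      unfolding sublattices.simps
    proof (rule sum_mono)
      fix d assume "d \<in> {d. d dvd n}"
      then have "d \<le> n" using sub by auto
      then show "d * sublattices l d \<le> n * n ^ (2 * l)"
        using Suc.IH[of d] power_mono[of d n "2 * l"] by (intro mult_mono) auto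
    qed
    also have "\<dots> = card {d. d dvd n} * (n * n ^ (2 * l))" by simp
    also have "\<dots> \<le> n * (n * n ^ (2 * l))"
      using card_mono[OF _ sub] by (intro mult_right_mono) auto
    finally show ?thesis by (simp add: power_add[symmetric] power2_eq_square mult_ac)
  qed simp
qed auto

text \<open>The divisor d = n alone gives this. For rank at least 2 it makes a_l(j)/j at least 1,
  the input to the bound away from angle 0.\<close>

lemma sublattices_ge: "n > 0 \<Longrightarrow> sublattices (Suc l) n \<ge> n ^ l"
proof (induction l)
  case 0
  have "(\<Sum>d\<in>{1}. d * sublattices 0 d) \<le> sublattices (Suc 0) n"
    unfolding sublattices.simps(2)[of 0 n] by (rule sum_mono2) (use 0 in auto)
  then show ?case by simp
next
  case (Suc l)
  have "(\<Sum>d\<in>{n}. d * sublattices (Suc l) d) \<le> sublattices (Suc (Suc l)) n"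
    unfolding sublattices.simps(2)[of "Suc l" n] by (rule sum_mono2) (use Suc in auto)
  then have "n * sublattices (Suc l) n \<le> sublattices (Suc (Suc l)) n" by (simp del: sublattices.simps)
  moreover have "n * n ^ l \<le> n * sublattices (Suc l) n" using Suc by (intro mult_left_mono) auto
  ultimately show ?case unfolding power_Suc by (rule order_trans[rotated])
qed

text \<open>Up to the sign (-1)^k this is the k-th derivative of sum_n a_l(n)/n e^(-nt). The
  quotient \<open>real n ^ k / real n\<close> avoids the exponent k - 1, which would be truncated at
  k = 0; the term n = 0 vanishes.\<close>

definition orbit_series :: "nat \<Rightarrow> nat \<Rightarrow> real \<Rightarrow> real" where
  "orbit_series l k t = (\<Sum>n. real (sublattices l n) * real n ^ k / real n * exp (- real n * t))"

lemma summable_orbit_series: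
  assumes "0 < t"
  shows "summable (\<lambda>n. real (sublattices l n) * real n ^ k / real n * exp (- real n * t))"
proof (rule summable_comparison_test')
  show "summable (\<lambda>n. real n ^ (2 * l + k) * exp (- real n * t))"
    by (rule summable_power_times_exp[OF assms])
  show "norm (real (sublattices l n) * real n ^ k / real n * exp (- real n * t)) \<le> real n ^ (2 * l + k) * exp (- real n * t)" for n
  proof (cases "n = 0")
    case False
    have "real (sublattices l n) \<le> real n ^ (2 * l)"
      using sublattices_le[of l n] by (metis of_nat_le_iff of_nat_power)
    then have "real (sublattices l n) * real n ^ k / real n \<le> real n ^ (2 * l) * real n ^ k / 1"
      using False by (intro frac_le mult_mono) auto
    from mult_right_mono[OF this, of "exp (- real n * t)"] show ?thesis by (simp add: power_add)
  qed simp
qed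

lemma orbit_series_sums:
  "0 < t \<Longrightarrow> (\<lambda>n. real (sublattices l n) * real n ^ k / real n * exp (- real n * t)) sums orbit_series l k t"
  unfolding orbit_series_def by (intro summable_sums summable_orbit_series)

lemma orbit_series_has_sum:
  assumes "0 < t"
  shows "((\<lambda>n. real (sublattices l n) * real n ^ k / real n * exp (- real n * t)) has_sum orbit_series l k t) {1..}"
proof -
  have "((\<lambda>n. real (sublattices l n) * real n ^ k / real n * exp (- real n * t)) has_sum orbit_series l k t) UNIV"
    by (intro sums_nonneg_imp_has_sum orbit_series_sums assms) auto
  then show ?thesis
    by (subst has_sum_cong_neutral[where T = UNIV]) (auto simp: not_le)
qed

lemma orbit_series_nonneg: "0 < t \<Longrightarrow> 0 \<le> orbit_series l k t"
  unfolding orbit_series_def by (intro suminf_nonneg summable_orbit_series) auto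

text \<open>Write n = m d in the divisor recursion and sum over m and d independently; all terms are
  nonnegative, so the rearrangement is harmless. Lowering the rank by one raises k by one and
  dilates t by m.\<close>

lemma orbit_series_Suc:
  assumes t: "0 < t"
  shows "((\<lambda>m. real m ^ k / real m * orbit_series l (Suc k) (real m * t)) has_sum orbit_series (Suc l) k t) {1..}"
proof -
  let ?F = "\<lambda>(n, d). real (sublattices l d) * real d * (real n ^ k / real n * exp (- real n * t))"
  let ?A = "Sigma {1::nat..} (\<lambda>n. {d. d dvd n})"
  have inner: "((\<lambda>d. ?F (n, d)) has_sum (real (sublattices (Suc l) n) * real n ^ k / real n * exp (- real n * t))) {d. d dvd n}"
    if "n \<in> {1..}" for n
  proof -
    have fin: "finite {d. d dvd n}" using that by auto
    have "(\<Sum>d | d dvd n. ?F (n, d)) = real (sublattices (Suc l) n) * real n ^ k / real n * exp (- real n * t)"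
    proof -
      have "(\<Sum>d | d dvd n. ?F (n, d)) =
        (\<Sum>d | d dvd n. real (sublattices l d) * real d) * (real n ^ k / real n * exp (- real n * t))"
        unfolding prod.case sum_distrib_right ..
      also have "(\<Sum>d | d dvd n. real (sublattices l d) * real d) = real (sublattices (Suc l) n)"
        by (simp add: mult.commute)
      finally show ?thesis by (simp add: mult.assoc)
    qed
    then show ?thesis using has_sum_finite[OF fin, of "\<lambda>d. ?F (n, d)"] by simp
  qed
  have "?F summable_on ?A"
    by (rule summable_on_SigmaI[OF inner has_sum_imp_summable[OF orbit_series_has_sum[OF t]]]) auto
  then have "(?F has_sum orbit_series (Suc l) k t) ?A"
    by (intro has_sum_SigmaI[OF inner orbit_series_has_sum[OF t]])
  also have "?this \<longleftrightarrow> ((\<lambda>(m, d). real m ^ k / real m * (real (sublattices l d) * real d ^ Suc k / real d * exp (- real d * (real m * t))))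
      has_sum orbit_series (Suc l) k t) ({1..} \<times> {1..})"
    by (rule has_sum_reindex_bij_witness[where i = "\<lambda>(m, d). (m * d, d)" and j = "\<lambda>(n, d). (n div d, d)"])
       (auto simp: field_simps power_mult_distrib Suc_le_eq intro!: Nat.gr0I dest!: dvd_pos_nat elim!: dvdE)
  finally have S: "((\<lambda>(m, d). real m ^ k / real m * (real (sublattices l d) * real d ^ Suc k / real d * exp (- real d * (real m * t))))
      has_sum orbit_series (Suc l) k t) ({1..} \<times> {1..})" .
  show ?thesis
  proof (rule has_sum_SigmaD[OF S])
    fix m :: nat assume "m \<in> {1..}"
    then show "((\<lambda>d. case (m, d) of (m, d) \<Rightarrow> real m ^ k / real m * (real (sublattices l d) * real d ^ Suc k / real d * exp (- real d * (real m * t))))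
        has_sum real m ^ k / real m * orbit_series l (Suc k) (real m * t)) {1..}"
      unfolding prod.case using t by (intro has_sum_cmult_right orbit_series_has_sum) auto
  qed
qed

section \<open>The rank-one series\<close>

lemma sublattices_1: "n > 0 \<Longrightarrow> sublattices (Suc 0) n = 1"
proof -
  assume n: "n > 0"
  have "(\<Sum>d | d dvd n. d * sublattices 0 d) = (\<Sum>d\<in>{1::nat}. 1)"
    by (rule sum.mono_neutral_cong_right) (use n in auto)
  then show ?thesis by simp
qed

lemma negative_binomial_sums:
  assumes "0 < q" "q < (1::real)"
  shows "(\<lambda>n. real ((n + k) choose k) * q ^ n) sums (1 / (1 - q) ^ Suc k)"
proof -
  have "(\<lambda>n. ((- real (Suc k)) gchoose n) * (- q) ^ n) sums (1 + (- q)) powr (- real (Suc k))"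
    using assms by (intro gen_binomial_real) auto
  moreover have "((- real (Suc k)) gchoose n) * (- q) ^ n = real ((n + k) choose k) * q ^ n" for n
  proof -
    have "(- real (Suc k)) gchoose n = (-1) ^ n * (real (n + k) gchoose n)"
      by (subst gbinomial_minus) (simp add: algebra_simps)
    also have "real (n + k) gchoose n = real ((n + k) choose k)"
      unfolding binomial_gbinomial[symmetric] using binomial_symmetric[of k "n + k"] by simp
    finally show ?thesis by (simp flip: power_mult_distrib mult.assoc)
  qed
  moreover have "(1 + (- q)) powr (- real (Suc k)) = 1 / (1 - q) ^ Suc k"
    using assms by (simp add: powr_minus powr_realpow divide_inverse del: of_nat_Suc power_Suc)
  ultimately show ?thesis by simp
qed

text \<open>The series is sum_{n>=1} n^k q^n with q = e^(-t). Squeezing n^k between k! C(n,k) and k!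
  C(n+k,k) leaves negative binomial series with closed sums. The third bound holds on the whole
  half-line, as the dilated arguments m t of the rank recursion require.\<close>

lemma orbit_series_1_bounds:
  assumes "0 < t"
  shows "orbit_series (Suc 0) (Suc k) t \<le> fact k / (1 - exp (- t)) ^ Suc k"
    and "fact k * exp (- t) ^ k / (1 - exp (- t)) ^ Suc k - 1 \<le> orbit_series (Suc 0) (Suc k) t"
    and "t ^ Suc k * orbit_series (Suc 0) (Suc k) t \<le> fact k * 2 ^ Suc k"
proof -
  let ?q = "exp (- t)"
  have q: "0 < ?q" "?q < 1" using assms by auto
  let ?f = "\<lambda>n. real (sublattices (Suc 0) n) * real n ^ Suc k / real n * exp (- real n * t)"
  have f: "?f n = (if n = 0 then 0 else real n ^ k * ?q ^ n)" for n
    using sublattices_1[of n] by (auto simp: exp_of_nat_mult[symmetric] simp del: sublattices.simps)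
  note S = orbit_series_sums[OF assms, of "Suc 0" "Suc k", unfolded f]
  show "orbit_series (Suc 0) (Suc k) t \<le> fact k / (1 - ?q) ^ Suc k"
  proof (rule sums_le[OF _ S])
    show "(\<lambda>n. fact k * (real ((n + k) choose k) * ?q ^ n)) sums (fact k / (1 - ?q) ^ Suc k)"
      using sums_mult[OF negative_binomial_sums[OF q, of k], of "fact k"] by simp
    fix n
    have "real n ^ k \<le> (\<Prod>i = 0..<k. real (n + k) - real i)"
      using prod_mono[of "{0..<k}" "\<lambda>_. real n" "\<lambda>i. real (n + k) - real i"] by simp
    also have "\<dots> = fact k * real ((n + k) choose k)"
      unfolding binomial_gbinomial gbinomial_prod_rev by simp
    finally have "real n ^ k \<le> fact k * real ((n + k) choose k)" .
    then show "(if n = 0 then 0 else real n ^ k * ?q ^ n) \<le> fact k * (real ((n + k) choose k) * ?q ^ n)"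
      using q by (auto simp: mult.assoc[symmetric] intro!: mult_right_mono)
  qed
  show "fact k * ?q ^ k / (1 - ?q) ^ Suc k - 1 \<le> orbit_series (Suc 0) (Suc k) t"
  proof (rule sums_le[OF _ _ S])
    have "(\<lambda>n. real ((n + k) choose k) * ?q ^ (n + k)) sums (?q ^ k / (1 - ?q) ^ Suc k)"
      using sums_mult2[OF negative_binomial_sums[OF q, of k], of "?q ^ k"] by (simp add: power_add mult_ac)
    then have "(\<lambda>n. real (n choose k) * ?q ^ n) sums (?q ^ k / (1 - ?q) ^ Suc k)"
      by (subst sums_zero_iff_shift[of k, symmetric]) auto
    from sums_diff[OF sums_mult[OF this, of "fact k"] sums_single[of 0 "\<lambda>_. 1"]]
    \<comment> \<open>The correction at n = 0 matters for k = 0, where the binomial side has the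
      term 1 and the series has none.\<close>
    show "(\<lambda>n. fact k * (real (n choose k) * ?q ^ n) - (if n = 0 then 1 else 0)) sums (fact k * ?q ^ k / (1 - ?q) ^ Suc k - 1)"
      by simp
    fix n
    have "real (n choose k) * fact k \<le> real n ^ k"
      using binomial_fact_pow[of n k] by (metis of_nat_fact of_nat_le_iff of_nat_mult of_nat_power)
    then have "fact k * (real (n choose k) * ?q ^ n) \<le> real n ^ k * ?q ^ n"
      using mult_right_mono[of _ _ "?q ^ n"] q by (simp add: mult_ac)
    then show "fact k * (real (n choose k) * ?q ^ n) - (if n = 0 then 1 else 0) \<le> (if n = 0 then 0 else real n ^ k * ?q ^ n)"
      by (cases "n = 0") (auto simp: power_0_left split: if_splits)
  qed
  let ?s = "exp (- (t / 2))"
  have "orbit_series (Suc 0) (Suc k) t \<le> fact k * (2 / t) ^ k * (1 / (1 - ?s) - 1)"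
  proof (rule sums_le[OF _ S])
    \<comment> \<open>Without the term n = 0 the geometric sum stays below 2/t even for large t;
      with it the product with t^(k+1) would be unbounded.\<close>
    have "(\<lambda>n. ?s ^ n) sums (1 / (1 - ?s))" using assms by (intro geometric_sums) auto
    from sums_diff[OF this sums_single[of 0 "\<lambda>_. 1"]]
    have "(\<lambda>n. ?s ^ n - (if n = 0 then 1 else 0)) sums (1 / (1 - ?s) - 1)" by simp
    from sums_mult[OF this, of "fact k * (2 / t) ^ k"]
    show "(\<lambda>n. fact k * (2 / t) ^ k * (?s ^ n - (if n = 0 then 1 else 0))) sums (fact k * (2 / t) ^ k * (1 / (1 - ?s) - 1))" .
    show "(if n = 0 then 0 else real n ^ k * ?q ^ n) \<le> fact k * (2 / t) ^ k * (?s ^ n - (if n = 0 then 1 else 0))" for n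
      using power_times_exp_le[OF assms, of n k] by (auto simp: exp_of_nat_mult[symmetric])
  qed
  also have "1 / (1 - ?s) - 1 \<le> 2 / t"
  proof -
    have "?s * (1 + t / 2) \<le> ?s * exp (t / 2)"
      using exp_ge_add_one_self[of "t / 2"] by (intro mult_left_mono) auto
    then have "?s * (1 + t / 2) \<le> 1" by (simp add: mult_exp_exp)
    moreover have "?s < 1" using assms by simp
    ultimately show ?thesis using assms by (simp add: field_simps)
  qed
  finally have "orbit_series (Suc 0) (Suc k) t \<le> fact k * (2 / t) ^ k * (2 / t)"
    using assms by (simp add: mult_left_mono)
  then have "t ^ Suc k * orbit_series (Suc 0) (Suc k) t \<le> t ^ Suc k * (fact k * (2 / t) ^ Suc k)"
    using assms by (intro mult_left_mono) (auto simp: mult_ac)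
  also have "\<dots> = fact k * 2 ^ Suc k" using assms by (simp add: power_divide)
  finally show "t ^ Suc k * orbit_series (Suc 0) (Suc k) t \<le> fact k * 2 ^ Suc k" .
qed

section \<open>Zeta factors and leading asymptotics in every rank\<close>

definition zeta_prod :: "nat \<Rightarrow> real" where
  "zeta_prod l = (\<Prod>j=2..l. zeta (real j))"

lemma summable_zeta: "summable (\<lambda>m. 1 / real (Suc m) ^ Suc (Suc l))"
proof -
  have "summable (\<lambda>m. inverse (real (Suc m) ^ Suc (Suc l)))"
    using inverse_power_summable[of "Suc (Suc l)", where 'a = real] by (subst summable_Suc_iff) simp
  then show ?thesis by (simp add: inverse_eq_divide)
qed

lemma zeta_sums: "(\<lambda>m. 1 / real (Suc m) ^ Suc (Suc l)) sums zeta (real (Suc (Suc l)))"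
  using summable_sums[OF summable_zeta[of l]] unfolding zeta_def by (simp add: powr_realpow del: of_nat_Suc power_Suc)

lemma zeta_pos: "0 < zeta (real (Suc (Suc l)))"
  using zeta_sums[of l] suminf_pos[OF summable_zeta[of l]] by (simp add: sums_iff)

lemma zeta_prod_pos: "0 < zeta_prod l"
  unfolding zeta_prod_def
proof (rule prod_pos)
  fix j assume "j \<in> {2..l}"
  then obtain i where "j = Suc (Suc i)" by (auto simp: numeral_2_eq_2 Suc_le_eq dest!: less_imp_Suc_add)
  then show "0 < zeta (real j)" using zeta_pos[of i] by simp
qed

text \<open>Induction on the rank with k free. In the recursion from l to l + 1, t^(l+k) times the
  m-th term is m^(-(l+1)) times a function of m t alone, so Tannery's theorem produces the factor
  zeta(l+1). The bound for all t > 0 supplies the majorant, so both claims go through one induction.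
  The condition 2 <= l + k excludes l = 1, k = 0, where the series is logarithmic.\<close>

lemma orbit_series_asymp:
  assumes "1 \<le> l" "2 \<le> l + k"
  shows "((\<lambda>t. t ^ (l + k - 1) * orbit_series l k t) \<longlongrightarrow> fact (l + k - 2) * zeta_prod l) (at_right 0)"
    and "\<exists>C. \<forall>t>0. t ^ (l + k - 1) * orbit_series l k t \<le> C"
proof -
  have "((\<lambda>t. t ^ (l + k - 1) * orbit_series l k t) \<longlongrightarrow> fact (l + k - 2) * zeta_prod l) (at_right 0) \<and>
    (\<exists>C. \<forall>t>0. t ^ (l + k - 1) * orbit_series l k t \<le> C)"
    using assms
  proof (induction l arbitrary: k rule: nat_induct_at_least)
    case base
    then obtain j where k: "k = Suc j" by (cases k) auto
    have "((\<lambda>t. t ^ Suc j * orbit_series 1 (Suc j) t) \<longlongrightarrow> fact j) (at_right 0)"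
    proof (rule tendsto_sandwich[where f = "\<lambda>t::real. fact j * exp (- t) ^ j * (t / (1 - exp (- t))) ^ Suc j - t ^ Suc j"
        and h = "\<lambda>t::real. fact j * (t / (1 - exp (- t))) ^ Suc j"])
      have 1: "((\<lambda>t::real. t / (1 - exp (- t))) \<longlongrightarrow> 1) (at_right 0)" by real_asymp
      have 2: "((\<lambda>t::real. exp (- t)) \<longlongrightarrow> 1) (at_right 0)" by real_asymp
      have 3: "((\<lambda>t::real. t ^ Suc j) \<longlongrightarrow> 0) (at_right 0)" by (auto intro!: tendsto_eq_intros)
      show "((\<lambda>t::real. fact j * (t / (1 - exp (- t))) ^ Suc j) \<longlongrightarrow> fact j) (at_right 0)"
        using tendsto_mult[OF tendsto_const tendsto_power[OF 1], of "fact j" "Suc j"] by (simp del: power_Suc)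
      show "((\<lambda>t::real. fact j * exp (- t) ^ j * (t / (1 - exp (- t))) ^ Suc j - t ^ Suc j) \<longlongrightarrow> fact j) (at_right 0)"
        using tendsto_diff[OF tendsto_mult[OF tendsto_mult[OF tendsto_const tendsto_power[OF 2]] tendsto_power[OF 1]] 3, of "fact j" j "Suc j"] by (simp del: power_Suc)
      have pos: "eventually (\<lambda>t::real. t > 0) (at_right 0)" by (simp add: eventually_at_right_less)
      show "\<forall>\<^sub>F t in at_right 0. t ^ Suc j * orbit_series 1 (Suc j) t \<le> fact j * (t / (1 - exp (- t))) ^ Suc j"
        using pos
      proof eventually_elim
        case (elim t)
        have "t ^ Suc j * orbit_series (Suc 0) (Suc j) t \<le> t ^ Suc j * (fact j / (1 - exp (- t)) ^ Suc j)"
          using elim orbit_series_1_bounds(1)[OF elim, of j] by (intro mult_left_mono) auto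
        then show ?case by (simp add: power_divide mult_ac)
      qed
      show "\<forall>\<^sub>F t in at_right 0. fact j * exp (- t) ^ j * (t / (1 - exp (- t))) ^ Suc j - t ^ Suc j \<le> t ^ Suc j * orbit_series 1 (Suc j) t"
        using pos
      proof eventually_elim
        case (elim t)
        have "t ^ Suc j * (fact j * exp (- t) ^ j / (1 - exp (- t)) ^ Suc j - 1) \<le> t ^ Suc j * orbit_series (Suc 0) (Suc j) t"
          using elim orbit_series_1_bounds(2)[OF elim, of j] by (intro mult_left_mono) auto
        then show ?case by (simp add: power_divide right_diff_distrib mult_ac)
      qed
    qed
    then show ?case using orbit_series_1_bounds(3)[of _ j] by (auto simp: k zeta_prod_def simp del: power_Suc)
  next
    case (Suc l)
    have lk: "2 \<le> l + Suc k" using Suc by simp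
    define p where "p = l + k"
    have p: "p = l + Suc k - 1" by (simp add: p_def)
    note IH = Suc.IH[OF lk]
    obtain C where C: "\<And>t. t > 0 \<Longrightarrow> t ^ p * orbit_series l (Suc k) t \<le> C" using IH by (auto simp: p)
    have C0: "0 \<le> C" using C[of 1] orbit_series_nonneg[of 1 l "Suc k"] by simp
    define g where "g m t = 1 / real (Suc m) ^ Suc l * ((real (Suc m) * t) ^ p * orbit_series l (Suc k) (real (Suc m) * t))" for m t
    have g_eq: "t ^ p * (real (Suc m) ^ k / real (Suc m) * orbit_series l (Suc k) (real (Suc m) * t)) = g m t" for m t
      by (simp add: g_def p_def power_mult_distrib power_add field_simps del: of_nat_Suc)
    have gs: "(\<lambda>m. g m t) sums (t ^ p * orbit_series (Suc l) k t)" if "0 < t" for t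
    proof -
      have "((\<lambda>m. real (Suc m) ^ k / real (Suc m) * orbit_series l (Suc k) (real (Suc m) * t)) has_sum orbit_series (Suc l) k t) UNIV"
      proof -
        have b: "bij_betw Suc UNIV {1..}" by (rule bij_betwI[where g = "\<lambda>n. n - 1"]) auto
        show ?thesis
          using orbit_series_Suc[OF that, of k l]
          by (subst has_sum_reindex_bij_betw[OF b, where f = "\<lambda>m. real m ^ k / real m * orbit_series l (Suc k) (real m * t)"])
      qed
      from sums_mult[OF has_sum_imp_sums[OF this], of "t ^ p"] show ?thesis unfolding g_eq .
    qed
    \<comment> \<open>As l >= 1, the exponent is at least 2 and the majorant converges.\<close>
    have l: "Suc l = Suc (Suc (l - 1))" using Suc by simp
    have g_le: "g m t \<le> C * (1 / real (Suc m) ^ Suc l)" if "0 < t" for m t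
      using mult_left_mono[OF C[of "real (Suc m) * t"], of "1 / real (Suc m) ^ Suc l"] that
      by (simp add: g_def mult_ac del: of_nat_Suc)
    have g_nonneg: "0 \<le> g m t" if "0 < t" for m t
      unfolding g_def using that by (intro mult_nonneg_nonneg orbit_series_nonneg) auto
    have pos: "eventually (\<lambda>t::real. t > 0) (at_right 0)" by (simp add: eventually_at_right_less)
    have sM: "summable (\<lambda>m. C * (1 / real (Suc m) ^ Suc l))"
      unfolding l by (intro summable_mult summable_zeta)
    have "((\<lambda>t. \<Sum>m. g m t) \<longlongrightarrow> (\<Sum>m. 1 / real (Suc m) ^ Suc l * (fact (p - 1) * zeta_prod l))) (at_right 0)"
    proof (rule tannerys_theorem[THEN conjunct2, THEN conjunct2])
      show "((\<lambda>t. g m t) \<longlongrightarrow> 1 / real (Suc m) ^ Suc l * (fact (p - 1) * zeta_prod l)) (at_right 0)" for m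
      proof -
        have A: "filterlim (\<lambda>t. real (Suc m) * t) (at_right 0) (at_right 0)"
          by real_asymp
        have B: "((\<lambda>t. t ^ p * orbit_series l (Suc k) t) \<longlongrightarrow> fact (p - 1) * zeta_prod l) (at_right 0)"
          using IH by (simp add: p numeral_2_eq_2)
        show ?thesis unfolding g_def
          by (rule tendsto_mult[OF tendsto_const filterlim_compose[OF B A]])
      qed
      show "\<forall>\<^sub>F (m, t) in at_top \<times>\<^sub>F at_right 0. norm (g m t) \<le> C * (1 / real (Suc m) ^ Suc l)"
        unfolding eventually_prod_filter
      proof (intro exI conjI)
        show "\<forall>\<^sub>F m in at_top. True" by simp
        show "\<forall>\<^sub>F t :: real in at_right 0. 0 < t" by (rule pos)
        show "\<forall>m t. True \<longrightarrow> 0 < t \<longrightarrow> (case (m, t) of (m, t) \<Rightarrow> norm (g m t) \<le> C * (1 / real (Suc m) ^ Suc l))"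
          unfolding prod.case real_norm_def using g_le g_nonneg by (metis abs_of_nonneg)
      qed
      show "summable (\<lambda>m. C * (1 / real (Suc m) ^ Suc l))" by (rule sM)
    qed simp
    also have "(\<Sum>m. 1 / real (Suc m) ^ Suc l * (fact (p - 1) * zeta_prod l)) = fact (p - 1) * zeta_prod (Suc l)"
    proof -
      have "(\<lambda>m. 1 / real (Suc m) ^ Suc l) sums zeta (real (Suc l))"
        using zeta_sums[of "l - 1"] unfolding l[symmetric] .
      from sums_mult2[OF this, of "fact (p - 1) * zeta_prod l"]
      have "(\<Sum>m. 1 / real (Suc m) ^ Suc l * (fact (p - 1) * zeta_prod l)) = zeta (real (Suc l)) * (fact (p - 1) * zeta_prod l)"
        by (simp only: sums_iff)
      also have "\<dots> = fact (p - 1) * (zeta (real (Suc l)) * zeta_prod l)" by (simp only: mult_ac)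
      also have "zeta (real (Suc l)) * zeta_prod l = zeta_prod (Suc l)"
        unfolding zeta_prod_def using Suc.hyps by (subst prod.nat_ivl_Suc') (auto simp del: of_nat_Suc)
      finally show ?thesis .
    qed
    finally have lim: "((\<lambda>t. \<Sum>m. g m t) \<longlongrightarrow> fact (p - 1) * zeta_prod (Suc l)) (at_right 0)" .
    have "\<forall>\<^sub>F t in at_right 0. (\<Sum>m. g m t) = t ^ p * orbit_series (Suc l) k t"
      using pos by eventually_elim (use gs in \<open>simp only: sums_iff\<close>)
    from Lim_transform_eventually[OF lim this]
    have "((\<lambda>t. t ^ p * orbit_series (Suc l) k t) \<longlongrightarrow> fact (p - 1) * zeta_prod (Suc l)) (at_right 0)" .
    moreover have "t ^ p * orbit_series (Suc l) k t \<le> (\<Sum>m. C * (1 / real (Suc m) ^ Suc l))" if "0 < t" for t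
      using sums_le[OF g_le[OF that] gs[OF that] summable_sums[OF sM]] .
    ultimately show ?case by (auto simp: p_def numeral_2_eq_2)
  qed
  then show "((\<lambda>t. t ^ (l + k - 1) * orbit_series l k t) \<longlongrightarrow> fact (l + k - 2) * zeta_prod l) (at_right 0)"
    and "\<exists>C. \<forall>t>0. t ^ (l + k - 1) * orbit_series l k t \<le> C" by blast+
qed

section \<open>The characteristic exponent\<close>

text \<open>Real part of the second-order Taylor estimate for exp (i u).\<close>

lemma one_minus_cos_ge_cubic: "u\<^sup>2 / 2 - \<bar>u\<bar> ^ 3 / 2 \<le> 1 - cos (u :: real)"
proof -
  let ?w = "\<i> * of_real u"
  have "Re (exp ?w - (\<Sum>k\<le>2. ?w ^ k / fact k)) \<le> norm (exp ?w - (\<Sum>k\<le>2. ?w ^ k / fact k))"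
    by (rule complex_Re_le_cmod)
  also have "\<dots> \<le> exp \<bar>Re ?w\<bar> * norm ?w ^ Suc 2 / fact 2" by (rule Taylor_exp)
  also have "\<dots> = \<bar>u\<bar> ^ 3 / 2" by (simp add: norm_mult eval_nat_numeral)
  also have "Re (exp ?w - (\<Sum>k\<le>2. ?w ^ k / fact k)) = cos u - 1 + u\<^sup>2 / 2"
    by (simp add: exp_Euler numeral_2_eq_2 cos_of_real sin_of_real power2_eq_square)
  finally show ?thesis by simp
qed

text \<open>Up to 1/2 the cubic bound gives u^2/4. Beyond that 1 - cos u >= 1/16 by monotonicity,
  and u^2 <= 16 because pi < 4; hence 256 = 16 * 16.\<close>

lemma one_minus_cos_ge_square:
  assumes "\<bar>u\<bar> \<le> pi"
  shows "u\<^sup>2 / 256 \<le> 1 - cos u"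
proof (cases "\<bar>u\<bar> \<le> 1 / 2")
  case True
  have "\<bar>u\<bar> ^ 3 = \<bar>u\<bar> * u\<^sup>2" by (simp add: power3_eq_cube power2_eq_square)
  also have "\<dots> \<le> 1 / 2 * u\<^sup>2" using True by (intro mult_right_mono) auto
  finally show ?thesis using one_minus_cos_ge_cubic[of u] zero_le_power2[of u] by linarith
next
  case False
  have "cos u = cos \<bar>u\<bar>" by simp
  also have "\<dots> \<le> cos (1 / 2)" using False assms by (subst cos_mono_le_eq) auto
  also have "\<dots> \<le> 1 - 1 / 16" using one_minus_cos_ge_cubic[of "1 / 2"] by (simp add: power2_eq_square power3_eq_cube)
  finally have "cos u \<le> 1 - 1 / 16" .
  moreover have "u\<^sup>2 \<le> 4\<^sup>2"
    using assms pi_less_4 by (subst abs_le_square_iff[symmetric]) auto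
  ultimately show ?thesis by simp
qed

lemma one_minus_cos_le: "1 - cos (u :: real) \<le> u\<^sup>2"
proof -
  have "cos u = 1 - 2 * (sin (u / 2))\<^sup>2" using cos_double_sin[of "u / 2"] by simp
  moreover have "(sin (u / 2))\<^sup>2 \<le> (u / 2)\<^sup>2"
    by (rule iffD1[OF abs_le_square_iff abs_sin_x_le_abs_x])
  ultimately show ?thesis by (simp add: power2_eq_square) (smt (verit) zero_le_square)
qed

text \<open>1 - cos u is half the squared chord |e^(iu) - 1|^2, so this is the triangle inequality
  for chords combined with (a + b)^2 <= 2 a^2 + 2 b^2. It separates the imaginary part w of the tilt
  from the angle v.\<close>

lemma one_minus_cos_add_ge: "(1 - cos v) / 2 - (1 - cos w) \<le> 1 - cos (w + v :: real)"
proof -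
  define p q where "p = (w + v) / 2" and "q = w / 2"
  have c: "1 - cos (2 * y) = 2 * (sin y)\<^sup>2" for y :: real using cos_double_sin[of y] by simp
  have "sin (p - q) = sin p * cos q - cos p * sin q" by (rule sin_diff)
  then have "\<bar>sin (p - q)\<bar> \<le> \<bar>sin p\<bar> * \<bar>cos q\<bar> + \<bar>cos p\<bar> * \<bar>sin q\<bar>"
    by (simp add: abs_mult[symmetric])
  also have "\<dots> \<le> \<bar>sin p\<bar> * 1 + 1 * \<bar>sin q\<bar>"
    by (intro add_mono mult_mono) auto
  finally have "\<bar>sin (p - q)\<bar>\<^sup>2 \<le> (\<bar>sin p\<bar> + \<bar>sin q\<bar>)\<^sup>2" by (intro power_mono) auto
  also have "\<dots> \<le> 2 * \<bar>sin p\<bar>\<^sup>2 + 2 * \<bar>sin q\<bar>\<^sup>2"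
    using sum_squares_bound[of "\<bar>sin p\<bar>" "\<bar>sin q\<bar>"] by (simp add: power2_sum)
  finally have "(sin (p - q))\<^sup>2 \<le> 2 * (sin p)\<^sup>2 + 2 * (sin q)\<^sup>2" by simp
  moreover have "1 - cos v = 2 * (sin (p - q))\<^sup>2" "1 - cos (w + v) = 2 * (sin p)\<^sup>2" "1 - cos w = 2 * (sin q)\<^sup>2"
  proof -
    have e: "2 * (p - q) = v" "2 * p = w + v" "2 * q = w" by (simp_all add: p_def q_def field_simps)
    show "1 - cos v = 2 * (sin (p - q))\<^sup>2" "1 - cos (w + v) = 2 * (sin p)\<^sup>2" "1 - cos w = 2 * (sin q)\<^sup>2"
      using c[of "p - q"] c[of p] c[of q] unfolding e by simp_all
  qed
  ultimately show ?thesis by simp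
qed

lemma cube_add_le:
  assumes "0 \<le> a" "0 \<le> (b :: real)"
  shows "(a + b) ^ 3 \<le> 4 * (a ^ 3 + b ^ 3)"
proof -
  have "0 \<le> 3 * ((a + b) * (a - b)\<^sup>2)" using assms by simp
  also have "\<dots> = 4 * (a ^ 3 + b ^ 3) - (a + b) ^ 3" by (simp add: power3_eq_cube power2_eq_square algebra_simps)
  finally show ?thesis by simp
qed

section \<open>Poisson weights and the centred exponent\<close>

locale orbit_saddle =
  fixes l :: nat and x :: real
  assumes l_ge_2: "2 \<le> l" and x_pos: "0 < x"
begin

definition wt :: "real \<Rightarrow> nat \<Rightarrow> real" where
  "wt t j = x * real (sublattices l j) / real j * exp (- real j * t)"

definition G :: "nat \<Rightarrow> real \<Rightarrow> real" where
  "G k t = x * orbit_series l k t"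

abbreviation summand :: "real \<Rightarrow> complex \<Rightarrow> real \<Rightarrow> nat \<Rightarrow> complex" where
  "summand t z th j \<equiv> of_real (wt t j) * (exp (z + \<i> * of_real (real j * th)) - 1 - (z + \<i> * of_real (real j * th)))"

text \<open>In the Poisson model with N orbits of total size T, this is the logarithm of the
  expectation of exp (z (N - \<open>G 0 t\<close>) + i th (T - \<open>G 1 t\<close>)). The linear
  term in \<open>summand\<close> does the centring.\<close>

definition Psi :: "real \<Rightarrow> complex \<Rightarrow> real \<Rightarrow> complex" where
  "Psi t z th = (\<Sum>j. summand t z th j)"

text \<open>Minus the real part of \<open>Psi\<close> at z = 0.\<close>

definition decay :: "real \<Rightarrow> real \<Rightarrow> real" where
  "decay t th = (\<Sum>j. wt t j * (1 - cos (real j * th)))"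

lemma wt_nonneg: "0 \<le> wt t j"
  using x_pos by (simp add: wt_def)

lemma wt_sums: "0 < t \<Longrightarrow> (\<lambda>j. wt t j * real j ^ k) sums G k t"
  using sums_mult[OF orbit_series_sums[of t l k], of x] by (simp add: wt_def G_def mult_ac)

lemma wt_sums_0: "0 < t \<Longrightarrow> wt t sums G 0 t"
  using wt_sums[of t 0] by simp

lemma G_nonneg: "0 < t \<Longrightarrow> 0 \<le> G k t"
  unfolding G_def using x_pos orbit_series_nonneg by simp

text \<open>The subtracted parts of the summands add up to \<open>G 0\<close>, z \<open>G 0\<close>
  and i th \<open>G 1\<close>. What is left is the exponent of the generating function with y = x
  e^z at the point e^(-t + i th).\<close>

lemma Psi_summand_sums:
  assumes t: "0 < t"
  shows "summand t z th sums
    (of_real x * exp z * (\<Sum>k. of_real (real (sublattices l k) / real k) * (of_real (exp (- t)) * cis th) ^ k)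
     - of_real (G 0 t) - z * of_real (G 0 t) - \<i> * of_real th * of_real (G 1 t))"
proof -
  have eq: "of_real x * exp z * (of_real (real (sublattices l k) / real k) * (of_real (exp (- t)) * cis th) ^ k) =
    of_real (wt t k) * exp (z + \<i> * of_real (real k * th))" for k
  proof -
    have "(of_real (exp (- t)) * cis th) ^ k = of_real (exp (- real k * t)) * exp (\<i> * of_real (real k * th))"
      unfolding power_mult_distrib Complex.DeMoivre cis_conv_exp
      by (simp add: exp_of_nat_mult[symmetric] mult_ac flip: of_real_power)
    then show ?thesis by (simp add: wt_def exp_add mult_ac)
  qed
  have "summable (\<lambda>k. norm (of_real (wt t k) * exp (z + \<i> * of_real (real k * th))))"
    using summable_mult2[OF sums_summable[OF wt_sums_0[OF t]], of "exp (Re z)"] wt_nonneg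
    by (simp add: norm_mult)
  then have s: "summable (\<lambda>k. of_real (wt t k) * exp (z + \<i> * of_real (real k * th)))"
    by (rule summable_norm_cancel)
  then have "summable (\<lambda>k. of_real (real (sublattices l k) / real k) * (of_real (exp (- t)) * cis th) ^ k)"
    unfolding eq[symmetric] using x_pos by (subst (asm) summable_cmult_iff) auto
  from sums_mult[OF summable_sums[OF this], of "of_real x * exp z"]
  have 1: "(\<lambda>k. of_real (wt t k) * exp (z + \<i> * of_real (real k * th))) sums
    (of_real x * exp z * (\<Sum>k. of_real (real (sublattices l k) / real k) * (of_real (exp (- t)) * cis th) ^ k))"
    unfolding eq .
  have 2: "(\<lambda>k. of_real (wt t k)) sums (of_real (G 0 t) :: complex)"
    by (intro sums_of_real wt_sums_0 t)
  have 3: "(\<lambda>k. of_real (wt t k * real k)) sums (of_real (G 1 t) :: complex)"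
    using wt_sums[OF t, of 1] by (intro sums_of_real) simp
  from sums_diff[OF sums_diff[OF sums_diff[OF 1 2] sums_mult[OF 2, of z]] sums_mult[OF 3, of "\<i> * of_real th"]]
  show ?thesis by (simp add: algebra_simps)
qed

lemma Psi_sums:
  assumes t: "0 < t"
  shows "summand t z th sums Psi t z th"
  unfolding Psi_def by (rule summable_sums[OF sums_summable[OF Psi_summand_sums[OF t]]])

lemma Psi_eq:
  "0 < t \<Longrightarrow> Psi t z th = of_real x * exp z * (\<Sum>k. of_real (real (sublattices l k) / real k) * (of_real (exp (- t)) * cis th) ^ k)
     - of_real (G 0 t) - z * of_real (G 0 t) - \<i> * of_real th * of_real (G 1 t)"
  using sums_unique2[OF Psi_sums Psi_summand_sums] .

text \<open>Second-order Taylor expansion in w = z + i j th, summed over j. The growth factor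
  involves only Re z because the angle part is imaginary; the constant 2 is 4/2 with the 4 from
  \<open>cube_add_le\<close>.\<close>

lemma Psi_quadratic:
  assumes t: "0 < t"
  shows "norm (Psi t z th - (z\<^sup>2 * of_real (G 0 t) + 2 * \<i> * z * of_real (th * G 1 t) - of_real (th\<^sup>2 * G 2 t)) / 2) \<le>
    2 * exp \<bar>Re z\<bar> * (norm z ^ 3 * G 0 t + \<bar>th\<bar> ^ 3 * G 3 t)"
proof -
  let ?w = "\<lambda>j. z + \<i> * of_real (real j * th)"
  have 0: "(\<lambda>k. of_real (wt t k)) sums (of_real (G 0 t) :: complex)"
    by (intro sums_of_real wt_sums_0 t)
  have 1: "(\<lambda>k. of_real (wt t k * real k ^ 1)) sums (of_real (G 1 t) :: complex)"
    by (intro sums_of_real wt_sums t)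
  have 2: "(\<lambda>k. of_real (wt t k * real k ^ 2)) sums (of_real (G 2 t) :: complex)"
    by (intro sums_of_real wt_sums t)
  have Q: "(\<lambda>j. of_real (wt t j) * ((?w j)\<^sup>2 / 2)) sums
    ((z\<^sup>2 * of_real (G 0 t) + 2 * \<i> * z * of_real (th * G 1 t) - of_real (th\<^sup>2 * G 2 t)) / 2)"
  proof -
    have A: "(\<lambda>j. (z\<^sup>2 * of_real (wt t j) + 2 * \<i> * z * of_real th * of_real (wt t j * real j ^ 1) - of_real (th\<^sup>2) * of_real (wt t j * real j ^ 2)) / 2) sums
      ((z\<^sup>2 * of_real (G 0 t) + 2 * \<i> * z * of_real th * of_real (G 1 t) - of_real (th\<^sup>2) * of_real (G 2 t)) / 2)"
      by (intro sums_divide sums_diff sums_add sums_mult 0 1 2)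
    have B: "(z\<^sup>2 * of_real (wt t j) + 2 * \<i> * z * of_real th * of_real (wt t j * real j ^ 1) - of_real (th\<^sup>2) * of_real (wt t j * real j ^ 2)) / 2 =
      of_real (wt t j) * ((?w j)\<^sup>2 / 2)" for j
      by (simp add: power2_eq_square field_simps)
    from A show ?thesis unfolding B by (simp only: of_real_mult mult.assoc)
  qed
  define d where "d j = of_real (wt t j) * (exp (?w j) - 1 - ?w j) - of_real (wt t j) * ((?w j)\<^sup>2 / 2)" for j
  have D: "d sums (Psi t z th - (z\<^sup>2 * of_real (G 0 t) + 2 * \<i> * z * of_real (th * G 1 t) - of_real (th\<^sup>2 * G 2 t)) / 2)"
    unfolding d_def by (rule sums_diff[OF Psi_sums[OF t] Q])
  define e where "e j = 2 * exp \<bar>Re z\<bar> * (norm z ^ 3 * wt t j + \<bar>th\<bar> ^ 3 * (wt t j * real j ^ 3))" for j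
  have E: "e sums (2 * exp \<bar>Re z\<bar> * (norm z ^ 3 * G 0 t + \<bar>th\<bar> ^ 3 * G 3 t))"
    unfolding e_def by (intro sums_mult sums_add wt_sums wt_sums_0 t)
  have de: "norm (d j) \<le> e j" for j
  proof -
    have "norm (exp (?w j) - (\<Sum>k\<le>2. ?w j ^ k / fact k)) \<le> exp \<bar>Re (?w j)\<bar> * norm (?w j) ^ Suc 2 / fact 2"
      by (rule Taylor_exp)
    also have "(\<Sum>k\<le>2. ?w j ^ k / fact k) = 1 + ?w j + (?w j)\<^sup>2 / 2" by (simp add: numeral_2_eq_2)
    also have "exp \<bar>Re (?w j)\<bar> * norm (?w j) ^ Suc 2 / fact 2 = exp \<bar>Re z\<bar> / 2 * norm (?w j) ^ 3"
      by (simp add: eval_nat_numeral)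
    also have "\<dots> \<le> exp \<bar>Re z\<bar> / 2 * (4 * (norm z ^ 3 + (real j * \<bar>th\<bar>) ^ 3))"
    proof (intro mult_left_mono)
      have "norm (?w j) \<le> norm z + norm (\<i> * of_real (real j * th))" by (rule norm_triangle_ineq)
      also have "norm (\<i> * of_real (real j * th) :: complex) = real j * \<bar>th\<bar>"
        by (simp add: norm_mult abs_mult)
      finally have "norm (?w j) ^ 3 \<le> (norm z + real j * \<bar>th\<bar>) ^ 3" by (intro power_mono) auto
      also have "\<dots> \<le> 4 * (norm z ^ 3 + (real j * \<bar>th\<bar>) ^ 3)" by (rule cube_add_le) auto
      finally show "norm (?w j) ^ 3 \<le> 4 * (norm z ^ 3 + (real j * \<bar>th\<bar>) ^ 3)" .
    qed auto
    finally have "norm (exp (?w j) - (1 + ?w j + (?w j)\<^sup>2 / 2)) \<le> 2 * exp \<bar>Re z\<bar> * (norm z ^ 3 + (real j * \<bar>th\<bar>) ^ 3)"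
      by (simp add: algebra_simps)
    then have "wt t j * norm (exp (?w j) - (1 + ?w j + (?w j)\<^sup>2 / 2)) \<le> wt t j * (2 * exp \<bar>Re z\<bar> * (norm z ^ 3 + (real j * \<bar>th\<bar>) ^ 3))"
      by (intro mult_left_mono wt_nonneg)
    also have "\<dots> = e j" by (simp add: e_def power_mult_distrib algebra_simps)
    also have "d j = of_real (wt t j) * (exp (?w j) - (1 + ?w j + (?w j)\<^sup>2 / 2))"
      unfolding d_def by algebra
    then have "wt t j * norm (exp (?w j) - (1 + ?w j + (?w j)\<^sup>2 / 2)) = norm (d j)"
      using wt_nonneg[of t j] by (simp add: norm_mult)
    finally show ?thesis .
  qed
  have "norm (\<Sum>j. d j) \<le> (\<Sum>j. e j)"
    using summable_norm_comparison_test[of d e] de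
    by (intro order_trans[OF summable_norm suminf_le] sums_summable[OF E] summable_comparison_test[of "\<lambda>j. norm (d j)" e]) auto
  then show ?thesis using D E by (simp add: sums_iff)
qed

section \<open>Bounds for the real part of the exponent\<close>

lemma decay_sums:
  assumes "0 < t"
  shows "(\<lambda>j. wt t j * (1 - cos (real j * th))) sums decay t th"
  unfolding decay_def
proof (rule summable_sums, rule summable_comparison_test')
  show "summable (\<lambda>j. wt t j * 2)"
    by (rule summable_mult2[OF sums_summable[OF wt_sums_0[OF assms]]])
  show "norm (wt t j * (1 - cos (real j * th))) \<le> wt t j * 2" for j
    using wt_nonneg[of t j] cos_ge_minus_one[of "real j * th"] cos_le_one[of "real j * th"]
    by (auto simp: abs_mult intro!: mult_left_mono)
qed

text \<open>For |z| <= 1, exp (Re z) lies between 1/3 and 3. The angle gains at least (1/3)(1/2)(1 -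
  cos), whence 1/6, while the tilt costs at most 3 |z|^2 per unit of weight. With z of order 1/sd
  and \<open>G 0\<close> of order sd^2 the tilt term stays bounded.\<close>

lemma Re_Psi_le:
  assumes t: "0 < t" and z: "norm z \<le> 1"
  shows "Re (Psi t z th) \<le> 3 * (norm z)\<^sup>2 * G 0 t - decay t th / 6"
proof (rule sums_le)
  show "(\<lambda>j. Re (summand t z th j)) sums Re (Psi t z th)"
    by (rule sums_Re[OF Psi_sums[OF t]])
  show "(\<lambda>j. 3 * (norm z)\<^sup>2 * wt t j - wt t j * (1 - cos (real j * th)) / 6) sums (3 * (norm z)\<^sup>2 * G 0 t - decay t th / 6)"
    by (intro sums_diff sums_mult sums_divide decay_sums wt_sums_0 t)
  fix j
  let ?u = "Re z" and ?w = "Im z" and ?v = "real j * th"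
  have u: "\<bar>?u\<bar> \<le> 1" using abs_Re_le_cmod[of z] z by simp
  have e3: "exp ?u \<le> 3" using exp_le u by (meson abs_le_D1 exp_le_cancel_iff order_trans)
  have e13: "1 / 3 \<le> exp ?u"
  proof (rule order_trans)
    show "1 / 3 \<le> exp (- 1 :: real)" using exp_le by (simp add: exp_minus field_simps)
    show "exp (- 1) \<le> exp ?u" using u by simp
  qed
  have quad: "exp ?u - 1 - ?u \<le> 3 * ?u\<^sup>2"
  proof -
    have "norm (exp (of_real ?u :: complex) - (\<Sum>k\<le>1. of_real ?u ^ k / fact k)) \<le> exp \<bar>Re (of_real ?u)\<bar> * norm (of_real ?u :: complex) ^ Suc 1 / fact 1"
      by (rule Taylor_exp)
    also have "exp (of_real ?u :: complex) - (\<Sum>k\<le>1. of_real ?u ^ k / fact k) = of_real (exp ?u - 1 - ?u)"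
      by (simp add: exp_of_real)
    also have "exp \<bar>Re (of_real ?u)\<bar> * norm (of_real ?u :: complex) ^ Suc 1 / fact 1 = exp \<bar>?u\<bar> * ?u\<^sup>2"
      by (simp add: power2_eq_square)
    also have "\<dots> \<le> 3 * ?u\<^sup>2" using exp_le u by (intro mult_right_mono) (meson exp_le_cancel_iff order_trans, simp)
    finally show ?thesis unfolding norm_of_real by linarith
  qed
  have A: "exp ?u * ((1 - cos ?v) / 2) - exp ?u * (1 - cos ?w) \<le> exp ?u * (1 - cos (?w + ?v))"
    by (subst right_diff_distrib[symmetric]) (intro mult_left_mono one_minus_cos_add_ge, simp)
  have B: "exp ?u * ((1 - cos ?v) / 2) \<ge> 1 / 3 * ((1 - cos ?v) / 2)"
    using e13 by (intro mult_right_mono) auto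
  have C: "exp ?u * (1 - cos ?w) \<le> 3 * ?w\<^sup>2"
    using e3 one_minus_cos_le[of ?w] by (intro mult_mono) auto
  have "exp ?u - 1 - ?u - exp ?u * (1 - cos (?w + ?v)) \<le> 3 * (?u\<^sup>2 + ?w\<^sup>2) - (1 - cos ?v) / 6"
    using quad
  proof -
    \<comment> \<open>Naming the products turns the claim into linear arithmetic.\<close>
    have "q - E3 \<le> 3 * (a + b) - c / 6"
      if "E1 - E2 \<le> E3" "1 / 3 * (c / 2) \<le> E1" "E2 \<le> 3 * b" "q \<le> 3 * a" for E1 E2 E3 q a b c :: real
    proof -
      have "c / 6 \<le> E1" using that(2) by simp
      with that(1,3,4) show ?thesis by argo
    qed
    then show "exp ?u - 1 - ?u - exp ?u * (1 - cos (?w + ?v)) \<le> 3 * (?u\<^sup>2 + ?w\<^sup>2) - (1 - cos ?v) / 6"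
      using A B C quad by blast
  qed
  then have "wt t j * (exp ?u - 1 - ?u - exp ?u * (1 - cos (?w + ?v))) \<le> wt t j * (3 * (?u\<^sup>2 + ?w\<^sup>2) - (1 - cos ?v) / 6)"
    by (intro mult_left_mono wt_nonneg)
  then have le: "wt t j * (exp ?u - 1 - ?u - exp ?u * (1 - cos (?w + ?v))) \<le> 3 * (norm z)\<^sup>2 * wt t j - wt t j * (1 - cos ?v) / 6"
    by (simp add: cmod_power2 algebra_simps)
  have "Re (summand t z th j) =
    wt t j * (exp ?u - 1 - ?u - exp ?u * (1 - cos (?w + ?v)))"
    by (simp add: Re_exp algebra_simps)
  with le show "Re (summand t z th j) \<le>
    3 * (norm z)\<^sup>2 * wt t j - wt t j * (1 - cos ?v) / 6"
    by (simp only:)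
qed

lemma decay_ge_cubic:
  assumes "0 < t"
  shows "th\<^sup>2 * G 2 t / 2 - \<bar>th\<bar> ^ 3 * G 3 t / 2 \<le> decay t th"
proof (rule sums_le[OF _ _ decay_sums[OF assms]])
  show "(\<lambda>j. th\<^sup>2 * (wt t j * real j ^ 2) / 2 - \<bar>th\<bar> ^ 3 * (wt t j * real j ^ 3) / 2) sums (th\<^sup>2 * G 2 t / 2 - \<bar>th\<bar> ^ 3 * G 3 t / 2)"
    by (intro sums_diff sums_mult sums_divide wt_sums assms)
  show "th\<^sup>2 * (wt t j * real j ^ 2) / 2 - \<bar>th\<bar> ^ 3 * (wt t j * real j ^ 3) / 2 \<le> wt t j * (1 - cos (real j * th))" for j
    using mult_left_mono[OF one_minus_cos_ge_cubic[of "real j * th"] wt_nonneg[of t j]]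
    by (simp add: power_mult_distrib abs_mult algebra_simps)
qed

text \<open>Since l >= 2, the weights for j > 0 are at least x q^j with q = e^(-t), so
  \<open>decay\<close> is at least x (1/(1-q) - Re 1/(1 - q e^(i th))). For |th| >= \<epsilon> t the
  second denominator is larger in modulus by at least the factor sqrt (1 + \<epsilon>^2/256), which
  leaves a positive multiple of 1/t.\<close>

lemma decay_ge_minor:
  assumes t: "0 < t" "t \<le> 1 / 2" and e: "0 < \<epsilon>" and th: "\<epsilon> * t \<le> \<bar>th\<bar>" "\<bar>th\<bar> \<le> pi"
  shows "x * (1 - 1 / sqrt (1 + \<epsilon>\<^sup>2 / 256)) / t \<le> decay t th"
proof -
  define q where "q = exp (- t)"
  have q: "0 < q" "q < 1" using t by (auto simp: q_def)
  have qt: "1 - q \<le> t" using exp_ge_add_one_self[of "- t"] by (simp add: q_def)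
  have q2: "1 / 2 \<le> q" using qt t by simp
  let ?w = "of_real q * cis th"
  have S1: "(\<lambda>j. q ^ j) sums (1 / (1 - q))" using q by (intro geometric_sums) auto
  have "(\<lambda>j. ?w ^ j) sums (1 / (1 - ?w))" using q by (intro geometric_sums) (auto simp: norm_mult)
  from sums_diff[OF S1 sums_Re[OF this]]
  have S: "(\<lambda>j. q ^ j - Re (?w ^ j)) sums (1 / (1 - q) - Re (1 / (1 - ?w)))" .
  have eq: "q ^ j - Re (?w ^ j) = q ^ j * (1 - cos (real j * th))" for j
    unfolding power_mult_distrib Complex.DeMoivre by (simp add: algebra_simps flip: of_real_power)
  have decay: "x * (1 / (1 - q) - Re (1 / (1 - ?w))) \<le> decay t th"
  proof (rule sums_le[OF _ sums_mult[OF S, of x] decay_sums[OF t(1)]])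
    fix j
    show "x * (q ^ j - Re (?w ^ j)) \<le> wt t j * (1 - cos (real j * th))"
    proof (cases "j = 0")
      case False
      obtain k where k: "l = Suc (Suc k)" using l_ge_2 by (metis add_2_eq_Suc le_Suc_ex)
      have "j \<le> j ^ Suc k" using False by (simp add: self_le_power)
      also have "\<dots> \<le> sublattices l j" unfolding k using sublattices_ge[of j "Suc k"] False by simp
      finally have "1 \<le> real (sublattices l j) / real j" using False by simp
      then have "x * q ^ j * 1 \<le> x * q ^ j * (real (sublattices l j) / real j)"
        using x_pos q by (intro mult_left_mono) auto
      also have "\<dots> = wt t j" by (simp add: wt_def q_def exp_of_nat_mult[symmetric])
      finally show ?thesis unfolding eq mult.assoc[symmetric] by (intro mult_right_mono) auto
    qed simp
  qed
  have le: "(1 - 1 / sqrt (1 + \<epsilon>\<^sup>2 / 256)) / t \<le> 1 / (1 - q) - Re (1 / (1 - ?w))"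
  proof -
    have "(norm (1 - ?w))\<^sup>2 = (1 - q)\<^sup>2 + 2 * q * (1 - cos th)"
    proof -
      have "(norm (1 - ?w))\<^sup>2 = (1 - q * cos th)\<^sup>2 + (q * sin th)\<^sup>2" by (simp add: cmod_power2)
      also have "\<dots> = 1 - 2 * q * cos th + q\<^sup>2 * ((sin th)\<^sup>2 + (cos th)\<^sup>2)"
        by algebra
      also have "(sin th)\<^sup>2 + (cos th)\<^sup>2 = 1" by simp
      finally show ?thesis by (simp add: power2_eq_square algebra_simps)
    qed
    \<comment> \<open>t <= 1/2 yields 2 q >= 1, and 1 - q <= t replaces \<epsilon> t by \<epsilon>
      (1 - q) in the condition on the angle.\<close>
    also have "\<dots> \<ge> (1 - q)\<^sup>2 + 1 * ((\<epsilon> * (1 - q))\<^sup>2 / 256)"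
    proof (intro add_left_mono mult_mono)
      have "\<epsilon> * (1 - q) \<le> \<bar>th\<bar>" using mult_left_mono[OF qt, of \<epsilon>] e th by linarith
      then have "(\<epsilon> * (1 - q))\<^sup>2 \<le> \<bar>th\<bar>\<^sup>2" using e q by (intro power_mono) auto
      then show "(\<epsilon> * (1 - q))\<^sup>2 / 256 \<le> 1 - cos th"
        using one_minus_cos_ge_square[OF th(2)] by simp
    qed (use q2 in auto)
    finally have "(1 - q)\<^sup>2 * (1 + \<epsilon>\<^sup>2 / 256) \<le> (norm (1 - ?w))\<^sup>2"
      by (simp add: power_mult_distrib distrib_left mult_ac)
    then have "sqrt ((1 - q)\<^sup>2 * (1 + \<epsilon>\<^sup>2 / 256)) \<le> norm (1 - ?w)"
      by (metis norm_ge_zero real_sqrt_le_iff real_sqrt_unique)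
    then have n: "(1 - q) * sqrt (1 + \<epsilon>\<^sup>2 / 256) \<le> norm (1 - ?w)"
      using q by (simp add: real_sqrt_mult)
    have s1: "1 \<le> sqrt (1 + \<epsilon>\<^sup>2 / 256)" by simp
    have "Re (1 / (1 - ?w)) \<le> norm (1 / (1 - ?w))" by (rule complex_Re_le_cmod)
    also have "\<dots> = 1 / norm (1 - ?w)" by (simp add: norm_divide)
    also have "\<dots> \<le> 1 / ((1 - q) * sqrt (1 + \<epsilon>\<^sup>2 / 256))"
      using n q s1 by (intro divide_left_mono) (auto intro!: mult_pos_pos add_pos_nonneg less_le_trans[OF _ n])
    finally have "1 / (1 - q) - Re (1 / (1 - ?w)) \<ge> (1 - 1 / sqrt (1 + \<epsilon>\<^sup>2 / 256)) / (1 - q)"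
      by (simp add: diff_divide_distrib mult.commute)
    moreover have "(1 - 1 / sqrt (1 + \<epsilon>\<^sup>2 / 256)) / t \<le> (1 - 1 / sqrt (1 + \<epsilon>\<^sup>2 / 256)) / (1 - q)"
    proof (rule divide_left_mono)
      show "0 \<le> 1 - 1 / sqrt (1 + \<epsilon>\<^sup>2 / 256)" using s1 by (simp add: divide_le_eq_1_pos add_pos_nonneg)
    qed (use q qt t in auto)
    ultimately show ?thesis by linarith
  qed
  have "x * ((1 - 1 / sqrt (1 + \<epsilon>\<^sup>2 / 256)) / t) \<le> x * (1 / (1 - q) - Re (1 / (1 - ?w)))"
    by (rule mult_left_mono[OF le]) (use x_pos in simp)
  from order_trans[OF this decay] show ?thesis by (simp only: times_divide_eq_right)
qed

end

section \<open>Scaling at the saddle point\<close>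

lemma integrable_inverse_1_plus_square_lborel:
  "integrable lborel (\<lambda>x :: real. inverse (1 + x\<^sup>2))"
  using integrable_inverse_1_plus_square by (simp add: set_integrable_def)

text \<open>Brings the Gaussian bound to the same majorant 1/(1 + s^2) as the bound away from angle
  0.\<close>

lemma exp_neg_le_inverse:
  assumes "0 < c"
  shows "exp (- (c * s\<^sup>2)) \<le> max 1 (1 / c) * inverse (1 + (s::real)\<^sup>2)"
proof -
  have p: "0 < 1 + s\<^sup>2" by (rule add_pos_nonneg) auto
  have "1 + s\<^sup>2 \<le> max 1 (1 / c) * (1 + c * s\<^sup>2)"
  proof -
    have "1 * 1 \<le> max 1 (1 / c) * 1" by (intro mult_right_mono) auto
    moreover have "1 / c * (c * s\<^sup>2) \<le> max 1 (1 / c) * (c * s\<^sup>2)" using assms by (intro mult_right_mono) auto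
    ultimately show ?thesis using assms by (simp add: distrib_left)
  qed
  also have "\<dots> \<le> max 1 (1 / c) * exp (c * s\<^sup>2)"
    using exp_ge_add_one_self[of "c * s\<^sup>2"] by (intro mult_left_mono) (auto simp: le_max_iff_disj)
  finally have "(1 + s\<^sup>2) * exp (- (c * s\<^sup>2)) \<le> max 1 (1 / c)"
    by (simp add: exp_minus field_simps)
  then show ?thesis using p by (simp add: field_simps)
qed

context orbit_saddle begin

text \<open>The residue at s = l of x times the Dirichlet series sum_n a_l(n) n^(-s) = zeta(s)
  zeta(s-1) ... zeta(s-l+1).\<close>

definition resid :: real where "resid = x * zeta_prod l"

lemma resid_pos: "0 < resid"
  using x_pos zeta_prod_pos by (simp add: resid_def)

lemma G_asymp: "((\<lambda>t. t ^ (l + k - 1) * G k t) \<longlongrightarrow> resid * fact (l + k - 2)) (at_right 0)"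
proof -
  have "((\<lambda>t. x * (t ^ (l + k - 1) * orbit_series l k t)) \<longlongrightarrow> x * (fact (l + k - 2) * zeta_prod l)) (at_right 0)"
    using l_ge_2 by (intro tendsto_mult tendsto_const orbit_series_asymp) auto
  then show ?thesis by (simp add: G_def resid_def mult_ac)
qed

lemma G1_asymp: "((\<lambda>t. t ^ l * G 1 t) \<longlongrightarrow> resid * fact (l - 1)) (at_right 0)"
  using G_asymp[of 1] by simp

lemma G2_asymp: "((\<lambda>t. t ^ (l + 1) * G 2 t) \<longlongrightarrow> resid * fact l) (at_right 0)"
  using G_asymp[of 2] by simp

lemma G3_asymp: "((\<lambda>t. t ^ (l + 2) * G 3 t) \<longlongrightarrow> resid * fact (l + 1)) (at_right 0)"
proof -
  have "l + 3 - 1 = l + 2" "l + 3 - 2 = l + 1" by auto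
  then show ?thesis using G_asymp[of 3] by (simp only:)
qed

lemma G_bound: obtains C where "\<And>t. 0 < t \<Longrightarrow> t ^ (l + k - 1) * G k t \<le> C"
proof -
  obtain C where C: "\<And>t. 0 < t \<Longrightarrow> t ^ (l + k - 1) * orbit_series l k t \<le> C"
    using orbit_series_asymp(2)[of l k] l_ge_2 by auto
  have "t ^ (l + k - 1) * G k t \<le> x * C" if "0 < t" for t
    using mult_left_mono[OF C[OF that], of x] x_pos by (simp add: G_def mult_ac)
  then show ?thesis using that by blast
qed

section \<open>The saddle point\<close>

lemma isCont_G:
  assumes t: "0 < t"
  shows "isCont (G k) t"
proof -
  let ?a = "\<lambda>n. real (sublattices l n) * real n ^ k / real n"
  have "summable (\<lambda>n. ?a n * exp (- (t / 2)) ^ n)"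
    using summable_orbit_series[of "t / 2" l k] t by (simp add: exp_of_nat_mult[symmetric] mult_ac)
  then have "isCont (\<lambda>t. \<Sum>n. ?a n * exp (- t) ^ n) t"
    by (rule isCont_powser'[rotated]) (use t in auto)
  then have "isCont (\<lambda>t. x * (\<Sum>n. ?a n * exp (- t) ^ n)) t" by (intro continuous_intros)
  also have "(\<lambda>t. x * (\<Sum>n. ?a n * exp (- t) ^ n)) = G k"
    unfolding G_def orbit_series_def by (simp add: exp_of_nat_mult[symmetric] fun_eq_iff mult_ac)
  finally show ?thesis .
qed

text \<open>\<open>G 1\<close> exceeds n near 0 by its asymptotics and is at most n far out by the
  global bound; the intermediate value theorem does the rest.\<close>

lemma saddle_exists:
  assumes n: "0 < n"
  shows "\<exists>t>0. G 1 t = real n"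
proof -
  let ?A = "resid * fact (l - 1)"
  have A: "0 < ?A" using resid_pos by simp
  from G1_asymp have "\<forall>\<^sub>F t in at_right 0. ?A / 2 < t ^ l * G 1 t" by (rule order_tendstoD) (use A in simp)
  moreover have "((\<lambda>t. real n * t ^ l) \<longlongrightarrow> 0) (at_right 0)"
    using l_ge_2 by (auto intro!: tendsto_eq_intros)
  then have "\<forall>\<^sub>F t in at_right 0. real n * t ^ l < ?A / 2" by (rule order_tendstoD) (use A in simp)
  moreover have "\<forall>\<^sub>F t::real in at_right 0. 0 < t" by (simp add: eventually_at_right_less)
  ultimately have ev: "\<forall>\<^sub>F t in at_right 0. 0 < t \<and> real n \<le> G 1 t"
  proof eventually_elim
    case (elim t)
    then have "t ^ l * real n < t ^ l * G 1 t" by (simp only: mult.commute[of "t ^ l" "real n"])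
    then show ?case using elim by (simp add: mult_less_cancel_left)
  qed
  then obtain t1 where t1: "0 < t1" "real n \<le> G 1 t1"
    using eventually_happens'[OF trivial_limit_at_right_real ev] by auto
  obtain C where C: "\<And>t. 0 < t \<Longrightarrow> t ^ l * G 1 t \<le> C" using G_bound[of 1] by auto
  \<comment> \<open>For t2 >= 1 and t2 >= C/n one has t2^l n >= t2 n >= C, which turns the bound on
    t^l \<open>G 1 t\<close> into \<open>G 1 t2\<close> <= n.\<close>
  define t2 where "t2 = max t1 (max 1 (C / real n))"
  have "C / real n \<le> t2" by (simp add: t2_def)
  then have t2: "1 \<le> t2" "t1 \<le> t2" "C \<le> t2 * real n" using n by (auto simp: t2_def field_simps)
  have "t2 ^ l * G 1 t2 \<le> t2 * real n" using C[of t2] t2 by linarith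
  also have "\<dots> \<le> t2 ^ l * real n" using t2 l_ge_2 by (intro mult_right_mono self_le_power) auto
  finally have "G 1 t2 \<le> real n" using t2 by (simp add: mult_le_cancel_left)
  moreover have "\<forall>t. t1 \<le> t \<and> t \<le> t2 \<longrightarrow> isCont (G 1) t" using t1(1) by (auto intro!: isCont_G)
  ultimately obtain t where "t1 \<le> t" "G 1 t = real n"
    using IVT2[of "G 1" t2 "real n" t1] t1(2) t2(2) by blast
  then show ?thesis using t1(1) by (intro exI[of _ t]) auto
qed

definition saddle :: "nat \<Rightarrow> real" where
  "saddle n = (SOME t. 0 < t \<and> G 1 t = real n)"

lemma saddle: "0 < n \<Longrightarrow> 0 < saddle n \<and> G 1 (saddle n) = real n"
  unfolding saddle_def by (rule someI_ex) (rule saddle_exists)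

lemma saddle_tendsto: "filterlim saddle (at_right 0) sequentially"
proof -
  obtain C where C: "\<And>t. 0 < t \<Longrightarrow> t ^ l * G 1 t \<le> C" using G_bound[of 1] by auto
  have ev: "\<forall>\<^sub>F n in sequentially. 0 < n" by (rule eventually_gt_at_top)
  have "(\<lambda>n. saddle n ^ l) \<longlonglongrightarrow> 0"
  proof (rule tendsto_sandwich[OF _ _ tendsto_const])
    show "\<forall>\<^sub>F n in sequentially. 0 \<le> saddle n ^ l"
      using ev
    proof eventually_elim
      case (elim n)
      then show ?case using saddle[OF elim] by simp
    qed
    show "\<forall>\<^sub>F n in sequentially. saddle n ^ l \<le> C / real n"
      using ev
    proof eventually_elim
      case (elim n)
      have "saddle n ^ l * real n \<le> C" using C[of "saddle n"] saddle[OF elim] by simp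
      then show ?case using elim by (simp add: pos_le_divide_eq)
    qed
    show "(\<lambda>n. C / real n) \<longlonglongrightarrow> 0" by real_asymp
  qed
  then have "(\<lambda>n. root l (saddle n ^ l)) \<longlonglongrightarrow> root l 0" by (rule tendsto_real_root)
  moreover have "\<forall>\<^sub>F n in sequentially. root l (saddle n ^ l) = saddle n"
    using ev
  proof eventually_elim
    case (elim n)
    then show ?case using saddle[OF elim] l_ge_2 by (intro real_root_power_cancel) auto
  qed
  ultimately have "saddle \<longlonglongrightarrow> root l 0" by (rule Lim_transform_eventually)
  then have "saddle \<longlonglongrightarrow> 0" by simp
  moreover have "\<forall>\<^sub>F n in sequentially. saddle n \<in> {0<..} \<and> saddle n \<noteq> 0"
    using ev
  proof eventually_elim
    case (elim n)
    then show ?case using saddle[OF elim] by simp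
  qed
  ultimately show ?thesis unfolding filterlim_at by blast
qed

lemma saddle_asymp: "(\<lambda>n. saddle n ^ l * real n) \<longlonglongrightarrow> resid * fact (l - 1)"
proof -
  have "(\<lambda>n. saddle n ^ l * G 1 (saddle n)) \<longlonglongrightarrow> resid * fact (l - 1)"
    by (rule filterlim_compose[OF G1_asymp saddle_tendsto])
  then show ?thesis
  proof (rule Lim_transform_eventually)
    show "\<forall>\<^sub>F n in sequentially. saddle n ^ l * G 1 (saddle n) = saddle n ^ l * real n"
      using eventually_gt_at_top[of 0]
    proof eventually_elim
      case (elim n)
      show ?case unfolding saddle[OF elim, THEN conjunct2] ..
    qed
  qed
qed

text \<open>Leading coefficient of the conditional variance \<open>G 0 - (G 1)^2 / G 2\<close>:
  \<open>resid\<close> times (l-2)! - ((l-1)!)^2 / l! = (l-2)!/l.\<close>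

definition var0 :: real where
  "var0 = resid * fact (l - 2) / real l"

lemma var0_pos: "0 < var0"
  unfolding var0_def using resid_pos l_ge_2 by simp

text \<open>At the saddle point \<open>t\<close>, \<open>sd t\<close> is the order of the standard deviation of the orbit count
  and \<open>sc t\<close> the width of the peak of the integrand in the angle.\<close>

definition sd :: "real \<Rightarrow> real" where
  "sd t = sqrt (var0 / t ^ (l - 1))"

definition sc :: "real \<Rightarrow> real" where
  "sc t = sqrt (t ^ (l + 1))"

text \<open>Limit of the covariance of N/sd and sc T in the Poisson model.\<close>

definition cov :: real where
  "cov = resid * fact (l - 1) / sqrt var0"

lemma sd_pos: "0 < t \<Longrightarrow> 0 < sd t"
  unfolding sd_def using var0_pos by simp

lemma sc_pos: "0 < t \<Longrightarrow> 0 < sc t"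
  unfolding sc_def by simp

text \<open>This identity makes the limit variance 1: the unconditioned variance of N/sd tends to l,
  and conditioning on the total size removes \<open>cov\<close>^2 / (\<open>resid\<close> l!) = l -
  1.\<close>

lemma cov_sq: "cov\<^sup>2 = (real l - 1) * (resid * fact l)"
proof -
  obtain k where k: "l = Suc (Suc k)" using l_ge_2 by (metis add_2_eq_Suc le_Suc_ex)
  have "cov\<^sup>2 = (resid * fact (l - 1))\<^sup>2 / (resid * fact (l - 2) / real l)"
    unfolding cov_def power_divide var0_def[symmetric] using var0_pos by simp
  also have "\<dots> = (real l - 1) * (resid * fact l)"
    using resid_pos unfolding k by (simp add: power2_eq_square field_simps)
  finally show ?thesis .
qed

lemma ev_pos: "\<forall>\<^sub>F t::real in at_right 0. 0 < t"
  by (simp add: eventually_at_right_less)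

lemma G0_sd: "((\<lambda>t. G 0 t / (sd t)\<^sup>2) \<longlongrightarrow> real l) (at_right 0)"
proof -
  let ?c = var0
  have c: "0 < ?c" by (rule var0_pos)
  have "((\<lambda>t. t ^ (l - 1) * G 0 t / ?c) \<longlongrightarrow> resid * fact (l - 2) / ?c) (at_right 0)"
    using G_asymp[of 0] by (intro tendsto_divide tendsto_const) (use c in auto)
  also have "resid * fact (l - 2) / ?c = real l" using resid_pos l_ge_2 by (simp add: var0_def)
  finally have "((\<lambda>t. t ^ (l - 1) * G 0 t / ?c) \<longlongrightarrow> real l) (at_right 0)" .
  then show ?thesis
  proof (rule Lim_transform_eventually)
    show "\<forall>\<^sub>F t in at_right 0. t ^ (l - 1) * G 0 t / ?c = G 0 t / (sd t)\<^sup>2"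
      using ev_pos
    proof eventually_elim
      case (elim t)
      have "(sd t)\<^sup>2 = ?c / t ^ (l - 1)" unfolding sd_def using c elim by (intro real_sqrt_pow2) auto
      then show ?case by (simp only:) (simp add: mult.commute)
    qed
  qed
qed

lemma sd_inverse: "((\<lambda>t. 1 / sd t) \<longlongrightarrow> 0) (at_right 0)"
proof -
  let ?c = var0
  have c: "0 < ?c" by (rule var0_pos)
  have "((\<lambda>t. sqrt (t ^ (l - 1) / ?c)) \<longlongrightarrow> sqrt (0 / ?c)) (at_right 0)"
    using l_ge_2 c by (intro tendsto_real_sqrt tendsto_divide tendsto_const) (auto intro!: tendsto_eq_intros)
  then show ?thesis
    unfolding sd_def by (simp add: real_sqrt_divide)
qed

lemma G1_sc_sd: "((\<lambda>t. G 1 t * sc t / sd t) \<longlongrightarrow> cov) (at_right 0)"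
proof -
  let ?c = var0
  have c: "0 < ?c" by (rule var0_pos)
  have "((\<lambda>t. t ^ l * G 1 t / sqrt ?c) \<longlongrightarrow> cov) (at_right 0)"
    unfolding cov_def by (rule tendsto_divide[OF G1_asymp tendsto_const]) (use c in simp)
  then show ?thesis
  proof (rule Lim_transform_eventually)
    show "\<forall>\<^sub>F t in at_right 0. t ^ l * G 1 t / sqrt ?c = G 1 t * sc t / sd t"
      using ev_pos
    proof eventually_elim
      case (elim t)
      have "sc t / sd t = sqrt (t ^ (l + 1)) * sqrt (t ^ (l - 1)) / sqrt ?c"
        unfolding sc_def sd_def by (simp add: real_sqrt_divide)
      also have "sqrt (t ^ (l + 1)) * sqrt (t ^ (l - 1)) = sqrt ((t ^ l)\<^sup>2)"
        unfolding real_sqrt_mult[symmetric] power_add[symmetric] power_mult[symmetric]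
        using l_ge_2 by (intro arg_cong[of _ _ "\<lambda>k. sqrt (t ^ k)"]) auto
      also have "\<dots> = t ^ l" using elim by simp
      finally have q: "sc t / sd t = t ^ l / sqrt ?c" .
      have "G 1 t * sc t / sd t = G 1 t * (sc t / sd t)" by (rule times_divide_eq_right[symmetric])
      also have "\<dots> = t ^ l * G 1 t / sqrt ?c" unfolding q by (simp add: mult.commute)
      finally show ?case ..
    qed
  qed
qed

lemma G2_sc: "((\<lambda>t. G 2 t * (sc t)\<^sup>2) \<longlongrightarrow> resid * fact l) (at_right 0)"
proof -
  from G2_asymp show ?thesis
    by (rule Lim_transform_eventually)
       (use ev_pos in \<open>eventually_elim, simp add: sc_def mult.commute\<close>)
qed

text \<open>The peak is narrower than t by the factor t^((l-1)/2); this ratio makes the cubic term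
  vanish in \<open>G3_sc\<close>.\<close>

lemma sc_over_id: "((\<lambda>t. sc t / t) \<longlongrightarrow> 0) (at_right 0)"
proof -
  have "((\<lambda>t. sqrt (t ^ (l - 1))) \<longlongrightarrow> sqrt 0) (at_right 0)"
    using l_ge_2 by (intro tendsto_real_sqrt) (auto intro!: tendsto_eq_intros)
  then have "((\<lambda>t. sqrt (t ^ (l - 1))) \<longlongrightarrow> 0) (at_right 0)" by simp
  then show ?thesis
  proof (rule Lim_transform_eventually)
    show "\<forall>\<^sub>F t in at_right 0. sqrt (t ^ (l - 1)) = sc t / t"
      using ev_pos
    proof eventually_elim
      case (elim t)
      have "t ^ (l + 1) = t ^ (l - 1) * t\<^sup>2"
        unfolding power_add[symmetric] using l_ge_2 by (intro arg_cong[of _ _ "\<lambda>k. t ^ k"]) auto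
      then show ?case using elim by (simp add: sc_def real_sqrt_mult)
    qed
  qed
qed

lemma G3_sc: "((\<lambda>t. G 3 t * (sc t) ^ 3) \<longlongrightarrow> 0) (at_right 0)"
proof -
  have "((\<lambda>t. sc t / t * (t ^ (l + 2) * G 3 t)) \<longlongrightarrow> 0 * (resid * fact (l + 1))) (at_right 0)"
    by (rule tendsto_mult[OF sc_over_id G3_asymp])
  then have "((\<lambda>t. sc t / t * (t ^ (l + 2) * G 3 t)) \<longlongrightarrow> 0) (at_right 0)" by simp
  then show ?thesis
  proof (rule Lim_transform_eventually)
    show "\<forall>\<^sub>F t in at_right 0. sc t / t * (t ^ (l + 2) * G 3 t) = G 3 t * (sc t) ^ 3"
      using ev_pos
    proof eventually_elim
      case (elim t)
      have "(sc t) ^ 3 = sc t * (sc t)\<^sup>2" by (simp add: power3_eq_cube power2_eq_square)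
      also have "(sc t)\<^sup>2 = t ^ (l + 1)" using elim by (simp add: sc_def)
      finally show ?case using elim by simp
    qed
  qed
qed

text \<open>After scaling, the quadratic form converges and the cubic remainder vanishes with 1/sd
  and sc/t. The argument z varies with n because the final normalization uses the true mean and
  variance.\<close>

lemma Psi_tendsto:
  assumes t: "filterlim t (at_right 0) sequentially" and z: "z \<longlonglongrightarrow> z0"
  shows "(\<lambda>n. Psi (t n) (z n / of_real (sd (t n))) (s * sc (t n))) \<longlonglongrightarrow>
    (z0\<^sup>2 * of_real (real l) + 2 * \<i> * z0 * of_real (s * cov) - of_real (s\<^sup>2 * (resid * fact l))) / 2"
proof -
  let ?z = "\<lambda>n. z n / of_real (sd (t n))" and ?th = "\<lambda>n. s * sc (t n)"
  let ?Q = "\<lambda>n. ((?z n)\<^sup>2 * of_real (G 0 (t n)) + 2 * \<i> * ?z n * of_real (?th n * G 1 (t n)) - of_real ((?th n)\<^sup>2 * G 2 (t n))) / 2"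
  note lim = filterlim_compose[OF _ t]
  have Q: "?Q \<longlonglongrightarrow> (z0\<^sup>2 * of_real (real l) + 2 * \<i> * z0 * of_real (s * cov) - of_real (s\<^sup>2 * (resid * fact l))) / 2"
  proof -
    have "?Q n = ((z n)\<^sup>2 * of_real (G 0 (t n) / (sd (t n))\<^sup>2) + 2 * \<i> * z n * of_real (s * (G 1 (t n) * sc (t n) / sd (t n)))
        - of_real (s\<^sup>2 * (G 2 (t n) * (sc (t n))\<^sup>2))) / 2" for n
      by (simp add: power_divide power_mult_distrib mult_ac)
    then show ?thesis
      by (simp only:) (intro tendsto_intros z lim[OF G0_sd] lim[OF G1_sc_sd] lim[OF G2_sc], simp)
  qed
  let ?e = "\<lambda>n. 2 * exp \<bar>Re (?z n)\<bar> * (norm (?z n) ^ 3 * G 0 (t n) + \<bar>?th n\<bar> ^ 3 * G 3 (t n))"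
  have zlim: "?z \<longlonglongrightarrow> 0"
  proof -
    have "(\<lambda>n. z n * of_real (1 / sd (t n))) \<longlonglongrightarrow> z0 * of_real 0"
      by (intro tendsto_intros z lim[OF sd_inverse])
    then show ?thesis by (simp add: divide_inverse)
  qed
  have pos: "\<forall>\<^sub>F n in sequentially. 0 < t n"
    using t by (auto simp: filterlim_at elim: eventually_mono)
  have "?e \<longlonglongrightarrow> 2 * exp \<bar>Re 0\<bar> * (norm z0 ^ 3 * (real l * 0) + \<bar>s\<bar> ^ 3 * 0)"
  proof -
    have "(\<lambda>n. 2 * exp \<bar>Re (?z n)\<bar> * (norm (z n) ^ 3 * (G 0 (t n) / (sd (t n))\<^sup>2 * (1 / sd (t n))) + \<bar>s\<bar> ^ 3 * (G 3 (t n) * sc (t n) ^ 3)))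
      \<longlonglongrightarrow> 2 * exp \<bar>Re 0\<bar> * (norm z0 ^ 3 * (real l * 0) + \<bar>s\<bar> ^ 3 * 0)"
      by (intro tendsto_intros z zlim lim[OF G0_sd] lim[OF sd_inverse] lim[OF G3_sc])
    then show ?thesis
    proof (rule Lim_transform_eventually)
      show "\<forall>\<^sub>F n in sequentially. 2 * exp \<bar>Re (?z n)\<bar> * (norm (z n) ^ 3 * (G 0 (t n) / (sd (t n))\<^sup>2 * (1 / sd (t n))) + \<bar>s\<bar> ^ 3 * (G 3 (t n) * sc (t n) ^ 3)) = ?e n"
        using pos
      proof eventually_elim
        case (elim n)
        then show ?case using sd_pos[OF elim] sc_pos[OF elim]
          by (simp add: norm_divide power_divide abs_mult power_mult_distrib power3_eq_cube power2_eq_square mult_ac)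
      qed
    qed
  qed
  then have e: "?e \<longlonglongrightarrow> 0" by simp
  have "(\<lambda>n. Psi (t n) (?z n) (?th n) - ?Q n) \<longlonglongrightarrow> 0"
  proof (rule Lim_null_comparison[OF _ e])
    show "\<forall>\<^sub>F n in sequentially. norm (Psi (t n) (?z n) (?th n) - ?Q n) \<le> ?e n"
      using pos by eventually_elim (rule Psi_quadratic)
  qed
  from tendsto_add[OF this Q] show ?thesis by simp
qed

text \<open>t \<open>G 3\<close> / \<open>G 2\<close> tends to l + 1, so \<epsilon> t
  \<open>G 3\<close> is asymptotically a quarter of \<open>G 2\<close>. The cubic correction then
  leaves 3/4 > 1/2 of the quadratic term throughout |th| <= \<epsilon> t.\<close>

lemma decay_ge_major:
  defines "\<epsilon> \<equiv> 1 / (4 * (real l + 1))"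
  shows "\<forall>\<^sub>F t in at_right 0. \<forall>th. \<bar>th\<bar> \<le> \<epsilon> * t \<longrightarrow> th\<^sup>2 * (resid * fact l / 4) / t ^ (l + 1) \<le> decay t th"
proof -
  let ?p = "resid * fact l"
  have p: "0 < ?p" using resid_pos by simp
  have "((\<lambda>t. t ^ (l + 1) * G 2 t - \<epsilon> * (t ^ (l + 2) * G 3 t)) \<longlongrightarrow> ?p - \<epsilon> * (resid * fact (l + 1))) (at_right 0)"
    by (rule tendsto_diff[OF G2_asymp tendsto_mult[OF tendsto_const G3_asymp]])
  moreover have "\<epsilon> * (resid * fact (l + 1)) = ?p / 4" by (simp add: \<epsilon>_def field_simps)
  ultimately have "((\<lambda>t. t ^ (l + 1) * G 2 t - \<epsilon> * (t ^ (l + 2) * G 3 t)) \<longlongrightarrow> ?p - ?p / 4) (at_right 0)"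
    by (simp only:)
  then have "\<forall>\<^sub>F t in at_right 0. ?p / 2 < t ^ (l + 1) * G 2 t - \<epsilon> * (t ^ (l + 2) * G 3 t)"
    by (rule order_tendstoD) (use p in linarith)
  then show ?thesis using ev_pos
  proof eventually_elim
    case (elim t)
    show ?case
    proof (intro allI impI)
      fix th assume th: "\<bar>th\<bar> \<le> \<epsilon> * t"
      have "th\<^sup>2 * (?p / 4) / t ^ (l + 1) = th\<^sup>2 / (2 * t ^ (l + 1)) * (?p / 2)" by simp
      also have "\<dots> \<le> th\<^sup>2 / (2 * t ^ (l + 1)) * (t ^ (l + 1) * G 2 t - \<epsilon> * (t ^ (l + 2) * G 3 t))"
        using elim by (intro mult_left_mono) auto
      also have "\<dots> = th\<^sup>2 * G 2 t / 2 - th\<^sup>2 * (\<epsilon> * t) * G 3 t / 2"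
        using elim by (simp add: field_simps)
      also have "th\<^sup>2 * \<bar>th\<bar> * G 3 t / 2 \<le> th\<^sup>2 * (\<epsilon> * t) * G 3 t / 2"
        using th G_nonneg elim by (intro divide_right_mono mult_right_mono mult_left_mono) auto
      then have "th\<^sup>2 * G 2 t / 2 - th\<^sup>2 * (\<epsilon> * t) * G 3 t / 2 \<le> th\<^sup>2 * G 2 t / 2 - \<bar>th\<bar> ^ 3 * G 3 t / 2"
        by (simp add: power3_eq_cube power2_eq_square)
      also have "\<dots> \<le> decay t th" by (rule decay_ge_cubic) (use elim in simp)
      finally show "th\<^sup>2 * (?p / 4) / t ^ (l + 1) \<le> decay t th" .
    qed
  qed
qed


section \<open>The rescaled integral and its limit\<close>

definition J_fun :: "real \<Rightarrow> complex \<Rightarrow> real \<Rightarrow> complex" where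
  "J_fun t z s = indicator {- pi / sc t..pi / sc t} s *\<^sub>R exp (Psi t (z / of_real (sd t)) (s * sc t))"

definition J :: "real \<Rightarrow> complex \<Rightarrow> complex" where
  "J t z = (LINT s|lborel. J_fun t z s)"

lemma borel_measurable_Psi [measurable]: "Psi t z \<in> borel_measurable borel"
  unfolding Psi_def by measurable

lemma borel_measurable_J_fun [measurable]: "J_fun t z \<in> borel_measurable borel"
  unfolding J_fun_def by measurable

text \<open>For |th| <= \<epsilon> t the decay is quadratic in s, which gives a Gaussian bound.
  Otherwise it is at least a multiple of 1/t, so the integrand is below any power of t; the power
  t^(l+1) = sc^2 is enough, because |s| sc <= pi converts it into a multiple of 1/(1 + s^2).\<close>

lemma J_fun_dominated:
  obtains K where "\<forall>\<^sub>F t in at_right 0. \<forall>z s. norm z \<le> R \<longrightarrow> norm (J_fun t z s) \<le> K * inverse (1 + s\<^sup>2)"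
proof -
  define \<epsilon> where "\<epsilon> = 1 / (4 * (real l + 1))"
  \<comment> \<open>The divisor 6 in c1 and c2 is the loss in \<open>Re_Psi_le\<close>; C0 bounds
    the contribution of the tilt.\<close>
  define c1 where "c1 = resid * fact l / 4 / 6"
  define c2 where "c2 = x * (1 - 1 / sqrt (1 + \<epsilon>\<^sup>2 / 256)) / 6"
  define K1 where "K1 = max 1 (1 / c1)"
  define K2 where "K2 = fact (l + 1) * (1 / c2) ^ (l + 1) * (1 + pi\<^sup>2)"
  define C0 where "C0 = exp (3 * (R\<^sup>2 * (real l + 1)))"
  have e: "0 < \<epsilon>" by (simp add: \<epsilon>_def)
  have c1: "0 < c1" using resid_pos by (simp add: c1_def)
  have "1 < sqrt (1 + \<epsilon>\<^sup>2 / 256)" using e by simp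
  then have "1 / sqrt (1 + \<epsilon>\<^sup>2 / 256) < 1" by (subst divide_less_eq_1_pos) (auto intro: add_pos_nonneg)
  then have c2: "0 < c2" unfolding c2_def using x_pos by (intro divide_pos_pos mult_pos_pos) auto
  have K1: "0 \<le> K1" by (simp add: K1_def le_max_iff_disj)
  have K2: "0 \<le> K2" using c2 by (simp add: K2_def)
  have "\<forall>\<^sub>F t in at_right 0. G 0 t / (sd t)\<^sup>2 < real l + 1"
    by (rule order_tendstoD(2)[OF G0_sd]) simp
  moreover have "\<forall>\<^sub>F t in at_right 0. R * (1 / sd t) < 1"
    using tendsto_mult[OF tendsto_const sd_inverse, of R] by (intro order_tendstoD(2)) auto
  moreover have "\<forall>\<^sub>F t :: real in at_right 0. t < 1 / 2"
    by (rule eventually_at_right_real[of 0 "1/2", THEN eventually_mono]) auto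
  ultimately have "\<forall>\<^sub>F t in at_right 0. \<forall>z s. norm z \<le> R \<longrightarrow> norm (J_fun t z s) \<le> C0 * (K1 + K2) * inverse (1 + s\<^sup>2)"
    using decay_ge_major[folded \<epsilon>_def] ev_pos
  proof eventually_elim
    case (elim t)
    note t = \<open>0 < t\<close>
    have sd: "0 < sd t" and sc: "0 < sc t" using t by (auto intro: sd_pos sc_pos)
    have sc2: "(sc t)\<^sup>2 = t ^ (l + 1)" using t by (simp add: sc_def)
    show ?case
    proof (intro allI impI)
      fix z :: complex and s :: real assume z: "norm z \<le> R"
      have p: "0 < 1 + s\<^sup>2" by (rule add_pos_nonneg) auto
      show "norm (J_fun t z s) \<le> C0 * (K1 + K2) * inverse (1 + s\<^sup>2)"
      proof (cases "s \<in> {- pi / sc t..pi / sc t}")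
        case False
        then show ?thesis using K1 K2 p by (simp add: J_fun_def C0_def)
      next
        case True
        define th where "th = s * sc t"
        have th: "\<bar>th\<bar> \<le> pi" using True sc by (auto simp: th_def abs_le_iff field_simps)
        have R0: "0 \<le> R" using z norm_ge_zero order_trans by blast
        let ?z = "z / of_real (sd t)"
        have nz: "norm ?z = norm z / sd t" using sd by (simp add: norm_divide)
        have "norm ?z \<le> R / sd t" unfolding nz using z sd by (simp add: divide_right_mono)
        also have "\<dots> \<le> 1" using elim(2) by simp
        finally have "Re (Psi t ?z th) \<le> 3 * (norm ?z)\<^sup>2 * G 0 t - decay t th / 6"
          by (rule Re_Psi_le[OF t])
        also have "(norm ?z)\<^sup>2 * G 0 t = (norm z)\<^sup>2 * (G 0 t / (sd t)\<^sup>2)"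
          unfolding nz by (simp add: power_divide)
        then have "3 * (norm ?z)\<^sup>2 * G 0 t = 3 * ((norm z)\<^sup>2 * (G 0 t / (sd t)\<^sup>2))" by (simp only: mult.assoc)
        also have "3 * ((norm z)\<^sup>2 * (G 0 t / (sd t)\<^sup>2)) \<le> 3 * (R\<^sup>2 * (real l + 1))"
          using z elim(1) G_nonneg[OF t, of 0] by (intro mult_left_mono mult_mono power_mono) auto
        finally have re: "Re (Psi t ?z th) \<le> 3 * (R\<^sup>2 * (real l + 1)) - decay t th / 6" by simp
        have "norm (J_fun t z s) = exp (Re (Psi t ?z th))"
          using True by (simp add: J_fun_def th_def)
        also have "\<dots> \<le> exp (3 * (R\<^sup>2 * (real l + 1)) - decay t th / 6)" using re by simp
        also have "\<dots> = C0 * exp (- (decay t th / 6))" by (simp add: C0_def mult_exp_exp)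
        also have "\<dots> \<le> C0 * ((K1 + K2) * inverse (1 + s\<^sup>2))"
        proof (rule mult_left_mono)
          show "exp (- (decay t th / 6)) \<le> (K1 + K2) * inverse (1 + s\<^sup>2)"
          proof (cases "\<bar>th\<bar> \<le> \<epsilon> * t")
            case True
            then have "th\<^sup>2 * (resid * fact l / 4) / t ^ (l + 1) \<le> decay t th" using elim by blast
            moreover have "th\<^sup>2 * (resid * fact l / 4) / t ^ (l + 1) = s\<^sup>2 * (resid * fact l / 4)"
              unfolding th_def power_mult_distrib sc2 using t by simp
            ultimately have "s\<^sup>2 * (resid * fact l / 4) \<le> decay t th" by (simp only:)
            then have "c1 * s\<^sup>2 \<le> decay t th / 6" by (simp add: c1_def mult_ac)
            then have "exp (- (decay t th / 6)) \<le> exp (- (c1 * s\<^sup>2))" by simp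
            also have "\<dots> \<le> K1 * inverse (1 + s\<^sup>2)" unfolding K1_def by (rule exp_neg_le_inverse[OF c1])
            also have "\<dots> \<le> (K1 + K2) * inverse (1 + s\<^sup>2)" using K2 p by (intro mult_right_mono) auto
            finally show ?thesis .
          next
            case False
            define y where "y = c2 / t"
            have y: "0 < y" using c2 t by (simp add: y_def)
            have "x * (1 - 1 / sqrt (1 + \<epsilon>\<^sup>2 / 256)) / t \<le> decay t th"
              by (rule decay_ge_minor) (use t elim e th False in auto)
            then have "y \<le> decay t th / 6" by (simp add: y_def c2_def)
            then have "exp (- (decay t th / 6)) \<le> exp (- y)" by simp
            \<comment> \<open>The exponent l + 1 is chosen to produce sc^2 = t^(l+1).\<close>
            also have "\<dots> \<le> fact (l + 1) / y ^ (l + 1)"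
              using power_le_fact_exp[of y "l + 1"] y by (simp add: exp_minus field_simps)
            also have "\<dots> = fact (l + 1) * (1 / c2) ^ (l + 1) * (sc t)\<^sup>2"
              unfolding sc2 y_def by (simp add: power_divide)
            also have "(sc t)\<^sup>2 \<le> (1 + pi\<^sup>2) * inverse (1 + s\<^sup>2)"
            proof -
              have "\<bar>th\<bar>\<^sup>2 \<le> pi\<^sup>2" using th by (intro power_mono) auto
              then have "(sc t)\<^sup>2 * s\<^sup>2 \<le> pi\<^sup>2" by (simp add: th_def power_mult_distrib mult.commute)
              moreover have "(sc t)\<^sup>2 \<le> 1" unfolding sc2 using t elim by (intro power_le_one) auto
              ultimately have "(sc t)\<^sup>2 * (1 + s\<^sup>2) \<le> 1 + pi\<^sup>2" by (simp add: distrib_left)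
              then show ?thesis using p by (simp add: field_simps)
            qed
            then have "fact (l + 1) * (1 / c2) ^ (l + 1) * (sc t)\<^sup>2 \<le> fact (l + 1) * (1 / c2) ^ (l + 1) * ((1 + pi\<^sup>2) * inverse (1 + s\<^sup>2))"
              using c2 by (intro mult_left_mono) auto
            also have "\<dots> = K2 * inverse (1 + s\<^sup>2)" by (simp add: K2_def)
            also have "\<dots> \<le> (K1 + K2) * inverse (1 + s\<^sup>2)" using K1 p by (intro mult_right_mono) auto
            finally show ?thesis .
          qed
        qed (simp add: C0_def)
        finally show ?thesis by (simp only: mult.assoc)
      qed
    qed
  qed
  then show ?thesis by (rule that)
qed

lemma J_tendsto:
  assumes t: "filterlim t (at_right 0) sequentially" and z: "z \<longlonglongrightarrow> z0"
  shows "(\<lambda>n. J (t n) (z n)) \<longlonglongrightarrow>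
    (LINT s|lborel. exp ((z0\<^sup>2 * of_real (real l) + 2 * \<i> * z0 * of_real (s * cov) - of_real (s\<^sup>2 * (resid * fact l))) / 2))"
    (is "_ \<longlonglongrightarrow> (LINT s|lborel. ?f s)")
proof -
  obtain B where B: "\<And>n. norm (z n) \<le> B"
    using convergent_imp_Bseq[of z] z by (auto simp: convergent_def Bseq_def)
  obtain K where K: "\<forall>\<^sub>F t in at_right 0. \<forall>z s. norm z \<le> B \<longrightarrow> norm (J_fun t z s) \<le> K * inverse (1 + s\<^sup>2)"
    by (rule J_fun_dominated)
  have "\<forall>\<^sub>F n in sequentially. \<forall>z s. norm z \<le> B \<longrightarrow> norm (J_fun (t n) z s) \<le> K * inverse (1 + s\<^sup>2)"
    using filterlim_iff[THEN iffD1, OF t] K by blast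
  then obtain N where "\<forall>n\<ge>N. \<forall>z s. norm z \<le> B \<longrightarrow> norm (J_fun (t n) z s) \<le> K * inverse (1 + s\<^sup>2)"
    unfolding eventually_sequentially by blast
  then have N: "\<And>n s. N \<le> n \<Longrightarrow> norm (J_fun (t n) (z n) s) \<le> K * inverse (1 + s\<^sup>2)"
    using B by blast
  have sc0: "(\<lambda>n. sc (t n)) \<longlonglongrightarrow> 0"
  proof -
    have "((\<lambda>t. sqrt (t ^ (l + 1))) \<longlongrightarrow> sqrt 0) (at_right 0)"
      by (intro tendsto_real_sqrt) (auto intro!: tendsto_eq_intros)
    then show ?thesis using filterlim_compose[OF _ t] by (simp add: sc_def[abs_def])
  qed
  have pos: "\<forall>\<^sub>F n in sequentially. 0 < t n"
    using t by (auto simp: filterlim_at elim: eventually_mono)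
  have pt: "(\<lambda>n. J_fun (t n) (z n) s) \<longlonglongrightarrow> ?f s" for s
  proof -
    have "(\<lambda>n. exp (Psi (t n) (z n / of_real (sd (t n))) (s * sc (t n)))) \<longlonglongrightarrow> ?f s"
      by (intro tendsto_exp Psi_tendsto t z)
    then show ?thesis
    proof (rule Lim_transform_eventually)
      \<comment> \<open>Each fixed s eventually lies in the window of integration because sc tends
        to 0.\<close>
      have "(\<lambda>n. \<bar>s\<bar> * sc (t n)) \<longlonglongrightarrow> \<bar>s\<bar> * 0" by (intro tendsto_intros sc0)
      then have "\<forall>\<^sub>F n in sequentially. \<bar>s\<bar> * sc (t n) < pi" by (intro order_tendstoD) auto
      then show "\<forall>\<^sub>F n in sequentially. exp (Psi (t n) (z n / of_real (sd (t n))) (s * sc (t n))) = J_fun (t n) (z n) s"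
        using pos
      proof eventually_elim
        case (elim n)
        have "\<bar>s\<bar> \<le> pi / sc (t n)" using elim sc_pos[of "t n"] by (simp add: field_simps)
        then have "s \<in> {- pi / sc (t n)..pi / sc (t n)}" by (auto simp: abs_le_iff)
        then show ?case by (simp add: J_fun_def)
      qed
    qed
  qed
  \<comment> \<open>The domination holds from N on, so the sequence is shifted by N.\<close>
  have "(\<lambda>n. LINT s|lborel. J_fun (t (n + N)) (z (n + N)) s) \<longlonglongrightarrow> (LINT s|lborel. ?f s)"
  proof (rule integral_dominated_convergence)
    show "integrable lborel (\<lambda>s. K * inverse (1 + s\<^sup>2))"
      by (intro integrable_mult_right integrable_inverse_1_plus_square_lborel)
    show "AE s in lborel. (\<lambda>n. J_fun (t (n + N)) (z (n + N)) s) \<longlonglongrightarrow> ?f s"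
      using pt by (intro AE_I2 LIMSEQ_ignore_initial_segment)
    show "AE s in lborel. norm (J_fun (t (n + N)) (z (n + N)) s) \<le> K * inverse (1 + s\<^sup>2)" for n
      using N by (intro AE_I2) simp
  qed simp_all
  then have "(\<lambda>n. J (t (n + N)) (z (n + N))) \<longlonglongrightarrow> (LINT s|lborel. ?f s)" unfolding J_def .
  then show ?thesis by (rule LIMSEQ_offset)
qed

definition gauss_mass :: real where
  "gauss_mass = (LINT s|lborel. exp (- (s\<^sup>2 * (resid * fact l)) / 2))"

lemma gauss_mass_pos: "0 < gauss_mass"
proof -
  define \<sigma> where "\<sigma> = 1 / sqrt (resid * fact l)"
  have p: "0 < resid * fact l" using resid_pos by simp
  then have \<sigma>: "0 < \<sigma>" and \<sigma>2: "\<sigma>\<^sup>2 = 1 / (resid * fact l)" by (simp_all add: \<sigma>_def power_divide)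
  have "exp (- (s\<^sup>2 * (resid * fact l)) / 2) = sqrt (2 * pi * \<sigma>\<^sup>2) * normal_density 0 \<sigma> s" for s
    using p \<sigma> resid_pos unfolding normal_density_def \<sigma>2 by (simp add: field_simps)
  then have "gauss_mass = sqrt (2 * pi * \<sigma>\<^sup>2)"
    unfolding gauss_mass_def using \<sigma> by simp
  then show ?thesis using \<sigma> by simp
qed

text \<open>For imaginary z the centre of the square in s is real, so completing the square amounts
  to a translation of the real line.\<close>

lemma J_tendsto_imag:
  assumes t: "filterlim t (at_right 0) sequentially" and z: "z \<longlonglongrightarrow> \<i> * of_real v"
  shows "(\<lambda>n. J (t n) (z n)) \<longlonglongrightarrow> of_real (exp (- v\<^sup>2 / 2) * gauss_mass)"
proof -
  let ?a = "resid * fact l"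
  have a: "0 < ?a" using resid_pos by simp
  let ?g = "\<lambda>s. exp (- v\<^sup>2 / 2) * exp (- (s\<^sup>2 * ?a) / 2)"
  have eq: "exp (((\<i> * of_real v)\<^sup>2 * of_real (real l) + 2 * \<i> * (\<i> * of_real v) * of_real (s * cov) - of_real (s\<^sup>2 * ?a)) / 2) =
    of_real (?g (v * cov / ?a + 1 * s))" for s
  proof -
    have "((\<i> * of_real v)\<^sup>2 * of_real (real l) + 2 * \<i> * (\<i> * of_real v) * of_real (s * cov) - of_real (s\<^sup>2 * ?a)) / 2 =
      (of_real (- (v\<^sup>2 * real l) / 2 - v * (s * cov) - s\<^sup>2 * ?a / 2) :: complex)"
      by (simp add: power_mult_distrib field_simps)
    moreover have "- (v\<^sup>2 * real l) / 2 - v * (s * cov) - s\<^sup>2 * ?a / 2 = - v\<^sup>2 / 2 + - ((v * cov / ?a + 1 * s)\<^sup>2 * ?a) / 2"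
    proof -
      have "(v * cov / ?a + 1 * s)\<^sup>2 * ?a = v\<^sup>2 * (cov\<^sup>2 / ?a) + 2 * v * cov * s + s\<^sup>2 * ?a"
        using a resid_pos by (simp add: power2_eq_square field_simps)
      \<comment> \<open>Of the term v^2 l there remains v^2 (l - (l - 1)) = v^2.\<close>
      also have "cov\<^sup>2 / ?a = real l - 1" unfolding cov_sq using a resid_pos by simp
      finally show ?thesis by (simp add: field_simps)
    qed
    ultimately show ?thesis by (simp only: exp_of_real exp_add)
  qed
  have "(LINT s|lborel. exp (((\<i> * of_real v)\<^sup>2 * of_real (real l) + 2 * \<i> * (\<i> * of_real v) * of_real (s * cov) - of_real (s\<^sup>2 * ?a)) / 2))
    = (of_real (LINT s|lborel. ?g (v * cov / ?a + 1 * s)) :: complex)"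
    unfolding eq by (rule integral_complex_of_real)
  also have "(LINT s|lborel. ?g (v * cov / ?a + 1 * s)) = (LINT s|lborel. ?g s)"
    using lborel_integral_real_affine[of 1 ?g "v * cov / ?a"] by simp
  also have "\<dots> = exp (- v\<^sup>2 / 2) * gauss_mass" unfolding gauss_mass_def by simp
  finally show ?thesis using J_tendsto[OF t z] by simp
qed

text \<open>Serves real z, where convergence is used to bound the exponential moments.\<close>

lemma J_convergent:
  assumes "filterlim t (at_right 0) sequentially" and "convergent z"
  shows "convergent (\<lambda>n. J (t n) (z n))"
  using J_tendsto[OF assms(1)] assms(2) unfolding convergent_def by blast

end

section \<open>The limit law\<close>

lemma integral_tuple_measure:
  fixes f :: "_ \<Rightarrow> 'b::{banach, second_countable_topology}"
  assumes "0 < x"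
  shows "(LINT w|tuple_measure l n x. f w) =
    (\<Sum>w\<in>commuting_tuples l n. (x ^ num_orbits n w / (\<Sum>w\<in>commuting_tuples l n. x ^ num_orbits n w)) *\<^sub>R f w)"
  unfolding tuple_measure_def orbit_poly_eq
  by (rule lebesgue_integral_point_measure_finite[OF finite_commuting_tuples])
     (use assms in \<open>auto intro!: divide_nonneg_nonneg sum_nonneg\<close>)

lemma integrable_tuple_measure:
  fixes f :: "_ \<Rightarrow> 'b::{banach, second_countable_topology}"
  shows "integrable (tuple_measure l n x) f"
  unfolding tuple_measure_def by (rule integrable_point_measure_finite[OF finite_commuting_tuples])

lemma sum_power_num_orbits:
  fixes y :: complex
  shows "(\<Sum>w\<in>commuting_tuples l n. y ^ num_orbits n w) =
    fact n * exp_coeff (\<lambda>k. of_real (real (sublattices l k) / real k)) y n"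
proof -
  let ?c = "\<lambda>k. of_real (real (sublattices l k) / real k) :: complex"
  have "(\<Sum>w\<in>commuting_tuples l n. y ^ num_orbits n w) = (\<Sum>w\<in>comm_tuples l {1..n}. y ^ num_orb {1..n} w)"
    unfolding commuting_tuples_eq[symmetric] by (rule sum.cong[OF refl]) (simp add: num_orbits_eq)
  also have "\<dots> = fact (card {1..n}) * exp_coeff ?c y (card {1..n})"
  proof (rule sum_power_num_orb)
    show "exp_coeff ?c y 0 = 1" by (rule exp_coeff_0)
    show "of_nat n * exp_coeff ?c y n = y * (\<Sum>j=1..n. of_nat (sublattices l j) * exp_coeff ?c y (n - j))" if "n > 0" for n
      by (subst exp_coeff_rec[OF _ that]) (auto intro!: sum.cong)
  qed simp
  finally show ?thesis by simp
qed

context orbit_saddle begin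

abbreviation "TM \<equiv> \<lambda>n. tuple_measure l n x"


text \<open>An explicit proxy for the mean, as \<open>sg\<close> is for the standard deviation; the
  true values are recovered from the moments of \<open>Zn\<close>.\<close>

definition mu :: "nat \<Rightarrow> real" where "mu n = G 0 (saddle n)"

definition sg :: "nat \<Rightarrow> real" where "sg n = sd (saddle n)"

definition Zn :: "nat \<Rightarrow> (nat \<Rightarrow> nat) list \<Rightarrow> real" where
  "Zn n w = (real (num_orbits n w) - mu n) / sg n"

text \<open>Cauchy's formula at radius e^(-t) with the angle rescaled by sc. The prefactor does not
  contain z, so it cancels in quotients.\<close>

lemma sum_power_eq_J:
  assumes n: "0 < n"
  defines "t \<equiv> saddle n"
  shows "(\<Sum>w\<in>commuting_tuples l n. (of_real x * exp (z / of_real (sd t))) ^ num_orbits n w) * exp (- (z / of_real (sd t) * of_real (G 0 t))) =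
    of_real (fact n * sc t * exp (G 0 t) / (2 * pi * exp (- t) ^ n)) * J t z"
proof -
  let ?\<zeta> = "z / of_real (sd t)" and ?c = "\<lambda>k. of_real (real (sublattices l k) / real k) :: complex"
  let ?y = "of_real x * exp ?\<zeta>"
  have t: "0 < t" and G1: "G 1 t = real n" using saddle[OF n] by (auto simp: t_def)
  have sc: "0 < sc t" by (rule sc_pos[OF t])
  have "summable (\<lambda>k. norm (?c k) * r ^ k)" if "0 < r" "r < 1" for r
  proof -
    have "0 < - ln r" using that by simp
    from summable_orbit_series[OF this, of l 0] that show ?thesis
      by (simp add: exp_of_nat_mult norm_divide mult_ac)
  qed
  then have A: "of_real (2 * pi) * (exp_coeff ?c ?y n * of_real (exp (- t)) ^ n) =
    (LINT th:{-pi..pi}|lborel. exp (?y * (\<Sum>k. ?c k * (of_real (exp (- t)) * cis th) ^ k)) * cis (- (real n * th)))"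
    by (intro exp_coeff_integral[symmetric]) (use t in auto)
  \<comment> \<open>The saddle equation enters here: with \<open>G 1 t\<close> = n, the factor cis
    (- n th) is exactly the linear term in th that \<open>Psi\<close> subtracts.\<close>
  have B: "exp (?y * (\<Sum>k. ?c k * (of_real (exp (- t)) * cis th) ^ k)) * cis (- (real n * th)) =
    exp (of_real (G 0 t) + ?\<zeta> * of_real (G 0 t)) * exp (Psi t ?\<zeta> th)" for th
    unfolding cis_conv_exp mult_exp_exp Psi_eq[OF t] G1 by (rule arg_cong[of _ _ exp]) simp
  note A
  also have "(LINT th:{-pi..pi}|lborel. exp (?y * (\<Sum>k. ?c k * (of_real (exp (- t)) * cis th) ^ k)) * cis (- (real n * th))) =
    (LINT th:{-pi..pi}|lborel. exp (of_real (G 0 t) + ?\<zeta> * of_real (G 0 t)) * exp (Psi t ?\<zeta> th))"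
    unfolding B ..
  also have "(LINT th:{-pi..pi}|lborel. exp (of_real (G 0 t) + ?\<zeta> * of_real (G 0 t)) * exp (Psi t ?\<zeta> th)) =
    exp (of_real (G 0 t) + ?\<zeta> * of_real (G 0 t)) * (LINT th:{-pi..pi}|lborel. exp (Psi t ?\<zeta> th))"
    by (rule set_integral_mult_right)
  also have "(LINT th:{-pi..pi}|lborel. exp (Psi t ?\<zeta> th)) = sc t *\<^sub>R J t z"
  proof -
    have "(LINT th:{-pi..pi}|lborel. exp (Psi t ?\<zeta> th)) = \<bar>sc t\<bar> *\<^sub>R (LINT s|lborel. indicator {-pi..pi} (0 + sc t * s) *\<^sub>R exp (Psi t ?\<zeta> (0 + sc t * s)))"
      unfolding set_lebesgue_integral_def using sc by (subst lborel_integral_real_affine[of "sc t" _ 0]) auto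
    moreover have "indicator {-pi..pi} (0 + sc t * s) *\<^sub>R exp (Psi t ?\<zeta> (0 + sc t * s)) = J_fun t z s" for s
    proof -
      have "(0 + sc t * s \<in> {-pi..pi}) = (s \<in> {- pi / sc t..pi / sc t})" using sc by (auto simp: field_simps)
      then show ?thesis by (simp add: J_fun_def indicator_def mult.commute)
    qed
    ultimately show ?thesis using sc by (simp only: J_def abs_of_pos)
  qed
  finally have eq: "of_real (2 * pi) * (exp_coeff ?c ?y n * of_real (exp (- t)) ^ n) =
    exp (of_real (G 0 t) + ?\<zeta> * of_real (G 0 t)) * (of_real (sc t) * J t z)" by (simp add: scaleR_conv_of_real)
  have "of_real (2 * pi * exp (- t) ^ n) * (exp_coeff ?c ?y n * exp (- (?\<zeta> * of_real (G 0 t)))) =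
    (of_real (2 * pi) * (exp_coeff ?c ?y n * of_real (exp (- t)) ^ n)) * exp (- (?\<zeta> * of_real (G 0 t)))"
    by simp
  also have "\<dots> = (exp (of_real (G 0 t) + ?\<zeta> * of_real (G 0 t)) * exp (- (?\<zeta> * of_real (G 0 t)))) * (of_real (sc t) * J t z)"
    unfolding eq by (simp only: mult_ac)
  also have "exp (of_real (G 0 t) + ?\<zeta> * of_real (G 0 t)) * exp (- (?\<zeta> * of_real (G 0 t))) = of_real (exp (G 0 t))"
    by (simp add: mult_exp_exp exp_of_real)
  finally have "exp_coeff ?c ?y n * exp (- (?\<zeta> * of_real (G 0 t))) =
    of_real (exp (G 0 t)) * (of_real (sc t) * J t z) / of_real (2 * pi * exp (- t) ^ n)"
    by (subst eq_divide_eq) (auto simp: mult_ac)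
  then show ?thesis unfolding sum_power_num_orbits by (simp add: mult_ac)
qed

lemma expectation_exp_Zn:
  assumes n: "0 < n"
  shows "(LINT w|TM n. exp (z * of_real (Zn n w))) = J (saddle n) z / J (saddle n) 0"
proof -
  let ?t = "saddle n" and ?C = "commuting_tuples l n"
  let ?K = "of_real (fact n * sc ?t * exp (G 0 ?t) / (2 * pi * exp (- ?t) ^ n)) :: complex"
  let ?W = "\<Sum>w\<in>?C. x ^ num_orbits n w"
  have t: "0 < ?t" using saddle[OF n] by simp
  have K: "?K \<noteq> 0" using sc_pos[OF t] by simp
  have W: "0 < ?W" using orbit_poly_pos[OF x_pos, of n l] by (simp add: orbit_poly_eq)
  have 0: "of_real ?W = ?K * J ?t 0"
    using sum_power_eq_J[OF n, of 0] by simp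
  \<comment> \<open>The total weight is positive, so the denominator cannot vanish.\<close>
  then have J0: "J ?t 0 \<noteq> 0" using W by (metis less_irrefl mult_zero_right of_real_eq_0_iff)
  have e: "of_real (x ^ num_orbits n w) * exp (z * of_real (Zn n w)) =
    (of_real x * exp (z / of_real (sd ?t))) ^ num_orbits n w * exp (- (z / of_real (sd ?t) * of_real (G 0 ?t)))" for w
    by (simp add: Zn_def mu_def sg_def power_mult_distrib exp_of_nat_mult[symmetric] mult_exp_exp mult.assoc diff_divide_distrib right_diff_distrib mult_ac)
  have "(LINT w|TM n. exp (z * of_real (Zn n w))) =
    (\<Sum>w\<in>?C. of_real (x ^ num_orbits n w) * exp (z * of_real (Zn n w))) / of_real ?W"
    unfolding integral_tuple_measure[OF x_pos] by (simp add: scaleR_conv_of_real sum_divide_distrib)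
  also have "(\<Sum>w\<in>?C. of_real (x ^ num_orbits n w) * exp (z * of_real (Zn n w))) = ?K * J ?t z"
    unfolding e sum_distrib_right[symmetric] by (rule sum_power_eq_J[OF n])
  also have "?K * J ?t z / of_real ?W = J ?t z / J ?t 0" unfolding 0 using K J0 by simp
  finally show ?thesis .
qed

lemma J_0_tendsto: "(\<lambda>n. J (saddle n) 0) \<longlonglongrightarrow> of_real gauss_mass"
  using J_tendsto_imag[OF saddle_tendsto, of "\<lambda>_. 0" 0] by simp

lemma expectation_exp_Zn_eventually:
  "\<forall>\<^sub>F n in sequentially. J (saddle n) (z n) / J (saddle n) 0 = (LINT w|TM n. exp (z n * of_real (Zn n w)))"
  using eventually_gt_at_top[of 0] by eventually_elim (rule expectation_exp_Zn[symmetric])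

lemma expectation_exp_Zn_tendsto:
  assumes "z \<longlonglongrightarrow> \<i> * of_real v"
  shows "(\<lambda>n. LINT w|TM n. exp (z n * of_real (Zn n w))) \<longlonglongrightarrow> of_real (exp (- v\<^sup>2 / 2))"
proof -
  have g: "(of_real gauss_mass :: complex) \<noteq> 0" using gauss_mass_pos by simp
  have "(\<lambda>n. J (saddle n) (z n) / J (saddle n) 0) \<longlonglongrightarrow> of_real (exp (- v\<^sup>2 / 2) * gauss_mass) / of_real gauss_mass"
    by (rule tendsto_divide[OF J_tendsto_imag[OF saddle_tendsto assms] J_0_tendsto g])
  also have "of_real (exp (- v\<^sup>2 / 2) * gauss_mass) / of_real gauss_mass = (of_real (exp (- v\<^sup>2 / 2)) :: complex)"
    using g by simp
  finally show ?thesis by (rule Lim_transform_eventually[OF _ expectation_exp_Zn_eventually])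
qed

lemma expectation_exp_Zn_Bseq:
  assumes "convergent z"
  shows "Bseq (\<lambda>n. LINT w|TM n. exp (z n * Zn n w))"
proof -
  have g: "(of_real gauss_mass :: complex) \<noteq> 0" using gauss_mass_pos by simp
  have "convergent (\<lambda>n. of_real (z n) :: complex)" using assms by (auto simp: convergent_def intro: tendsto_of_real)
  then obtain L where "(\<lambda>n. J (saddle n) (of_real (z n))) \<longlonglongrightarrow> L"
    using J_convergent[OF saddle_tendsto] by (auto simp: convergent_def)
  from tendsto_divide[OF this J_0_tendsto g]
  have "(\<lambda>n. J (saddle n) (of_real (z n)) / J (saddle n) 0) \<longlonglongrightarrow> L / of_real gauss_mass" .
  then have "(\<lambda>n. LINT w|TM n. exp (of_real (z n) * of_real (Zn n w))) \<longlonglongrightarrow> L / of_real gauss_mass"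
    by (rule Lim_transform_eventually[OF _ expectation_exp_Zn_eventually])
  moreover have "(LINT w|TM n. exp (of_real (z n) * of_real (Zn n w))) =
    (of_real (LINT w|TM n. exp (z n * Zn n w)) :: complex)" for n
    unfolding integral_complex_of_real[symmetric] by (simp only: exp_of_real of_real_mult[symmetric])
  ultimately have "Bseq (\<lambda>n. of_real (LINT w|TM n. exp (z n * Zn n w)) :: complex)"
    by (intro convergent_imp_Bseq) (auto simp: convergent_def)
  then show ?thesis by (simp add: Bseq_def)
qed

end

section \<open>Gaussian limits from exponential moments\<close>

lemma abs_power_le_exp: "\<bar>y :: real\<bar> ^ k \<le> fact k * (exp y + exp (- y))"
proof -
  have "\<bar>y\<bar> ^ k \<le> fact k * exp \<bar>y\<bar>" by (rule power_le_fact_exp) simp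
  also have "\<dots> \<le> fact k * (exp y + exp (- y))" by (intro mult_left_mono) (auto simp: abs_if)
  finally show ?thesis .
qed

text \<open>Truncation of the identity: its powers are bounded and continuous, so weak convergence
  applies to them.\<close>

definition clamp_to :: "real \<Rightarrow> real \<Rightarrow> real" where
  "clamp_to R y = max (- R) (min R y)"

lemma clamp_to_bound: "0 \<le> R \<Longrightarrow> \<bar>clamp_to R y\<bar> \<le> R"
  by (auto simp: clamp_to_def)

lemma isCont_clamp_to: "isCont (\<lambda>y. clamp_to R y ^ k) y"
  unfolding clamp_to_def by (intro continuous_intros)

text \<open>The difference vanishes unless |y| > R, and there a spare factor |y|/R > 1 can be
  inserted.\<close>

lemma clamp_to_power_diff:
  assumes "0 < R"
  shows "\<bar>y ^ k - clamp_to R y ^ k\<bar> \<le> 2 / R * \<bar>y\<bar> ^ Suc k"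
proof (cases "\<bar>y\<bar> \<le> R")
  case True
  then have "clamp_to R y = y" by (auto simp: clamp_to_def abs_le_iff)
  then show ?thesis using assms by simp
next
  case False
  have "\<bar>clamp_to R y\<bar> \<le> \<bar>y\<bar>" using False assms by (auto simp: clamp_to_def)
  then have "\<bar>clamp_to R y\<bar> ^ k \<le> \<bar>y\<bar> ^ k" by (intro power_mono) auto
  then have "\<bar>y ^ k - clamp_to R y ^ k\<bar> \<le> 2 * \<bar>y\<bar> ^ k"
    using abs_triangle_ineq4[of "y ^ k" "clamp_to R y ^ k"] by (simp add: power_abs)
  also have "2 * \<bar>y\<bar> ^ k * 1 \<le> 2 * \<bar>y\<bar> ^ k * (\<bar>y\<bar> / R)"
    using False assms by (intro mult_left_mono) auto
  then have "2 * \<bar>y\<bar> ^ k \<le> 2 / R * \<bar>y\<bar> ^ Suc k" by (simp add: mult_ac)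
  finally show ?thesis .
qed

text \<open>Levy's theorem gives weak convergence. For moments, the truncation error at level R is
  at most a constant over R, uniformly in n: e^X + e^(-X) controls the absolute moment of order k +
  1, and its expectation is bounded.\<close>

lemma gaussian_limit:
  fixes M :: "nat \<Rightarrow> 'a measure" and X :: "nat \<Rightarrow> 'a \<Rightarrow> real"
  assumes prob: "\<And>n. prob_space (M n)"
    and meas: "\<And>n. X n \<in> borel_measurable (M n)"
    and char: "\<And>v. (\<lambda>n. LINT w|M n. exp (\<i> * of_real v * of_real (X n w))) \<longlonglongrightarrow> of_real (exp (- v\<^sup>2 / 2))"
    and int: "\<And>n. integrable (M n) (\<lambda>w. exp (X n w))" "\<And>n. integrable (M n) (\<lambda>w. exp (- X n w))"
    and bdd: "Bseq (\<lambda>n. LINT w|M n. exp (X n w))" "Bseq (\<lambda>n. LINT w|M n. exp (- X n w))"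
  shows gaussian_limit_bounded: "\<And>f B. (\<And>y. isCont f y) \<Longrightarrow> (\<And>y. \<bar>f y\<bar> \<le> B) \<Longrightarrow>
      (\<lambda>n. LINT w|M n. f (X n w)) \<longlonglongrightarrow> (LINT y|std_normal_distribution. f y :: real)"
    and gaussian_limit_moment: "\<And>k. (\<lambda>n. LINT w|M n. X n w ^ k) \<longlonglongrightarrow> (LINT y|std_normal_distribution. y ^ k)"
proof -
  note [measurable] = meas
  let ?D = "\<lambda>n. distr (M n) borel (X n)"
  have rd: "real_distribution (?D n)" for n
    using prob_space.prob_space_distr[OF prob meas]
    by (simp add: real_distribution_def real_distribution_axioms_def)
  have wc: "weak_conv_m ?D std_normal_distribution"
  proof (rule levy_continuity[OF rd real_dist_normal_dist])
    fix v
    have "char (?D n) v = (LINT w|M n. exp (\<i> * of_real v * of_real (X n w)))" for n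
      unfolding char_def by (subst integral_distr) (auto simp: mult.assoc)
    then show "(\<lambda>n. char (?D n) v) \<longlonglongrightarrow> char std_normal_distribution v"
      using char[of v] by (simp add: char_std_normal_distribution)
  qed
  show bounded: "(\<lambda>n. LINT w|M n. f (X n w)) \<longlonglongrightarrow> (LINT y|std_normal_distribution. f y)"
    if f: "\<And>y. isCont f y" "\<And>y. \<bar>f y\<bar> \<le> B" for f :: "real \<Rightarrow> real" and B
  proof -
    have [measurable]: "f \<in> borel_measurable borel"
      using f(1) by (intro borel_measurable_continuous_onI continuous_at_imp_continuous_on) auto
    have "(\<lambda>n. integral\<^sup>L (?D n) f) \<longlonglongrightarrow> integral\<^sup>L std_normal_distribution f"
      using rd real_dist_normal_dist wc f(1)
      by (rule weak_conv_imp_integral_bdd_continuous_conv) (use f(2) in auto)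
    then show ?thesis by (simp add: integral_distr)
  qed
  have pint: "integrable (M n) (\<lambda>w. X n w ^ k)" for n k
  proof (rule Bochner_Integration.integrable_bound)
    show "integrable (M n) (\<lambda>w. fact k * (exp (X n w) + exp (- X n w)))"
      by (intro integrable_mult_right Bochner_Integration.integrable_add int)
    show "AE w in M n. norm (X n w ^ k) \<le> norm (fact k * (exp (X n w) + exp (- X n w)))"
      using abs_power_le_exp by (intro AE_I2) (simp add: power_abs abs_mult add_nonneg_nonneg)
  qed measurable
  show "(\<lambda>n. LINT w|M n. X n w ^ k) \<longlonglongrightarrow> (LINT y|std_normal_distribution. y ^ k)" for k
  proof -
    obtain B1 B2 where B: "\<And>n. norm (LINT w|M n. exp (X n w)) \<le> B1" "\<And>n. norm (LINT w|M n. exp (- X n w)) \<le> B2"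
      using bdd unfolding Bseq_def by blast
    define N where "N = (LINT y|std_normal_distribution. \<bar>y\<bar> ^ Suc k)"
    \<comment> \<open>C collects the truncation errors of the sequence and of the limit.\<close>
    define C where "C = 2 * (fact (Suc k) * (B1 + B2)) + 2 * N"
    have N0: "0 \<le> N" unfolding N_def by (intro integral_nonneg_AE AE_I2) auto
    have B0: "0 \<le> B1 + B2" using B[of 0] norm_ge_zero order_trans by (metis add_nonneg_nonneg)
    have C0: "0 \<le> C" using N0 B0 by (simp add: C_def)
    have d1: "\<bar>(LINT w|M n. X n w ^ k) - (LINT w|M n. clamp_to R (X n w) ^ k)\<bar> \<le> 2 * (fact (Suc k) * (B1 + B2)) / R"
      if R: "0 < R" for R n
    proof -
      interpret prob_space "M n" by (rule prob)
      have ic: "integrable (M n) (\<lambda>w. clamp_to R (X n w) ^ k)"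
        by (rule integrable_const_bound[of _ "R ^ k"])
           (use clamp_to_bound[of R] R in \<open>auto simp: power_abs intro!: power_mono AE_I2 simp: clamp_to_def\<close>)
      have ia: "integrable (M n) (\<lambda>w. 2 / R * (fact (Suc k) * (exp (X n w) + exp (- X n w))))"
        by (intro integrable_mult_right Bochner_Integration.integrable_add int)
      have "\<bar>(LINT w|M n. X n w ^ k) - (LINT w|M n. clamp_to R (X n w) ^ k)\<bar> = \<bar>LINT w|M n. X n w ^ k - clamp_to R (X n w) ^ k\<bar>"
        by (simp add: Bochner_Integration.integral_diff[OF pint ic])
      also have "\<dots> \<le> (LINT w|M n. 2 / R * (fact (Suc k) * (exp (X n w) + exp (- X n w))))"
      proof (rule order_trans[OF integral_abs_bound integral_mono[OF _ ia]])
        show "integrable (M n) (\<lambda>w. \<bar>X n w ^ k - clamp_to R (X n w) ^ k\<bar>)"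
          by (intro integrable_abs Bochner_Integration.integrable_diff pint ic)
        fix w
        have "2 / R * \<bar>X n w\<bar> ^ Suc k \<le> 2 / R * (fact (Suc k) * (exp (X n w) + exp (- X n w)))"
          using R by (intro mult_left_mono abs_power_le_exp) auto
        then show "\<bar>X n w ^ k - clamp_to R (X n w) ^ k\<bar> \<le> 2 / R * (fact (Suc k) * (exp (X n w) + exp (- X n w)))"
          by (rule order_trans[OF clamp_to_power_diff[OF R]])
      qed
      also have "\<dots> = 2 / R * (fact (Suc k) * ((LINT w|M n. exp (X n w)) + (LINT w|M n. exp (- X n w))))"
        using int by simp
      also have "\<dots> \<le> 2 / R * (fact (Suc k) * (B1 + B2))"
        using R B(1)[of n] B(2)[of n] by (intro mult_left_mono add_mono) auto
      finally show ?thesis by simp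
    qed
    have d2: "\<bar>(LINT y|std_normal_distribution. y ^ k) - (LINT y|std_normal_distribution. clamp_to R y ^ k)\<bar> \<le> 2 * N / R"
      if R: "0 < R" for R
    proof -
      interpret S: real_distribution std_normal_distribution by (rule real_dist_normal_dist)
      have ic: "integrable std_normal_distribution (\<lambda>y. clamp_to R y ^ k)"
        by (rule S.integrable_const_bound[of _ "R ^ k"])
           (use clamp_to_bound[of R] R in \<open>auto simp: power_abs intro!: power_mono AE_I2 simp: clamp_to_def\<close>)
      have ia: "integrable std_normal_distribution (\<lambda>y. 2 / R * \<bar>y\<bar> ^ Suc k)"
        using integrable_abs[OF integrable_std_normal_distribution_moment[of "Suc k"]]
        by (intro integrable_mult_right) (simp add: power_abs del: power_Suc)
      have "\<bar>(LINT y|std_normal_distribution. y ^ k) - (LINT y|std_normal_distribution. clamp_to R y ^ k)\<bar> = \<bar>LINT y|std_normal_distribution. y ^ k - clamp_to R y ^ k\<bar>"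
        by (simp add: Bochner_Integration.integral_diff[OF integrable_std_normal_distribution_moment ic])
      also have "\<dots> \<le> (LINT y|std_normal_distribution. 2 / R * \<bar>y\<bar> ^ Suc k)"
      proof (rule order_trans[OF integral_abs_bound integral_mono[OF _ ia]])
        show "integrable std_normal_distribution (\<lambda>y. \<bar>y ^ k - clamp_to R y ^ k\<bar>)"
          by (intro integrable_abs Bochner_Integration.integrable_diff integrable_std_normal_distribution_moment ic)
      qed (rule clamp_to_power_diff[OF R])
      also have "\<dots> = 2 * N / R" by (simp add: N_def)
      finally show ?thesis .
    qed
    show ?thesis
    proof (rule LIMSEQ_I)
      fix e :: real assume e: "0 < e"
      \<comment> \<open>Makes C/R < e/2, leaving e/2 for the truncated moments.\<close>
      define R where "R = 2 * C / e + 1"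
      have R: "0 < R" using C0 e by (simp add: R_def add_nonneg_pos)
      have CR: "C / R < e / 2" using C0 e R by (simp add: R_def field_simps)
      have "(\<lambda>n. LINT w|M n. clamp_to R (X n w) ^ k) \<longlonglongrightarrow> (LINT y|std_normal_distribution. clamp_to R y ^ k)"
        by (rule bounded[where B = "R ^ k"])
           (use clamp_to_bound[of R] R in \<open>auto simp: power_abs isCont_clamp_to intro!: power_mono\<close>)
      from LIMSEQ_D[OF this, of "e / 2"] e obtain n0 where n0: "\<And>n. n0 \<le> n \<Longrightarrow>
        norm ((LINT w|M n. clamp_to R (X n w) ^ k) - (LINT y|std_normal_distribution. clamp_to R y ^ k)) < e / 2" by auto
      show "\<exists>n0. \<forall>n\<ge>n0. norm ((LINT w|M n. X n w ^ k) - (LINT y|std_normal_distribution. y ^ k)) < e"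
      proof (intro exI allI impI)
        fix n assume "n0 \<le> n"
        note n0[OF this] d1[OF R, of n] d2[OF R] CR
        moreover have "C / R = 2 * (fact (Suc k) * (B1 + B2)) / R + 2 * N / R"
          by (simp add: C_def add_divide_distrib)
        ultimately show "norm ((LINT w|M n. X n w ^ k) - (LINT y|std_normal_distribution. y ^ k)) < e"
          unfolding real_norm_def by linarith
      qed
    qed
  qed
qed

lemma integral_std_normal_distribution:
  assumes [measurable]: "f \<in> borel_measurable borel"
  shows "(LINT y|std_normal_distribution. f y) = 1 / sqrt (2 * pi) * (LBINT s. f s * exp (- s\<^sup>2 / 2) :: real)"
proof -
  have "(LINT y|std_normal_distribution. f y) = (LBINT s. std_normal_density s *\<^sub>R f s)"
    by (rule integral_density) auto
  also have "\<dots> = (LBINT s. 1 / sqrt (2 * pi) * (f s * exp (- s\<^sup>2 / 2)))"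
    by (simp add: std_normal_density_def mult_ac)
  also have "\<dots> = 1 / sqrt (2 * pi) * (LBINT s. f s * exp (- s\<^sup>2 / 2))"
    by (rule integral_mult_right_zero)
  finally show ?thesis .
qed

section \<open>True mean, true variance and exact normalization\<close>

context orbit_saddle begin

definition Kc :: real where "Kc = x * zeta_const l"

lemma Kc_eq: "Kc = resid * fact (l - 1)"
  by (simp add: Kc_def resid_def zeta_const_def zeta_prod_def)

lemma Kc_eq': "Kc = resid * fact (l - 2) * (real l - 1)"
proof -
  have "fact (l - 1) = real (l - 1) * fact (l - 1 - 1)" using l_ge_2 by (intro fact_reduce) simp
  moreover have "l - 1 - 1 = l - 2" by simp
  ultimately show ?thesis using l_ge_2 by (simp add: Kc_eq of_nat_diff)
qed

lemma Kc_pos: "0 < Kc"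
  using resid_pos by (simp add: Kc_eq)

text \<open>Since t^l n tends to \<open>Kc\<close> at the saddle point t, the factor t^(l-1) is
  asymptotic to (\<open>Kc\<close>/n)^((l-1)/l). This trades the implicit scale for a power of
  n.\<close>

lemma asymp_equiv_power_rate:
  assumes f: "(\<lambda>n. saddle n ^ (l - 1) * f n) \<longlonglongrightarrow> Kc / c" and c: "c \<noteq> 0"
  shows "f \<sim>[at_top] (\<lambda>n. Kc powr (1 / real l) / c * real n powr ((real l - 1) / real l))"
proof (rule asymp_equivI')
  let ?a = "(real l - 1) / real l"
  have l: "1 < real l" using l_ge_2 by simp
  have "(\<lambda>n. saddle n ^ (l - 1) * f n / (Kc powr (1 / real l) / c * (saddle n ^ l * real n) powr ?a)) \<longlonglongrightarrow>
    Kc / c / (Kc powr (1 / real l) / c * Kc powr ?a)"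
    using saddle_asymp Kc_pos c unfolding Kc_eq[symmetric] by (intro tendsto_intros f) auto
  moreover have "Kc powr (1 / real l) * Kc powr ?a = Kc"
  proof -
    have "1 / real l + ?a = 1" using l by (simp add: field_simps)
    then show ?thesis using Kc_pos by (simp add: powr_add[symmetric])
  qed
  then have "Kc / c / (Kc powr (1 / real l) / c * Kc powr ?a) = 1" using Kc_pos c by simp
  ultimately have lim: "(\<lambda>n. saddle n ^ (l - 1) * f n / (Kc powr (1 / real l) / c * (saddle n ^ l * real n) powr ?a)) \<longlonglongrightarrow> 1"
    by (simp only:)
  show "(\<lambda>n. f n / (Kc powr (1 / real l) / c * real n powr ?a)) \<longlonglongrightarrow> 1"
  proof (rule Lim_transform_eventually[OF lim])
    show "\<forall>\<^sub>F n in sequentially. saddle n ^ (l - 1) * f n / (Kc powr (1 / real l) / c * (saddle n ^ l * real n) powr ?a) =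
      f n / (Kc powr (1 / real l) / c * real n powr ?a)"
      using eventually_gt_at_top[of 0]
    proof eventually_elim
      case (elim n)
      have t: "0 < saddle n" using saddle[OF elim] by simp
      have "(saddle n ^ l) powr ?a = saddle n powr (real l * ?a)" using t by (simp add: powr_realpow[symmetric] powr_powr)
      also have "real l * ?a = real (l - 1)" using l_ge_2 by (simp add: of_nat_diff)
      finally have "(saddle n ^ l) powr ?a = saddle n ^ (l - 1)" using t by (simp add: powr_realpow)
      then have "(saddle n ^ l * real n) powr ?a = saddle n ^ (l - 1) * real n powr ?a"
        using t by (simp add: powr_mult)
      then show ?case using t by (simp add: mult.left_commute)
    qed
  qed
qed

lemma TM_prob: "prob_space (TM n)"
  by (rule prob_space_tuple_measure[OF x_pos])

lemma TM_measurable: "(f :: _ \<Rightarrow> real) \<in> borel_measurable (TM n)"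
  unfolding tuple_measure_def by (simp add: measurable_point_measure_eq1)

definition mean_Zn :: "nat \<Rightarrow> real" where "mean_Zn n = (LINT w|TM n. Zn n w)"

definition second_Zn :: "nat \<Rightarrow> real" where "second_Zn n = (LINT w|TM n. (Zn n w)\<^sup>2)"

text \<open>For n > 0, the ratio of the true standard deviation to \<open>sg n\<close>.\<close>

definition sd_Zn :: "nat \<Rightarrow> real" where "sd_Zn n = sqrt (second_Zn n - (mean_Zn n)\<^sup>2)"

text \<open>The exponential moments at 1 and -1 dominate all powers, so bounding these two is
  enough.\<close>

lemma Zn_moments: "(\<lambda>n. LINT w|TM n. Zn n w ^ k) \<longlonglongrightarrow> (LINT y|std_normal_distribution. y ^ k)"
proof (rule gaussian_limit_moment[OF TM_prob TM_measurable])
  show "(\<lambda>n. LINT w|TM n. exp (\<i> * of_real v * of_real (Zn n w))) \<longlonglongrightarrow> of_real (exp (- v\<^sup>2 / 2))" for v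
    by (rule expectation_exp_Zn_tendsto) simp
  show "Bseq (\<lambda>n. LINT w|TM n. exp (Zn n w))"
    using expectation_exp_Zn_Bseq[of "\<lambda>_. 1"] by (simp add: convergent_const)
  show "Bseq (\<lambda>n. LINT w|TM n. exp (- Zn n w))"
    using expectation_exp_Zn_Bseq[of "\<lambda>_. -1"] by (simp add: convergent_const)
qed (rule integrable_tuple_measure)+

lemma mean_Zn_tendsto: "mean_Zn \<longlonglongrightarrow> 0"
  using Zn_moments[of 1] integral_std_normal_distribution_moment_odd[of 1] by (simp add: mean_Zn_def[abs_def])

lemma second_Zn_tendsto: "second_Zn \<longlonglongrightarrow> 1"
  using Zn_moments[of 2] std_normal_distribution_even_moments(1)[of 1] by (simp add: second_Zn_def[abs_def])

lemma sd_Zn_tendsto: "sd_Zn \<longlonglongrightarrow> 1"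
proof -
  have "(\<lambda>n. sqrt (second_Zn n - (mean_Zn n)\<^sup>2)) \<longlonglongrightarrow> sqrt (1 - 0\<^sup>2)"
    by (intro tendsto_intros second_Zn_tendsto mean_Zn_tendsto)
  then show ?thesis by (simp add: sd_Zn_def[abs_def])
qed

lemma num_orbits_eq_Zn:
  assumes "0 < n"
  shows "real (num_orbits n w) = mu n + sg n * Zn n w"
proof -
  have "0 < sg n" using saddle[OF assms] by (simp add: sg_def sd_pos)
  then show ?thesis by (simp add: Zn_def)
qed

lemma mean_orbits_eq:
  assumes n: "0 < n"
  shows "mean_orbits l x n = mu n + sg n * mean_Zn n"
proof -
  interpret prob_space "TM n" by (rule TM_prob)
  show ?thesis unfolding mean_orbits_def num_orbits_eq_Zn[OF n] mean_Zn_def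
    by (simp add: integrable_tuple_measure prob_space)
qed

lemma var_orbits_eq:
  assumes n: "0 < n"
  shows "var_orbits l x n = (sg n)\<^sup>2 * (second_Zn n - (mean_Zn n)\<^sup>2)"
proof -
  interpret prob_space "TM n" by (rule TM_prob)
  have "var_orbits l x n = variance (\<lambda>w. mu n + sg n * Zn n w)"
    unfolding var_orbits_def num_orbits_eq_Zn[OF n] ..
  also have "\<dots> = (LINT w|TM n. (sg n)\<^sup>2 * (Zn n w)\<^sup>2 - 2 * (sg n)\<^sup>2 * mean_Zn n * Zn n w + (sg n)\<^sup>2 * (mean_Zn n)\<^sup>2)"
  proof (rule Bochner_Integration.integral_cong[OF refl])
    fix w
    have "expectation (\<lambda>w. mu n + sg n * Zn n w) = mu n + sg n * mean_Zn n"
      unfolding mean_Zn_def by (simp add: integrable_tuple_measure prob_space)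
    then show "(mu n + sg n * Zn n w - expectation (\<lambda>w. mu n + sg n * Zn n w))\<^sup>2 =
      (sg n)\<^sup>2 * (Zn n w)\<^sup>2 - 2 * (sg n)\<^sup>2 * mean_Zn n * Zn n w + (sg n)\<^sup>2 * (mean_Zn n)\<^sup>2"
      by (simp add: power2_eq_square algebra_simps)
  qed
  also have "\<dots> = (sg n)\<^sup>2 * second_Zn n - 2 * (sg n)\<^sup>2 * mean_Zn n * mean_Zn n + (sg n)\<^sup>2 * (mean_Zn n)\<^sup>2"
    unfolding second_Zn_def mean_Zn_def by (simp add: integrable_tuple_measure prob_space)
  finally show ?thesis by (simp add: power2_eq_square algebra_simps)
qed

lemma sg_sq:
  assumes n: "0 < n"
  shows "saddle n ^ (l - 1) * (sg n)\<^sup>2 = var0"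
  using saddle[OF n] var0_pos by (simp add: sg_def sd_def)

text \<open>\<open>mu\<close> has order t^(-(l-1)), while \<open>sg\<close> has only the order of
  its square root, so the correction \<open>sg n * mean_Zn n\<close> is negligible and
  \<open>G 0\<close> decides.\<close>

lemma mean_asymp:
  "mean_orbits l x \<sim>[at_top] (\<lambda>n. Kc powr (1 / real l) / (real l - 1) * real n powr ((real l - 1) / real l))"
proof (rule asymp_equiv_power_rate)
  show "real l - 1 \<noteq> 0" using l_ge_2 by simp
  have "((\<lambda>t. t ^ (l - 1) * G 0 t) \<longlongrightarrow> resid * fact (l - 2)) (at_right 0)" using G_asymp[of 0] by simp
  from filterlim_compose[OF this saddle_tendsto]
  have 1: "(\<lambda>n. saddle n ^ (l - 1) * mu n) \<longlonglongrightarrow> resid * fact (l - 2)" by (simp add: mu_def)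
  have "((\<lambda>t. sqrt (var0 * t ^ (l - 1))) \<longlongrightarrow> sqrt (var0 * 0)) (at_right 0)"
    using l_ge_2 by (intro tendsto_real_sqrt tendsto_mult tendsto_const) (auto intro!: tendsto_eq_intros)
  from filterlim_compose[OF this saddle_tendsto]
  have "(\<lambda>n. sqrt (var0 * saddle n ^ (l - 1)) * mean_Zn n) \<longlonglongrightarrow> sqrt (var0 * 0) * 0"
    by (intro tendsto_mult mean_Zn_tendsto)
  with 1 have "(\<lambda>n. saddle n ^ (l - 1) * mu n + sqrt (var0 * saddle n ^ (l - 1)) * mean_Zn n) \<longlonglongrightarrow> resid * fact (l - 2) + 0"
    by (intro tendsto_add) auto
  also have "resid * fact (l - 2) + 0 = Kc / (real l - 1)" using l_ge_2 by (simp add: Kc_eq' field_simps)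
  finally show "(\<lambda>n. saddle n ^ (l - 1) * mean_orbits l x n) \<longlonglongrightarrow> Kc / (real l - 1)"
  proof (rule Lim_transform_eventually)
    show "\<forall>\<^sub>F n in sequentially. saddle n ^ (l - 1) * mu n + sqrt (var0 * saddle n ^ (l - 1)) * mean_Zn n = saddle n ^ (l - 1) * mean_orbits l x n"
      using eventually_gt_at_top[of 0]
    proof eventually_elim
      case (elim n)
      let ?u = "saddle n ^ (l - 1)"
      have t: "0 < saddle n" using saddle[OF elim] by simp
      have "sqrt (var0 * ?u) = sqrt ((?u * sg n)\<^sup>2)"
        unfolding power_mult_distrib using sg_sq[OF elim] by (simp add: power2_eq_square mult_ac)
      also have "\<dots> = ?u * sg n" using t sd_pos[OF t] by (simp add: sg_def)
      finally show ?case by (simp add: mean_orbits_eq[OF elim] distrib_left mult.assoc)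
    qed
  qed
qed

text \<open>t^(l-1) \<open>sg\<close>^2 equals \<open>var0\<close> exactly, so what remains is that
  the variance of \<open>Zn\<close> tends to 1.\<close>

lemma var_asymp:
  "var_orbits l x \<sim>[at_top] (\<lambda>n. Kc powr (1 / real l) / (real l * (real l - 1)) * real n powr ((real l - 1) / real l))"
proof (rule asymp_equiv_power_rate)
  show "real l * (real l - 1) \<noteq> 0" using l_ge_2 by simp
  have "(\<lambda>n. var0 * (second_Zn n - (mean_Zn n)\<^sup>2)) \<longlonglongrightarrow> var0 * (1 - 0\<^sup>2)"
    by (intro tendsto_intros second_Zn_tendsto mean_Zn_tendsto)
  also have "var0 * (1 - 0\<^sup>2) = Kc / (real l * (real l - 1))" using l_ge_2 by (simp add: Kc_eq' var0_def field_simps)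
  finally show "(\<lambda>n. saddle n ^ (l - 1) * var_orbits l x n) \<longlonglongrightarrow> Kc / (real l * (real l - 1))"
  proof (rule Lim_transform_eventually)
    show "\<forall>\<^sub>F n in sequentially. var0 * (second_Zn n - (mean_Zn n)\<^sup>2) = saddle n ^ (l - 1) * var_orbits l x n"
      using eventually_gt_at_top[of 0]
    proof eventually_elim
      case (elim n)
      show ?case unfolding var_orbits_eq[OF elim] sg_sq[OF elim, symmetric] by simp
    qed
  qed
qed

definition Wn :: "nat \<Rightarrow> (nat \<Rightarrow> nat) list \<Rightarrow> real" where
  "Wn n w = (Zn n w - mean_Zn n) / sd_Zn n"

lemma normalized_eq_Wn:
  assumes n: "0 < n"
  shows "(real (num_orbits n w) - mean_orbits l x n) / sqrt (var_orbits l x n) = Wn n w"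
proof -
  have sg: "0 < sg n" using saddle[OF n] by (simp add: sg_def sd_pos)
  have "sqrt (var_orbits l x n) = sg n * sd_Zn n"
    unfolding var_orbits_eq[OF n] sd_Zn_def using sg by (simp add: real_sqrt_mult)
  moreover have "real (num_orbits n w) - mean_orbits l x n = sg n * (Zn n w - mean_Zn n)"
    unfolding mean_orbits_eq[OF n] num_orbits_eq_Zn[OF n] by (simp add: algebra_simps)
  ultimately show ?thesis using sg by (simp add: Wn_def)
qed

lemma inverse_sd_Zn_tendsto: "(\<lambda>n. 1 / sd_Zn n) \<longlonglongrightarrow> 1"
  using tendsto_divide[OF tendsto_const sd_Zn_tendsto, of 1] by simp

text \<open>exp (i v \<open>Wn\<close>) is a deterministic factor times exp (z_n \<open>Zn\<close>),
  where z_n = i v / \<open>sd_Zn\<close> tends to i v. Convergence along moving arguments is used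
  here.\<close>

lemma Wn_char: "(\<lambda>n. LINT w|TM n. exp (\<i> * of_real v * of_real (Wn n w))) \<longlonglongrightarrow> of_real (exp (- v\<^sup>2 / 2))"
proof -
  let ?z = "\<lambda>n. \<i> * of_real v * of_real (1 / sd_Zn n)"
  have z: "?z \<longlonglongrightarrow> \<i> * of_real v * of_real 1" by (intro tendsto_intros inverse_sd_Zn_tendsto)
  then have "?z \<longlonglongrightarrow> \<i> * of_real v" by simp
  from expectation_exp_Zn_tendsto[OF this]
  have "(\<lambda>n. exp (- (?z n * of_real (mean_Zn n))) * (LINT w|TM n. exp (?z n * of_real (Zn n w)))) \<longlonglongrightarrow>
    exp (- (\<i> * of_real v * of_real 1 * of_real 0)) * of_real (exp (- v\<^sup>2 / 2))"
    by (intro tendsto_mult tendsto_exp tendsto_minus tendsto_of_real mean_Zn_tendsto z)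
  \<comment> \<open>The identity holds for every n: if \<open>sd_Zn n\<close> = 0, division by zero
    makes both \<open>?z n\<close> and \<open>Wn n w\<close> zero.\<close>
  moreover have "exp (- (?z n * of_real (mean_Zn n))) * (LINT w|TM n. exp (?z n * of_real (Zn n w))) =
    (LINT w|TM n. exp (\<i> * of_real v * of_real (Wn n w)))" for n
    unfolding integral_mult_right_zero[symmetric] mult_exp_exp
    by (rule Bochner_Integration.integral_cong[OF refl], rule arg_cong[of _ _ exp])
       (simp add: Wn_def diff_divide_distrib right_diff_distrib)
  ultimately show ?thesis by simp
qed

lemma Wn_exp_Bseq: "Bseq (\<lambda>n. LINT w|TM n. exp (c * Wn n w))"
proof -
  let ?z = "\<lambda>n. c * (1 / sd_Zn n)"
  have z: "?z \<longlonglongrightarrow> c * 1" by (intro tendsto_intros inverse_sd_Zn_tendsto)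
  have "(\<lambda>n. exp (- (?z n * mean_Zn n))) \<longlonglongrightarrow> exp (- (c * 1 * 0))"
    by (intro tendsto_intros z mean_Zn_tendsto)
  then have "Bseq (\<lambda>n. exp (- (?z n * mean_Zn n)))" by (intro convergent_imp_Bseq) (auto simp: convergent_def)
  moreover have "Bseq (\<lambda>n. LINT w|TM n. exp (?z n * Zn n w))"
    by (rule expectation_exp_Zn_Bseq) (use z in \<open>auto simp: convergent_def\<close>)
  ultimately have "Bseq (\<lambda>n. exp (- (?z n * mean_Zn n)) * (LINT w|TM n. exp (?z n * Zn n w)))" by (rule Bseq_mult)
  moreover have "exp (- (?z n * mean_Zn n)) * (LINT w|TM n. exp (?z n * Zn n w)) = (LINT w|TM n. exp (c * Wn n w))" for n
    unfolding integral_mult_right_zero[symmetric] mult_exp_exp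
    by (rule Bochner_Integration.integral_cong[OF refl], rule arg_cong[of _ _ exp])
       (simp add: Wn_def diff_divide_distrib right_diff_distrib)
  ultimately show ?thesis by simp
qed

lemma Wn_exp_Bseqs: "Bseq (\<lambda>n. LINT w|TM n. exp (Wn n w))" "Bseq (\<lambda>n. LINT w|TM n. exp (- Wn n w))"
  using Wn_exp_Bseq[of 1] Wn_exp_Bseq[of "- 1"] by simp_all

lemmas Wn_limit = TM_prob TM_measurable Wn_char integrable_tuple_measure integrable_tuple_measure Wn_exp_Bseqs

text \<open>Polynomials reduce to the moments by linearity; bounded continuous functions are covered
  by weak convergence.\<close>

lemma Wn_tendsto:
  assumes "bounded (range f) \<and> continuous_on UNIV f \<or> (\<exists>p :: real poly. f = poly p)"
  shows "(\<lambda>n. LINT w|TM n. f (Wn n w)) \<longlonglongrightarrow> (LINT y|std_normal_distribution. f y)"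
  using assms
proof
  assume f: "bounded (range f) \<and> continuous_on UNIV f"
  then obtain B where "\<And>y. \<bar>f y\<bar> \<le> B" by (auto simp: bounded_iff)
  moreover have "isCont f y" for y using f by (simp add: continuous_on_eq_continuous_at)
  ultimately show ?thesis by (intro gaussian_limit_bounded[OF Wn_limit]) auto
next
  assume "\<exists>p :: real poly. f = poly p"
  then obtain p where p: "f = poly p" by auto
  have 1: "(LINT w|TM n. f (Wn n w)) = (\<Sum>i\<le>degree p. coeff p i * (LINT w|TM n. Wn n w ^ i))" for n
    unfolding p poly_altdef by (simp add: integrable_tuple_measure)
  have 2: "(LINT y|std_normal_distribution. f y) = (\<Sum>i\<le>degree p. coeff p i * (LINT y|std_normal_distribution. y ^ i))"
    unfolding p poly_altdef by (simp add: integrable_std_normal_distribution_moment)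
  show ?thesis unfolding 1 2
    by (intro tendsto_sum tendsto_mult tendsto_const gaussian_limit_moment[OF Wn_limit])
qed

end

theorem theorem1p1:
  fixes l :: nat and x :: real
  assumes "l \<ge> 2" and "x > 0"
  shows "mean_orbits l x \<sim>[at_top]
      (\<lambda>n. (x * zeta_const l) powr (1 / real l) / (real l - 1)
              * real n powr ((real l - 1) / real l)) \<and>
    var_orbits l x \<sim>[at_top]
      (\<lambda>n. (x * zeta_const l) powr (1 / real l) / (real l * (real l - 1))
              * real n powr ((real l - 1) / real l)) \<and>
    (\<forall>f :: real \<Rightarrow> real.
      (bounded (range f) \<and> continuous_on UNIV f) \<or> (\<exists>p :: real poly. f = poly p) \<longrightarrow>
      (\<lambda>n. prob_space.expectation (tuple_measure l n x)
             (\<lambda>\<sigma>. f ((real (num_orbits n \<sigma>) - mean_orbits l x n) / sqrt (var_orbits l x n))))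
        \<longlonglongrightarrow> 1 / sqrt (2 * pi) * (LBINT s. f s * exp (- s\<^sup>2 / 2)))"
proof -
  interpret orbit_saddle l x using assms by unfold_locales
  show ?thesis
  proof (intro conjI allI impI)
    fix f :: "real \<Rightarrow> real"
    assume f: "bounded (range f) \<and> continuous_on UNIV f \<or> (\<exists>p :: real poly. f = poly p)"
    \<comment> \<open>Both kinds of f are continuous, which provides the measurability for the
      density formula.\<close>
    then have "continuous_on UNIV f" by (auto intro: continuous_intros)
    then have meas: "f \<in> borel_measurable borel" by (rule borel_measurable_continuous_onI)
    have "(\<lambda>n. LINT \<sigma>|TM n. f (Wn n \<sigma>)) \<longlonglongrightarrow> 1 / sqrt (2 * pi) * (LBINT s. f s * exp (- s\<^sup>2 / 2))"
      using Wn_tendsto[OF f] unfolding integral_std_normal_distribution[OF meas] .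
    then show "(\<lambda>n. LINT \<sigma>|TM n. f ((real (num_orbits n \<sigma>) - mean_orbits l x n) / sqrt (var_orbits l x n)))
        \<longlonglongrightarrow> 1 / sqrt (2 * pi) * (LBINT s. f s * exp (- s\<^sup>2 / 2))"
    proof (rule Lim_transform_eventually)
      show "\<forall>\<^sub>F n in sequentially. (LINT \<sigma>|TM n. f (Wn n \<sigma>)) =
        (LINT \<sigma>|TM n. f ((real (num_orbits n \<sigma>) - mean_orbits l x n) / sqrt (var_orbits l x n)))"
        using eventually_gt_at_top[of 0] by eventually_elim (simp add: normalized_eq_Wn)
    qed
  qed (use mean_asymp var_asymp in \<open>simp_all add: Kc_def\<close>)
qed

end
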